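(* Let $p$ be a prime with $p \equiv 1 \pmod 3$, let $s,m$ be positive integers, $q=p^s$, $r=q^m$, and let $\alpha$ be a generator of $\mathrm{GF}(r)^*$. Let $h$ be a positive divisor of $q-1$, and let $e=3$, where it is assumed that $3 \mid \gcd(q-1,hm)$. Put $g=\alpha^{(q-1)/h}$, $n=\frac{h(r-1)}{q-1}$, $\beta=\alpha^{(r-1)/3}$, and assume $N:=\gcd\left(\frac{r-1}{q-1},\frac{3(q-1)}{h}\right)=3$. Let $\mathrm{Tr}$ be the trace from $\mathrm{GF}(r)$ to $\mathrm{GF}(q)$ and consider the cyclic code $\mathcal{C}=\{\mathbf{c}_{(a,b)}: a,b\in\mathrm{GF}(r)\}$ over $\mathrm{GF}(q)$ with $\mathbf{c}_{(a,b)}=\left(\mathrm{Tr}(ag^i+b(\beta g)^i)\right)_{i=0}^{n-1}$, and define $\lambda(a,b)=\frac{h(r-1)}{q}-w(\mathbf{c}_{(a,b)})$, $w$ the Hamming weight. Let $\omega=\frac{-1+\sqrt{-3}}{2}$ and let $\pi\in\mathbb{Z}[\omega]$ satisfy $\pi\bar\pi=p$ and $\pi\equiv -1 \pmod{3\mathbb{Z}[\omega]}$. Identify $\mathbb{Z}[\omega]/\pi\mathbb{Z}[\omega]$ with $\mathrm{GF}(p)\subseteq \mathrm{GF}(r)$ via $\mathbb{Z}\to\mathbb{Z}[\omega]$, and define the cubic character $\rho$ of $\mathrm{GF}(r)^*$ by letting $\rho(x)$ be the unique $\zeta\in\{1,\omega,\omega^2\}$ with $\zeta \equiv N_{r/p}(x)^{(p-1)/3}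 \pmod{\pi\mathbb{Z}[\omega]}$, where $N_{r/p}:\mathrm{GF}(r)\to\mathrm{GF}(p)$ is the norm. Let $\psi$ be the canonical additive character of $\mathrm{GF}(r)$, $C^{(3,r)}$ the subgroup of nonzero cubes in $\mathrm{GF}(r)^*$, and for $u\in\mathrm{GF}(r)^*$ let $\eta_u=\sum_{z\in C^{(3,r)}}\psi(zu)$. Let $r^{1/3}=p^{sm/3}$ (here $3\mid m$). Then $\eta_1=\frac{(-1)^{sm+1}r^{1/3}(\pi^{sm/3}+\bar\pi^{sm/3})-1}{3}$, $\eta_\alpha=\frac{(-1)^{sm+1}r^{1/3}(\rho^2(\alpha)\pi^{sm/3}+\rho(\alpha)\bar\pi^{sm/3})-1}{3}$, $\eta_{\alpha^2}=\frac{(-1)^{sm+1}r^{1/3}(\rho(\alpha)\pi^{sm/3}+\rho^2(\alpha)\bar\pi^{sm/3})-1}{3}$. Moreover, write $X=(-1)^{ms}(\pi^{ms}+\bar\pi^{ms})$, $Y=(-1)^{ms}(\rho^2(\alpha)\pi^{ms}+\rho(\alpha)\bar\pi^{ms})$, $Z=(-1)^{ms}(\rho(\alpha)\pi^{ms}+\rho^2(\alpha)\bar\pi^{ms})$. As $(a,b)$ ranges over $\mathrm{GF}(r)^2$, the values of $\lambda(a,b)$ are distributed as follows (value: number of pairs; if listed values coincide, their numbers are added): (1) If $3\mid\frac{q-1}{h}$: $\frac{3h}{q}\eta_1$, $\frac{3h}{q}\eta_\alpha$, $\frac{3h}{q}\eta_{\alpha^2}$: each $\frac{r-1}{27}(r-8-X)$;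 $\frac{h}{q}(2\eta_1+\eta_\alpha)$: $\frac{r-1}{9}(r-2-Y)$; $\frac{h}{q}(2\eta_1+\eta_{\alpha^2})$: $\frac{r-1}{9}(r-2-Z)$; $\frac{h}{q}(2\eta_\alpha+\eta_1)$: $\frac{r-1}{9}(r-2-Z)$; $\frac{h}{q}(2\eta_\alpha+\eta_{\alpha^2})$: $\frac{r-1}{9}(r-2-Y)$; $\frac{h}{q}(2\eta_{\alpha^2}+\eta_1)$: $\frac{r-1}{9}(r-2-Y)$; $\frac{h}{q}(2\eta_{\alpha^2}+\eta_\alpha)$: $\frac{r-1}{9}(r-2-Z)$; $-\frac{h}{q}$: $\frac{2(r-1)}{9}(r+1-X)$; $\frac{h}{3q}(r-1+6\eta_1)$, $\frac{h}{3q}(r-1+6\eta_\alpha)$, $\frac{h}{3q}(r-1+6\eta_{\alpha^2})$: each $r-1$; $\frac{h(r-1)}{q}$: $1$. (2) If $3\nmid\frac{q-1}{h}$: $\frac{3h}{q}\eta_1$, $\frac{3h}{q}\eta_\alpha$, $\frac{3h}{q}\eta_{\alpha^2}$: each $\frac{r-1}{27}(r+1-X)$; $\frac{h}{q}(2\eta_1+\eta_\alpha)$: $\frac{r-1}{9}(r-2-Y)$; $\frac{h}{q}(2\eta_1+\eta_{\alpha^2})$: $\frac{r-1}{9}(r-2-Z)$; $\frac{h}{q}(2\eta_\alpha+\eta_1)$: $\frac{r-1}{9}(r-2-Z)$; $\frac{h}{q}(2\eta_\alpha+\eta_{\alpha^2})$: $\frac{r-1}{9}(r-2-Y)$; $\frac{h}{q}(2\eta_{\alpha^2}+\eta_1)$: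 $\frac{r-1}{9}(r-2-Y)$; $\frac{h}{q}(2\eta_{\alpha^2}+\eta_\alpha)$: $\frac{r-1}{9}(r-2-Z)$; $-\frac{h}{q}$: $\frac{r-1}{9}(2r-7-2X)$; $\frac{h}{q}\left(\frac{r-1}{3}+\eta_1+\eta_\alpha\right)$, $\frac{h}{q}\left(\frac{r-1}{3}+\eta_1+\eta_{\alpha^2}\right)$, $\frac{h}{q}\left(\frac{r-1}{3}+\eta_\alpha+\eta_{\alpha^2}\right)$: each $r-1$; $\frac{h(r-1)}{q}$: $1$.
   Context: $\bar\pi$ denotes complex conjugation. The canonical additive character of $\mathrm{GF}(r)$ is $\psi(x)=\exp\left(\frac{2\pi i}{p}\mathrm{Tr}_p(x)\right)$, where $\mathrm{Tr}_p$ is the trace from $\mathrm{GF}(r)$ to $\mathrm{GF}(p)$ (the $\pi$ in this exponential is the real number). $N_{r/p}(x)\in\mathrm{GF}(p)$ is identified with an integer mod $p$ when reducing modulo $\pi\mathbb{Z}[\omega]$. The Hamming weight of a vector is its number of nonzero coordinates. *)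

theory Defs
  imports Complex_Main "HOL-Computational_Algebra.Primes"
begin

section \<open>Trace, norm and the prime field\<close>

text \<open>
  A finite field \<open>GF(r)\<close> is a type \<open>'a\<close> of class \<open>finite_field\<close> with \<open>r\<close> elements. Its subfields are
  subsets of \<open>'a\<close>; the Galois group of \<open>GF(Q^k)\<close> over \<open>GF(Q)\<close> consists of the maps
  \<open>x \<mapsto> x^(Q^i)\<close> with \<open>i < k\<close>. The two definitions below are the trace and the norm from \<open>GF(Q^k)\<close> to
  \<open>GF(Q)\<close>, and are meaningful only if \<open>'a\<close> has \<open>Q^k\<close> elements.
\<close>

definition field_trace :: "nat \<Rightarrow> nat \<Rightarrow> 'a::finite_field \<Rightarrow> 'a" where
  "field_trace Q k x = (\<Sum>i<k. x ^ (Q ^ i))"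

definition field_norm :: "nat \<Rightarrow> nat \<Rightarrow> 'a::finite_field \<Rightarrow> 'a" where
  "field_norm Q k x = (\<Prod>i<k. x ^ (Q ^ i))"

text \<open>
  The identification of the prime field with the integers modulo \<open>p\<close>: the representative in
  \<open>{0..<p}\<close> of an element of the prime field. It is unspecified for all other elements.
\<close>

definition prime_field_rep :: "'a::finite_field \<Rightarrow> nat" where
  "prime_field_rep x = (LEAST k. of_nat k = x)"

definition field_generator :: "'a::finite_field \<Rightarrow> bool" where
  "field_generator \<alpha> \<longleftrightarrow> range (\<lambda>k::nat. \<alpha> ^ k) = UNIV - {0}"


section \<open>The cyclic code\<close>

definition codeword :: "nat \<Rightarrow> nat \<Rightarrow> nat \<Rightarrow> 'a::finite_field \<Rightarrow> 'a \<Rightarrow> 'a \<Rightarrow> 'a \<Rightarrow> 'a list" where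
  "codeword q m n g \<beta> a b = map (\<lambda>i. field_trace q m (a * g ^ i + b * (\<beta> * g) ^ i)) [0..<n]"

definition hamming_weight :: "'a::zero list \<Rightarrow> nat" where
  "hamming_weight c = card {i. i < length c \<and> c ! i \<noteq> 0}"

text \<open>
  \<open>D\<close> lists pairs of a value and a multiplicity. The multiplicities of equal values are added, and
  values that are not listed do not occur. The multiplicities are complex numbers since they are
  given by formulas over the complex numbers.
\<close>

definition has_value_distribution ::
    "('b::finite \<Rightarrow> complex) \<Rightarrow> (complex \<times> complex) list \<Rightarrow> bool" where
  "has_value_distribution f D \<longleftrightarrow>
     (\<forall>v. of_nat (card {x. f x = v}) = (\<Sum>(u, c)\<leftarrow>D. if u = v then c else 0))"


section \<open>Gaussian periods\<close>

text \<open>The canonical additive character of a field with \<open>p^d\<close> elements.\<close>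

definition additive_char :: "nat \<Rightarrow> nat \<Rightarrow> 'a::finite_field \<Rightarrow> complex" where
  "additive_char p d x =
     exp (2 * of_real pi * \<i> / of_nat p * of_nat (prime_field_rep (field_trace p d x)))"

definition nonzero_cubes :: "'a::finite_field set" where
  "nonzero_cubes = {y ^ 3 | y. y \<noteq> 0}"

definition cubic_period :: "nat \<Rightarrow> nat \<Rightarrow> 'a::finite_field \<Rightarrow> complex" where
  "cubic_period p d u = (\<Sum>z\<in>nonzero_cubes. additive_char p d (z * u))"


section \<open>Eisenstein integers and the cubic character\<close>

definition omega :: complex where
  "omega = (-1 + \<i> * of_real (sqrt 3)) / 2"

definition eisenstein_ints :: "complex set" where
  "eisenstein_ints = {of_int a + of_int b * omega | a b. True}"

definition eisenstein_cong :: "complex \<Rightarrow> complex \<Rightarrow> complex \<Rightarrow> bool" where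
  "eisenstein_cong x y \<mu> \<longleftrightarrow> (\<exists>z\<in>eisenstein_ints. x - y = \<mu> * z)"

text \<open>
  In a field with \<open>p^d\<close> elements, where \<open>\<pi>\<close> is an Eisenstein prime of norm \<open>p\<close>. The symbol
  \<open>\<pi>\<close> is an ordinary variable, not the real constant \<open>pi\<close>.
\<close>

definition cubic_char :: "nat \<Rightarrow> nat \<Rightarrow> complex \<Rightarrow> 'a::finite_field \<Rightarrow> complex" where
  "cubic_char p d \<pi> x =
     (THE \<zeta>. \<zeta> \<in> {1, omega, omega ^ 2} \<and>
        eisenstein_cong \<zeta> (of_nat (prime_field_rep (field_norm p d x)) ^ ((p - 1) div 3)) \<pi>)"

end

theory Submission
  imports Defs "HOL-Computational_Algebra.Polynomial" "HOL-Number_Theory.Cong"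
begin

text \<open>
  Let \<open>\<rho>\<close> be the cubic character and \<open>G\<close> its Gauss sum over \<open>GF(r)\<close>, \<open>r = p\<^sup>d\<close>. Then \<open>G\<^sup>3 = r J\<close> with the
  Jacobi sum \<open>J = J(\<rho>, \<rho>)\<close>, which is an Eisenstein integer of norm \<open>p\<^sup>d\<close>. Modulo \<open>\<pi>\<close> the conjugate of
  \<open>J\<close> is a power sum over \<open>GF(r)\<close> equal to a central binomial coefficient up to sign, and this is not
  divisible by \<open>p\<close>; hence \<open>J = u \<pi>\<^sup>d\<close> with a unit \<open>u\<close>. Since \<open>3\<close> divides \<open>d\<close>, the prime field consists of
  cubes, so \<open>G = - p S\<close> with \<open>S\<close> the sum of \<open>\<rho>\<close> over the elements of trace 1, and the orbits of length 3 of
  the Frobenius map of order 3 give \<open>S \<equiv> 1\<close>, hence \<open>G \<equiv> - 1\<close>, modulo 3. This fixes the unit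
  \<open>u\<close> and the cube root of \<open>r J\<close>, so no Hasse-Davenport lifting is needed.

  Orthogonality of characters turns \<open>\<lambda>(a, b)\<close> into a sum of three cubic periods, evaluated at \<open>x\<close>, \<open>g y\<close>
  and \<open>g\<^sup>2 (x + y)\<close> for a linear bijection \<open>(a, b) \<mapsto> (x, y)\<close>. The numbers of \<open>(x, y)\<close> for which \<open>x\<close>, \<open>y\<close> and
  \<open>x + y\<close> lie in prescribed cubic classes are cubic expressions in the periods and follow from \<open>G\<close>.
\<close>

text \<open>The congruence modulo 3 decides so much because 1 is the only Eisenstein unit congruent
  to 1 modulo 3: it selects one of six candidates for \<open>u\<close> and one of three cube roots
  of \<open>r J\<close>. The reduction modulo \<pi> has to come first, to tell \<pi> from its
  conjugate: there \<rho> becomes the power map with exponent \<open>(r - 1) / 3\<close>, and a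
  nonzero residue of the conjugate of \<open>J\<close> says that the conjugate of \<pi> does not
  divide \<open>J\<close>.

  The divisibility of \<open>d\<close> by 3 comes from the gcd hypothesis:
  \<open>(r - 1) / (q - 1)\<close> is a sum of \<open>m\<close> powers of \<open>q\<close>, hence
  congruent to \<open>m\<close> modulo 3. It makes \<open>r - 1\<close> divisible by 9, so \<beta>
  is a cube, and \<open>1 + \<beta> + \<beta>\<^sup>2 = 0\<close> then links the three arguments of
  the periods.

  Listed values of \<lambda> can coincide, so no single value is counted in isolation. Arbitrary
  functions of the value are summed instead, and the indicator of one value is inserted at the
  end.\<close>

lemma of_nat_card_UNIV_eq_0: "of_nat (card (UNIV :: 'a::finite_field set)) = (0 :: 'a)"
proof -
  \<comment> \<open>Translation by 1 permutes the field; cancelling the common sum leaves the number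
    of elements.\<close>
  have "(\<Sum>x\<in>UNIV. x + 1 :: 'a) = (\<Sum>x\<in>UNIV. x)"
    by (rule sum.reindex_bij_witness[of _ "\<lambda>x. x - 1" "\<lambda>x. x + 1"]) auto
  then show ?thesis by (simp add: sum.distrib)
qed

lemma frobenius_add_prime:
  fixes x y :: "'a::comm_semiring_1"
  assumes "prime p" "of_nat p = (0::'a)"
  shows "(x + y) ^ p = x ^ p + y ^ p"
proof -
  have p: "p > 1" using assms(1) prime_gt_1_nat by blast
  have "(x + y) ^ p = (\<Sum>k\<le>p. of_nat (p choose k) * x ^ k * y ^ (p - k))"
    by (rule binomial_ring)
  also have "\<dots> = (\<Sum>k\<in>{0,p}. of_nat (p choose k) * x ^ k * y ^ (p - k))"
  proof (rule sum.mono_neutral_right)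
    show "\<forall>i\<in>{..p} - {0, p}. of_nat (p choose i) * x ^ i * y ^ (p - i) = 0"
    proof
      fix i assume i: "i \<in> {..p} - {0, p}"
      then have "p dvd (p choose i)"
        using assms(1) p by (intro dvd_choose_prime) auto
      then obtain c where "p choose i = p * c" by (auto elim: dvdE)
      then show "of_nat (p choose i) * x ^ i * y ^ (p - i) = 0" using assms(2) by simp
    qed
  qed auto
  also have "\<dots> = x ^ p + y ^ p" using p by (simp add: add.commute)
  finally show ?thesis .
qed

lemma frobenius_add:
  fixes x y :: "'a::comm_semiring_1"
  assumes "prime p" "of_nat p = (0::'a)"
  shows "(x + y) ^ (p ^ k) = x ^ (p ^ k) + y ^ (p ^ k)"
proof (induction k)
  case (Suc k)
  have "(x + y) ^ (p ^ Suc k) = ((x + y) ^ (p ^ k)) ^ p"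
    by (simp add: power_mult[symmetric] mult.commute)
  also have "\<dots> = x ^ (p ^ Suc k) + y ^ (p ^ Suc k)"
    by (simp add: Suc frobenius_add_prime[OF assms] power_mult[symmetric] mult.commute)
  finally show ?case .
qed simp

lemma frobenius_sum:
  fixes f :: "'b \<Rightarrow> 'a::comm_semiring_1"
  assumes "prime p" "of_nat p = (0::'a)"
  shows "(\<Sum>i\<in>A. f i) ^ (p ^ k) = (\<Sum>i\<in>A. f i ^ (p ^ k))"
proof -
  have "p > 0" using assms(1) prime_gt_0_nat by blast
  then show ?thesis
    by (induction A rule: infinite_finite_induct) (simp_all add: frobenius_add[OF assms] power_0_left)
qed

section \<open>Finite fields with a generator, traces and additive characters\<close>

locale finite_field_gen =
  fixes p d :: nat and \<alpha> :: "'a::finite_field"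
  assumes prime_p: "prime p" and card_UNIV: "card (UNIV :: 'a set) = p ^ d"
    and gen: "field_generator \<alpha>"
begin

abbreviation "r \<equiv> p ^ d"

lemma p_gt_1: "p > 1" using prime_p prime_gt_1_nat by blast

lemma p_pos [simp]: "p > 0" using p_gt_1 by simp

lemma p_nz [simp]: "p \<noteq> 0" using p_gt_1 by simp

lemma d_pos: "d > 0"
proof (rule ccontr)
  assume "\<not> d > 0"
  then have c: "card (UNIV :: 'a set) = 1" using card_UNIV by simp
  then obtain z where "(UNIV :: 'a set) = {z}" using card_1_singletonE by blast
  then have "(0::'a) = z" "(1::'a) = z" by auto
  then show False by simp
qed

definition "M = r - 1"

lemma r_gt_1: "r > 1" using p_gt_1 d_pos one_less_power by blast

lemma CHAR_eq: "CHAR('a) = p"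
proof -
  have "of_nat (p ^ d) = (0 :: 'a)" using of_nat_card_UNIV_eq_0 card_UNIV by metis
  then have "CHAR('a) dvd p ^ d" using of_nat_eq_0_iff_char_dvd by blast
  then have "CHAR('a) dvd p" using prime_dvd_power[OF CHAR_prime] by blast
  then show ?thesis using CHAR_prime prime_p primes_dvd_imp_eq by blast
qed

lemma of_nat_p: "of_nat p = (0 :: 'a)" using CHAR_eq of_nat_CHAR by metis

lemmas frob_add = frobenius_add[OF prime_p of_nat_p]
lemmas frob_sum = frobenius_sum[OF prime_p of_nat_p]

lemma of_nat_eq_iff: "of_nat a = (of_nat b :: 'a) \<longleftrightarrow> a mod p = b mod p"
  using of_nat_eq_iff_cong_CHAR[where 'a='a, of a b] by (simp add: CHAR_eq cong_def)

lemma of_int_eq_0_iff: "of_int a = (0 :: 'a) \<longleftrightarrow> int p dvd a"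
  by (simp add: of_int_eq_0_iff_char_dvd CHAR_eq)

lemma r_eq: "r = Suc M" using r_gt_1 by (simp add: M_def)

lemma M_pos: "M > 0" using r_gt_1 by (simp add: M_def)

lemma power_card: "x ^ r = x" for x :: 'a
  using finite_field_power_card_eq_same card_UNIV by metis

lemma power_r_minus_1: "x \<noteq> 0 \<Longrightarrow> x ^ M = 1" for x :: 'a
proof -
  assume x: "x \<noteq> 0"
  have "x * x ^ M = x ^ r" by (simp add: r_eq)
  then show ?thesis using power_card[of x] x by simp
qed

lemma gen_range: "range (\<lambda>k::nat. \<alpha> ^ k) = UNIV - {0}"
  using gen unfolding field_generator_def .

lemma gen_nz: "\<alpha> \<noteq> 0"
proof -
  have "\<alpha> ^ 1 \<in> UNIV - {0}" using gen_range by blast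
  then show ?thesis by simp
qed

lemma gen_power_mod: "\<alpha> ^ (k mod M) = \<alpha> ^ k"
proof -
  have "\<alpha> ^ k = \<alpha> ^ (M * (k div M) + k mod M)" by simp
  also have "\<dots> = (\<alpha> ^ M) ^ (k div M) * \<alpha> ^ (k mod M)"
    by (simp only: power_add power_mult)
  also have "\<dots> = \<alpha> ^ (k mod M)" by (simp add: power_r_minus_1 gen_nz)
  finally show ?thesis by simp
qed

lemma gen_image: "(\<lambda>k. \<alpha> ^ k) ` {..<M} = UNIV - {0}"
proof -
  have "\<alpha> ^ k \<in> (\<lambda>k. \<alpha> ^ k) ` {..<M}" for k
    using M_pos by (intro image_eqI[of _ _ "k mod M"]) (auto simp: gen_power_mod)
  then have "(\<lambda>k. \<alpha> ^ k) ` {..<M} = range (\<lambda>k. \<alpha> ^ k)" by blast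
  then show ?thesis by (simp only: gen_range)
qed

text \<open>The \<open>M\<close> exponents already reach all \<open>M\<close> units, so counting
  gives injectivity. This fixes the order of \<alpha>.\<close>

lemma bij_gen: "bij_betw (\<lambda>k. \<alpha> ^ k) {..<M} (UNIV - {0})"
proof -
  have "card (UNIV - {0 :: 'a}) = M" by (simp add: card_UNIV card_Diff_subset M_def)
  then have "inj_on (\<lambda>k. \<alpha> ^ k) {..<M}"
    by (intro eq_card_imp_inj_on) (simp_all only: gen_image finite_lessThan card_lessThan)
  then show ?thesis using gen_image by (simp add: bij_betw_def)
qed

lemma gen_power_eq_iff: "\<alpha> ^ j = \<alpha> ^ k \<longleftrightarrow> j mod M = k mod M"
proof
  assume "\<alpha> ^ j = \<alpha> ^ k"
  then have "\<alpha> ^ (j mod M) = \<alpha> ^ (k mod M)" by (simp only: gen_power_mod)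
  moreover have "j mod M < M" "k mod M < M" using M_pos by auto
  ultimately show "j mod M = k mod M"
    by (intro inj_onD[OF bij_betw_imp_inj_on[OF bij_gen]]) simp_all
next
  assume "j mod M = k mod M"
  then show "\<alpha> ^ j = \<alpha> ^ k" by (metis gen_power_mod)
qed

lemma gen_power_eq_1_iff: "\<alpha> ^ j = 1 \<longleftrightarrow> M dvd j"
  using gen_power_eq_iff[of j 0] by (simp add: dvd_eq_mod_eq_0)

lemma ex_gen_power: "x \<noteq> 0 \<Longrightarrow> \<exists>k. x = \<alpha> ^ k" for x
  using gen_range by blast

section \<open>Subfields as fixed points of Frobenius powers\<close>

definition subfield :: "nat \<Rightarrow> 'a set" where
  "subfield k = {x. x ^ (p ^ k) = x}"

lemma p_power_gt_0: "p ^ k > 0" using p_gt_1 by simp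

lemma zero_subfield [simp]: "0 \<in> subfield k"
  using p_power_gt_0[of k] by (simp add: subfield_def)

lemma one_subfield [simp]: "1 \<in> subfield k" by (simp add: subfield_def)

lemma subfield_add: "x \<in> subfield k \<Longrightarrow> y \<in> subfield k \<Longrightarrow> x + y \<in> subfield k"
  by (simp add: subfield_def frob_add)

lemma subfield_mult: "x \<in> subfield k \<Longrightarrow> y \<in> subfield k \<Longrightarrow> x * y \<in> subfield k"
  by (simp add: subfield_def power_mult_distrib)

lemma subfield_divide: "x \<in> subfield k \<Longrightarrow> y \<in> subfield k \<Longrightarrow> x / y \<in> subfield k"
  by (simp add: subfield_def power_divide)

lemma subfield_of_nat [simp]: "of_nat n \<in> subfield k"
  by (induction n) (auto intro: subfield_add)

text \<open>Additivity of the Frobenius map avoids a case distinction on the sign of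
  \<open>(- 1) ^ (p ^ k)\<close>.\<close>

lemma subfield_minus: "x \<in> subfield k \<Longrightarrow> - x \<in> subfield k"
proof -
  assume x: "x \<in> subfield k"
  have "(x + - x) ^ (p ^ k) = x ^ (p ^ k) + (- x) ^ (p ^ k)" by (rule frob_add)
  moreover have "(0::'a) ^ (p ^ k) = 0" using p_power_gt_0[of k] by simp
  ultimately have "x + (- x) ^ (p ^ k) = 0" using x by (simp add: subfield_def)
  then show ?thesis by (simp add: subfield_def eq_neg_iff_add_eq_0 add.commute)
qed

lemma subfield_diff: "x \<in> subfield k \<Longrightarrow> y \<in> subfield k \<Longrightarrow> x - y \<in> subfield k"
  using subfield_add[of x k "- y"] subfield_minus[of y k] by simp

lemma subfield_d: "subfield d = UNIV" by (simp add: subfield_def power_card)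

lemma subfield_power_mult: "x \<in> subfield k \<Longrightarrow> x ^ (p ^ (k * j)) = x"
  by (induction j) (simp_all add: subfield_def power_add power_mult)

lemma power_minus_1_dvd: "k dvd d \<Longrightarrow> (p ^ k - 1) dvd M"
proof -
  assume "k dvd d"
  then obtain j where j: "d = k * j" by (auto elim: dvdE)
  have 1: "int (p ^ k) - 1 dvd int (p ^ k) ^ j - 1" by (simp only: power_diff_1_eq) simp
  have "p ^ k \<ge> 1" using p_power_gt_0[of k] by linarith
  then have "int (p ^ k - 1) = int (p ^ k) - 1" by (simp only: of_nat_diff of_nat_1)
  moreover have "int M = int (p ^ k) ^ j - 1"
  proof -
    have "int M + 1 = int (p ^ d)" using r_eq by simp
    then show ?thesis by (simp add: j power_mult)
  qed
  ultimately show ?thesis using 1 by (metis of_nat_dvd_iff)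
qed

text \<open>A power of \<alpha> is fixed exactly if \<open>M\<close> divides its exponent times
  \<open>p ^ k - 1\<close>. Since \<open>k dvd d\<close>, the number \<open>p ^ k - 1\<close>
  divides \<open>M\<close>, so the exponents are the multiples of the quotient; listing them also
  gives the size.\<close>

lemma subfield_nz_eq:
  assumes "k dvd d" "k > 0"
  shows "subfield k - {0} = (\<lambda>j. \<alpha> ^ (M div (p ^ k - 1) * j)) ` {..<p ^ k - 1}"
    and "card (subfield k) = p ^ k"
proof -
  define L where "L = M div (p ^ k - 1)"
  have qk: "p ^ k > 1" using p_gt_1 assms(2) one_less_power by blast
  have LM: "L * (p ^ k - 1) = M"
    unfolding L_def using power_minus_1_dvd[OF assms(1)] by simp
  have L0: "L > 0" using LM M_pos by (cases L) auto
  have iff: "\<alpha> ^ j \<in> subfield k \<longleftrightarrow> L dvd j" for j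
  proof -
    have "p ^ k = Suc (p ^ k - 1)" using qk by simp
    then have "(\<alpha> ^ j) ^ (p ^ k) = \<alpha> ^ j * \<alpha> ^ (j * (p ^ k - 1))"
      by (metis power_Suc power_mult)
    then have "\<alpha> ^ j \<in> subfield k \<longleftrightarrow> \<alpha> ^ (j * (p ^ k - 1)) = 1"
      using gen_nz by (simp add: subfield_def)
    also have "\<dots> \<longleftrightarrow> L * (p ^ k - 1) dvd j * (p ^ k - 1)"
      by (simp only: gen_power_eq_1_iff LM)
    also have "\<dots> \<longleftrightarrow> L dvd j" using qk by (simp only: dvd_times_right_cancel_iff)
    finally show ?thesis .
  qed
  have eq: "subfield k - {0} = (\<lambda>j. \<alpha> ^ (L * j)) ` {..<p ^ k - 1}"
  proof (intro equalityI subsetI)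
    fix x assume "x \<in> subfield k - {0}"
    then have "x \<in> (\<lambda>k. \<alpha> ^ k) ` {..<M}" using gen_image by blast
    then obtain i where i: "i < M" "x = \<alpha> ^ i" by auto
    then have "L dvd i" using iff \<open>x \<in> subfield k - {0}\<close> by auto
    then obtain j where "i = L * j" by (auto elim: dvdE)
    moreover have "j < p ^ k - 1" using i(1) L0 LM \<open>i = L * j\<close> by (metis mult_less_cancel1)
    ultimately show "x \<in> (\<lambda>j. \<alpha> ^ (L * j)) ` {..<p ^ k - 1}" using i by auto
  next
    fix x assume "x \<in> (\<lambda>j. \<alpha> ^ (L * j)) ` {..<p ^ k - 1}"
    then obtain j where "x = \<alpha> ^ (L * j)" by blast
    then show "x \<in> subfield k - {0}" using iff[of "L * j"] gen_nz by simp
  qed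
  have "inj_on (\<lambda>j. \<alpha> ^ (L * j)) {..<p ^ k - 1}"
  proof (rule inj_onI)
    fix i j assume ij: "i \<in> {..<p ^ k - 1}" "j \<in> {..<p ^ k - 1}" "\<alpha> ^ (L * i) = \<alpha> ^ (L * j)"
    then have "L * i < M" "L * j < M" using LM L0 by (metis lessThan_iff mult_less_cancel1)+
    then have "L * i = L * j" using iffD1[OF gen_power_eq_iff ij(3)] by (simp only: mod_less)
    then show "i = j" using L0 by simp
  qed
  then have "card (subfield k - {0}) = p ^ k - 1" by (simp only: eq card_image card_lessThan)
  moreover have "card (subfield k) = Suc (card (subfield k - {0}))"
    by (rule card.remove) auto
  ultimately show "card (subfield k) = p ^ k" using qk by linarith
  show "subfield k - {0} = (\<lambda>j. \<alpha> ^ (M div (p ^ k - 1) * j)) ` {..<p ^ k - 1}"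
    using eq by (simp only: L_def)
qed

lemma inj_of_nat: "inj_on (of_nat :: nat \<Rightarrow> 'a) {..<p}"
  by (auto simp: inj_on_def of_nat_eq_iff)

lemma subfield_1: "subfield (Suc 0) = of_nat ` {..<p}"
proof -
  have "card (of_nat ` {..<p} :: 'a set) = p" by (simp add: card_image inj_of_nat)
  moreover have "card (subfield (Suc 0)) = p" using subfield_nz_eq(2)[of 1] by simp
  moreover have "of_nat ` {..<p} \<subseteq> subfield (Suc 0)" by auto
  ultimately show ?thesis using card_subset_eq[of "subfield (Suc 0)" "of_nat ` {..<p}"] by simp
qed

lemma prime_field_rep_of_nat: "prime_field_rep (of_nat a :: 'a) = a mod p"
  unfolding prime_field_rep_def of_nat_eq_iff
proof (rule Least_equality)
  fix y assume "y mod p = a mod p"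
  then show "a mod p \<le> y" by (metis mod_less_eq_dividend)
qed simp

lemma of_nat_prime_field_rep: "x \<in> subfield (Suc 0) \<Longrightarrow> of_nat (prime_field_rep x) = x"
  unfolding subfield_1 by (auto simp: prime_field_rep_of_nat)

section \<open>Traces between subfields\<close>

lemma trace_add: "field_trace (p ^ s) k (x + y) = field_trace (p ^ s) k x + field_trace (p ^ s) k (y::'a)"
  by (simp add: field_trace_def power_mult[symmetric] frob_add sum.distrib flip: power_mult)

lemma trace_scale:
  assumes "c \<in> subfield s"
  shows "field_trace (p ^ s) k (c * x) = c * field_trace (p ^ s) k x"
  using subfield_power_mult[OF assms]
  by (simp add: field_trace_def power_mult_distrib sum_distrib_left flip: power_mult)

lemma trace_0 [simp]: "field_trace (p ^ s) k (0::'a) = 0"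
  by (simp add: field_trace_def power_0_left)

text \<open>Raising to the power \<open>p ^ s\<close> shifts the conjugates cyclically; the last one
  wraps around to \<open>x\<close> by the assumption on \<open>x\<close>.\<close>

lemma trace_subfield:
  assumes "x \<in> subfield (s * k)"
  shows "field_trace (p ^ s) k x \<in> subfield s"
proof (cases k)
  case 0
  then show ?thesis by (simp add: field_trace_def)
next
  case (Suc l)
  have "field_trace (p ^ s) k x ^ (p ^ s) = (\<Sum>i<k. x ^ (p ^ s) ^ Suc i)"
    unfolding field_trace_def frob_sum by (intro sum.cong) (simp_all add: mult.commute flip: power_mult)
  also have "\<dots> = (\<Sum>i<l. x ^ (p ^ s) ^ Suc i) + x ^ (p ^ s) ^ k" by (simp add: Suc)
  also have "x ^ (p ^ s) ^ k = x" using assms by (simp add: subfield_def flip: power_mult)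
  also have "(\<Sum>i<l. x ^ (p ^ s) ^ Suc i) + x = field_trace (p ^ s) k x"
    unfolding field_trace_def Suc sum.lessThan_Suc_shift by simp
  finally show ?thesis by (simp add: subfield_def)
qed

text \<open>Every exponent below \<open>s * k\<close> is \<open>i + s * j\<close> for exactly one
  \<open>i < s\<close> and one \<open>j < k\<close>.\<close>

lemma trace_trace:
  "field_trace p s (field_trace (p ^ s) k x) = field_trace p (s * k) (x::'a)"
proof -
  have "field_trace p s (field_trace (p ^ s) k x) = (\<Sum>i<s. \<Sum>j<k. x ^ (p ^ (i + s * j)))"
    unfolding field_trace_def frob_sum
    by (intro sum.cong refl) (simp add: mult.commute power_add flip: power_mult)
  also have "\<dots> = (\<Sum>j<k. \<Sum>i<s. x ^ (p ^ (i + s * j)))" by (rule sum.swap)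
  also have "\<dots> = (\<Sum>i<s * k. x ^ (p ^ i))"
  proof (induction k)
    case (Suc k)
    have "(\<Sum>i<s * Suc k. x ^ (p ^ i)) = (\<Sum>i<s * k. x ^ (p ^ i)) + (\<Sum>i=s*k..<s*k+s. x ^ (p ^ i))"
      by (subst sum.atLeastLessThan_concat[of 0, symmetric, simplified atLeast0LessThan])
        (auto simp: add.commute atLeast0LessThan)
    also have "(\<Sum>i=s*k..<s*k+s. x ^ (p ^ i)) = (\<Sum>i<s. x ^ (p ^ (i + s * k)))"
      using sum.shift_bounds_nat_ivl[of "\<lambda>i. x ^ (p ^ i)" 0 "s * k" s]
      by (simp add: atLeast0LessThan add.commute)
    finally show ?case using Suc by simp
  qed simp
  finally show ?thesis by (simp add: field_trace_def)
qed

text \<open>A fibre consists of roots of a polynomial of degree \<open>p ^ (k - 1)\<close>, so it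
  has at most that many elements. The \<open>p\<close> fibres share \<open>p ^ k\<close> elements,
  hence no bound can be strict.\<close>

lemma card_trace_fibre:
  assumes k: "k dvd d" "k > 0" and t: "t \<in> subfield (Suc 0)"
  shows "card {x \<in> subfield k. field_trace p k x = t} = p ^ (k - 1)"
proof -
  define N where "N t = card {x \<in> subfield k. field_trace p k x = t}" for t
  have le: "N t \<le> p ^ (k - 1)" for t
  proof -
    define P where "P = (\<Sum>i<k. monom (1::'a) (p ^ i)) - [:t:]"
    have poly_P: "poly P x = field_trace p k x - t" for x
      by (simp add: P_def poly_sum poly_monom field_trace_def)
    \<comment> \<open>Since \<open>p ^ (k - 1)\<close> is positive, the constant \<open>t\<close>
      does not touch this coefficient.\<close>
    have "coeff P (p ^ (k - 1)) = (\<Sum>i<k. if p ^ i = p ^ (k - 1) then 1 else 0)"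
      using p_power_gt_0[of "k - 1"] by (simp add: P_def coeff_sum coeff_pCons split: nat.split)
    also have "\<dots> = (\<Sum>i<k. if i = k - 1 then 1 else 0)"
      using p_gt_1 by (intro sum.cong) (auto simp: power_inject_exp)
    also have "\<dots> = 1" using k by simp
    finally have P0: "P \<noteq> 0" by auto
    have "degree P \<le> p ^ (k - 1)"
      unfolding P_def
    proof (rule degree_diff_le)
      show "degree (\<Sum>i<k. monom (1::'a) (p ^ i)) \<le> p ^ (k - 1)"
        using p_gt_1 by (intro degree_sum_le) (auto intro!: order.trans[OF degree_monom_le] power_increasing)
    qed simp
    have "N t \<le> card {x. poly P x = 0}"
      unfolding N_def by (rule card_mono) (auto simp: poly_P)
    also have "\<dots> \<le> degree P" by (rule card_poly_roots_bound[OF P0])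
    also have "\<dots> \<le> p ^ (k - 1)" by fact
    finally show ?thesis .
  qed
  have "(\<Sum>t\<in>subfield (Suc 0). N t) = card (subfield k)"
  proof -
    have "subfield k = (\<Union>t\<in>subfield (Suc 0). {x \<in> subfield k. field_trace p k x = t})"
      using trace_subfield[of _ 1 k] by auto
    then have "card (subfield k) = card (\<Union>t\<in>subfield (Suc 0). {x \<in> subfield k. field_trace p k x = t})"
      by simp
    also have "\<dots> = (\<Sum>t\<in>subfield (Suc 0). N t)"
      unfolding N_def by (rule card_UN_disjoint) auto
    finally show ?thesis by simp
  qed
  also have "\<dots> = (\<Sum>t\<in>subfield (Suc 0). p ^ (k - 1))"
    using subfield_nz_eq(2)[OF k] subfield_nz_eq(2)[of 1] k
    by (simp flip: power_Suc)
  finally have eq: "(\<Sum>t\<in>subfield (Suc 0). N t) = (\<Sum>t\<in>subfield (Suc 0). p ^ (k - 1))" .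
  show ?thesis
  proof (rule ccontr)
    assume "\<not> ?thesis"
    then have "N t < p ^ (k - 1)" using le[of t] by (simp add: N_def)
    then have "(\<Sum>t\<in>subfield (Suc 0). N t) < (\<Sum>t\<in>subfield (Suc 0). p ^ (k - 1))"
      using le t by (intro sum_strict_mono_ex1) auto
    then show False using eq by simp
  qed
qed

section \<open>Additive characters and orthogonality\<close>

definition unity_char :: "'a \<Rightarrow> complex" where
  "unity_char x = exp (2 * of_real pi * \<i> / of_nat p * of_nat (prime_field_rep x))"

lemma unity_char_of_nat: "unity_char (of_nat a) = exp (2 * of_real pi * \<i> / of_nat p) ^ a"
proof -
  define z where "z = exp (2 * of_real pi * \<i> / of_nat p)"
  have zp: "z ^ p = 1" unfolding z_def using p_gt_1
    by (simp flip: exp_of_nat_mult)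
  have "unity_char (of_nat a) = z ^ (a mod p)"
    by (simp add: unity_char_def z_def prime_field_rep_of_nat mult.commute flip: exp_of_nat_mult)
  also have "\<dots> = (z ^ p) ^ (a div p) * z ^ (a mod p)" using zp by simp
  also have "\<dots> = z ^ a" by (simp flip: power_mult power_add)
  finally show ?thesis by (simp add: z_def)
qed

lemma unity_char_add:
  "x \<in> subfield (Suc 0) \<Longrightarrow> y \<in> subfield (Suc 0) \<Longrightarrow> unity_char (x + y) = unity_char x * unity_char y"
  unfolding subfield_1 by (auto simp: unity_char_of_nat power_add simp flip: of_nat_add)

lemma unity_char_1: "unity_char 1 \<noteq> 1"
proof
  assume "unity_char 1 = 1"
  then have "cis (2 * pi / real p) = 1"
    using unity_char_of_nat[of 1] by (simp add: cis_conv_exp mult.commute)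
  then have "cos (2 * pi / real p) = 1" by (metis cis.sel(1) one_complex.sel(1))
  then obtain n :: int where "2 * pi / real p = n * 2 * pi"
    unfolding cos_one_2pi_int by auto
  then have "1 = of_int n * real p" using p_gt_1 by (simp add: field_simps)
  then have "1 = n * int p" by (metis of_int_eq_iff of_int_mult of_int_of_nat_eq of_int_1)
  then have "int p dvd 1" by (metis dvd_triv_right)
  then show False using p_gt_1 by simp
qed

definition \<psi> :: "'a \<Rightarrow> complex" where "\<psi> = additive_char p d"

lemma psi_eq: "\<psi> x = unity_char (field_trace p d x)"
  by (simp add: \<psi>_def additive_char_def unity_char_def)

lemma trace_prime_field: "field_trace p d (x::'a) \<in> subfield (Suc 0)"
  using trace_subfield[of x 1 d] by (simp add: subfield_d)

lemma psi_add: "\<psi> (x + y) = \<psi> x * \<psi> y"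
  using trace_add[of 1 d x y] by (simp add: psi_eq unity_char_add trace_prime_field)

lemma unity_char_0: "unity_char 0 = 1" using unity_char_of_nat[of 0] by simp

lemma psi_0 [simp]: "\<psi> 0 = 1"
  using trace_0[of 1 d] by (simp add: psi_eq unity_char_0)

lemma psi_minus: "\<psi> (- x) = cnj (\<psi> x)"
proof -
  have "norm (\<psi> x) = 1" by (simp add: psi_eq unity_char_def)
  then have "\<psi> x * cnj (\<psi> x) = 1" by (simp add: complex_norm_square[symmetric])
  moreover have "\<psi> x * \<psi> (- x) = 1" by (simp flip: psi_add)
  moreover have "\<psi> x \<noteq> 0" using calculation by auto
  ultimately show ?thesis by (metis mult_left_cancel)
qed

text \<open>Translation by an element of trace 1 multiplies the sum by \<open>unity_char 1\<close>,
  which is not 1.\<close>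

lemma sum_unity_char_subfield:
  assumes "k dvd d" "k > 0"
  shows "(\<Sum>y\<in>subfield k. unity_char (field_trace p k y)) = 0"
proof -
  have "card {x \<in> subfield k. field_trace p k x = 1} > 0"
    unfolding card_trace_fibre[OF assms one_subfield] by (rule p_power_gt_0)
  then have "{x \<in> subfield k. field_trace p k x = 1} \<noteq> {}" by fastforce
  then obtain z where z: "z \<in> subfield k" "field_trace p k z = 1" by blast
  have *: "field_trace p k y \<in> subfield (Suc 0)" if "y \<in> subfield k" for y
    using trace_subfield[of y 1 k] that by simp
  have "(\<Sum>y\<in>subfield k. unity_char (field_trace p k y))
        = (\<Sum>y\<in>subfield k. unity_char (field_trace p k (y + z)))"
    by (rule sum.reindex_bij_witness[of _ "\<lambda>y. y + z" "\<lambda>y. y - z"])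
      (simp_all add: subfield_add[OF _ z(1)] subfield_diff[OF _ z(1)])
  also have "\<dots> = (\<Sum>y\<in>subfield k. unity_char (field_trace p k y)) * unity_char 1"
    unfolding sum_distrib_right
  proof (rule sum.cong)
    fix y assume "y \<in> subfield k"
    moreover have "field_trace p k (y + z) = field_trace p k y + 1"
      using trace_add[of 1 k y z] by (simp add: z(2))
    ultimately show "unity_char (field_trace p k (y + z)) = unity_char (field_trace p k y) * unity_char 1"
      using unity_char_add[OF * one_subfield] by (simp only:)
  qed simp
  finally show ?thesis using unity_char_1 by simp
qed

text \<open>By transitivity of the trace the summand depends only on \<open>y\<close> times the
  relative trace of \<open>x\<close>; if that trace is nonzero, it can be absorbed into
  \<open>y\<close>. This detects the zero coordinates of a codeword, and for \<open>s = d\<close> it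
  is orthogonality over the whole field.\<close>

lemma sum_psi_subfield:
  assumes "d = s * k"
  shows "(\<Sum>y\<in>subfield s. \<psi> (y * x)) = (if field_trace (p ^ s) k x = 0 then of_nat (p ^ s) else 0)"
proof -
  define t where "t = field_trace (p ^ s) k x"
  have s: "s dvd d" "s > 0" using assms d_pos by auto
  have t: "t \<in> subfield s" unfolding t_def using assms
    by (intro trace_subfield) (simp add: subfield_d flip: assms)
  have *: "\<psi> (y * x) = unity_char (field_trace p s (y * t))" if "y \<in> subfield s" for y
    using trace_scale[OF that, of k x] trace_trace[of s k "y * x"]
    by (simp add: psi_eq t_def flip: assms)
  have "(\<Sum>y\<in>subfield s. \<psi> (y * x)) = (\<Sum>y\<in>subfield s. unity_char (field_trace p s (y * t)))"
    by (intro sum.cong) (auto simp: *)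
  also have "\<dots> = (if t = 0 then of_nat (p ^ s) else 0)"
  proof (cases "t = 0")
    case True
    then show ?thesis using trace_0[of 1 s] subfield_nz_eq(2)[OF s] by (simp add: unity_char_0)
  next
    case False
    have "(\<Sum>y\<in>subfield s. unity_char (field_trace p s (y * t)))
        = (\<Sum>y\<in>subfield s. unity_char (field_trace p s y))"
      by (rule sum.reindex_bij_witness[of _ "\<lambda>y. y / t" "\<lambda>y. y * t"])
        (simp_all add: False subfield_mult[OF _ t] subfield_divide[OF _ t])
    then show ?thesis using sum_unity_char_subfield[OF s] False by simp
  qed
  finally show ?thesis by (simp add: t_def)
qed

lemma sum_psi: "(\<Sum>y\<in>UNIV. \<psi> (y * x)) = (if x = 0 then of_nat r else 0)"
  using sum_psi_subfield[of d 1 x] by (simp add: subfield_d field_trace_def)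

end

section \<open>Complex cube roots of unity\<close>

lemma power_mod_3:
  assumes "w ^ 3 = (1 :: 'b::monoid_mult)"
  shows "w ^ (j mod 3) = w ^ j"
proof -
  have "w ^ j = w ^ (3 * (j div 3) + j mod 3)" by simp
  also have "\<dots> = w ^ (j mod 3)" by (simp only: power_add power_mult assms power_one mult_1_left)
  finally show ?thesis by simp
qed

lemma power_eq_mod_3:
  assumes "w ^ 3 = (1 :: 'b::monoid_mult)" "i mod 3 = j mod 3"
  shows "w ^ i = w ^ j"
  using power_mod_3[OF assms(1)] assms(2) by metis

text \<open>Encoded by the cyclotomic polynomial: polynomial identities can use it directly, and
  both primitive roots are treated alike.\<close>

definition prim_root3 :: "complex \<Rightarrow> bool" where
  "prim_root3 w \<longleftrightarrow> w\<^sup>2 + w + 1 = 0"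

lemma prim_root3_cube: "prim_root3 w \<Longrightarrow> w ^ 3 = 1"
  unfolding prim_root3_def by algebra

lemma prim_root3_neq_1: "prim_root3 w \<Longrightarrow> w \<noteq> 1"
  unfolding prim_root3_def by auto

lemma prim_root3_square: "prim_root3 w \<Longrightarrow> prim_root3 (w\<^sup>2)"
  unfolding prim_root3_def by algebra

lemma cube_eq_1_iff: "w ^ 3 = 1 \<longleftrightarrow> w = 1 \<or> prim_root3 w"
proof
  assume "w ^ 3 = 1"
  then have "(w - 1) * (w\<^sup>2 + w + 1) = 0" by algebra
  then show "w = 1 \<or> prim_root3 w" by (auto simp: prim_root3_def)
qed (auto dest: prim_root3_cube)

lemma prim_root3_sum:
  assumes "prim_root3 w"
  shows "1 + w ^ j + (w\<^sup>2) ^ j = (if 3 dvd j then 3 else 0)"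
proof -
  note c = prim_root3_cube[OF assms] prim_root3_cube[OF prim_root3_square[OF assms]]
  have "1 + w ^ j + (w\<^sup>2) ^ j = 1 + w ^ (j mod 3) + (w\<^sup>2) ^ (j mod 3)"
    by (simp only: power_mod_3[OF c(1)] power_mod_3[OF c(2)])
  moreover have "1 + w ^ 1 + (w\<^sup>2) ^ 1 = 0" "1 + w ^ 2 + (w\<^sup>2) ^ 2 = 0"
    using assms prim_root3_square[OF assms] by (simp_all add: prim_root3_def algebra_simps)
  moreover consider "j mod 3 = 0" | "j mod 3 = 1" | "j mod 3 = 2" by linarith
  then have "1 + w ^ (j mod 3) + (w\<^sup>2) ^ (j mod 3) = (if 3 dvd j then 3 else 0)"
  proof cases
    case 1
    then show ?thesis by (simp add: dvd_eq_mod_eq_0)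
  next
    case 2
    then show ?thesis using calculation(2) by (simp only: dvd_eq_mod_eq_0) simp
  next
    case 3
    then show ?thesis using calculation(3) by (simp only: dvd_eq_mod_eq_0) simp
  qed
  ultimately show ?thesis by simp
qed

section \<open>Cubic characters, Gauss sums and cubic periods\<close>

locale cubic_field = finite_field_gen +
  assumes p_mod_3: "p mod 3 = 1" and three_dvd_d: "3 dvd d"
begin

lemma p_power_mod_3: "p ^ k mod 3 = 1"
  by (metis p_mod_3 power_mod power_one one_mod_numeral semiring_norm(160) mod_mod_trivial)

text \<open>\<open>r\<close> is the cube of \<open>p ^ (d div 3)\<close>, and the cube of a number
  congruent to 1 modulo 3 is congruent to 1 modulo 9.\<close>

lemma nine_dvd_M: "9 dvd M"
proof -
  obtain l where l: "d = 3 * l" using three_dvd_d by (auto elim: dvdE)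
  obtain a where "p ^ l = 3 * a + 1"
    using p_power_mod_3[of l] by (metis mult_div_mod_eq)
  then have "r = (3 * a + 1) ^ 3" by (simp add: l mult.commute power_mult)
  also have "\<dots> = 9 * (3 * a ^ 3 + 3 * a\<^sup>2 + a) + 1" by algebra
  finally have "M = 9 * (3 * a ^ 3 + 3 * a\<^sup>2 + a)" by (simp add: M_def)
  then show ?thesis by simp
qed

lemma three_dvd_M: "3 dvd M" using nine_dvd_M by (rule dvd_trans[rotated]) simp

definition "L = M div 3"

lemma M_eq: "M = 3 * L" using three_dvd_M by (simp add: L_def)

lemma L_pos: "L > 0" using M_eq M_pos by simp

lemma gen_power_eq_mod_3: "\<alpha> ^ i = \<alpha> ^ j \<Longrightarrow> i mod 3 = j mod 3"
  unfolding gen_power_eq_iff using three_dvd_M by (metis mod_mod_cancel)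

lemma sum_units: "(\<Sum>x\<in>UNIV - {0}. f x) = (\<Sum>j<M. f (\<alpha> ^ j))"
  by (rule sum.reindex_bij_betw[OF bij_gen, symmetric])

lemma sum_remove_0: "(\<Sum>x\<in>UNIV. f x) = f 0 + (\<Sum>x\<in>UNIV - {0}. f (x::'a) :: complex)"
  by (rule sum.remove) auto

lemma sum_scale: "c \<noteq> 0 \<Longrightarrow> (\<Sum>x\<in>UNIV. f (c * x)) = (\<Sum>x\<in>UNIV. f (x :: 'a))"
  by (rule sum.reindex_bij_witness[of _ "\<lambda>x. x / c" "\<lambda>x. c * x"]) auto

text \<open>The choice is harmless: two logarithms differ by a multiple of \<open>M\<close>, hence
  of 3, and only the residue modulo 3 matters below.\<close>

definition dlog :: "'a \<Rightarrow> nat" where "dlog x = (SOME j. x = \<alpha> ^ j)"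

lemma gen_dlog: "x \<noteq> 0 \<Longrightarrow> \<alpha> ^ dlog x = x"
  unfolding dlog_def using ex_gen_power by (metis (mono_tags, lifting) someI_ex)

text \<open>The multiplicative character that sends \<alpha> to \<open>w\<close>, extended by 0. It
  is a character for \<open>w ^ 3 = 1\<close>; keeping \<open>w\<close> as a parameter covers a
  cubic character and its conjugate at once.\<close>

definition \<chi> :: "complex \<Rightarrow> 'a \<Rightarrow> complex" where
  "\<chi> w x = (if x = 0 then 0 else w ^ dlog x)"

lemma chi_0 [simp]: "\<chi> w 0 = 0" by (simp add: \<chi>_def)

lemma chi_gen: "w ^ 3 = 1 \<Longrightarrow> \<chi> w (\<alpha> ^ j) = w ^ j"
proof -
  assume w: "w ^ 3 = 1"
  have "\<alpha> ^ dlog (\<alpha> ^ j) = \<alpha> ^ j" by (rule gen_dlog) (simp add: gen_nz)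
  then have "dlog (\<alpha> ^ j) mod 3 = j mod 3" by (rule gen_power_eq_mod_3)
  from power_eq_mod_3[OF w this] show ?thesis using gen_nz by (simp add: \<chi>_def)
qed

lemma chi_mult: "w ^ 3 = 1 \<Longrightarrow> \<chi> w (x * y) = \<chi> w x * \<chi> w y"
proof (cases "x = 0 \<or> y = 0")
  case False
  assume w: "w ^ 3 = 1"
  from False obtain i j where "x = \<alpha> ^ i" "y = \<alpha> ^ j" using ex_gen_power by blast
  then show ?thesis by (simp add: chi_gen[OF w] flip: power_add)
qed auto

lemma chi_cube: "w ^ 3 = 1 \<Longrightarrow> x \<noteq> 0 \<Longrightarrow> \<chi> w (x ^ 3) = 1"
proof -
  assume w: "w ^ 3 = 1" and "x \<noteq> 0"
  then obtain j where "x = \<alpha> ^ j" using ex_gen_power by blast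
  then have "x ^ 3 = \<alpha> ^ (j * 3)" by (simp only: power_mult)
  then have "\<chi> w (x ^ 3) = w ^ (j * 3)" by (simp only: chi_gen[OF w])
  also have "\<dots> = (w ^ 3) ^ j" by (simp only: mult.commute[of j] power_mult)
  finally show ?thesis by (simp only: w power_one)
qed

lemma chi_minus: "w ^ 3 = 1 \<Longrightarrow> \<chi> w (- x) = \<chi> w x"
proof -
  assume w: "w ^ 3 = 1"
  have "\<chi> w (- 1) = 1" using chi_cube[OF w, of "- 1"] by simp
  then show ?thesis using chi_mult[OF w, of "- 1" x] by simp
qed

lemma chi_frob: "w ^ 3 = 1 \<Longrightarrow> \<chi> w (x ^ (p ^ k)) = \<chi> w x"
proof (cases "x = 0")
  case False
  assume w: "w ^ 3 = 1"
  from False obtain j where "x = \<alpha> ^ j" using ex_gen_power by blast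
  moreover have "j * p ^ k mod 3 = j mod 3"
    using p_power_mod_3[of k] by (metis mod_mult_right_eq mult.right_neutral)
  ultimately show ?thesis
    using power_eq_mod_3[OF w, of "j * p ^ k" j] by (simp add: chi_gen[OF w] flip: power_mult)
qed (simp add: power_0_left)

lemma chi_square: "w ^ 3 = 1 \<Longrightarrow> \<chi> (w\<^sup>2) x = \<chi> w x * \<chi> w x"
  by (simp add: \<chi>_def power2_eq_square power_mult_distrib)

lemma chi_inverse: "w ^ 3 = 1 \<Longrightarrow> x \<noteq> 0 \<Longrightarrow> \<chi> w x * \<chi> (w\<^sup>2) x = 1"
proof -
  assume w: "w ^ 3 = 1" and "x \<noteq> 0"
  then have "\<chi> w x * \<chi> (w\<^sup>2) x = (w * w\<^sup>2) ^ dlog x" by (simp add: \<chi>_def power_mult_distrib)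
  also have "w * w\<^sup>2 = 1" using w by (simp only: power3_eq_cube power2_eq_square mult.assoc)
  finally show ?thesis by simp
qed

lemma sum_chi: assumes "prim_root3 w" shows "(\<Sum>x\<in>UNIV. \<chi> w x) = 0"
proof -
  note w = prim_root3_cube[OF assms]
  have "(\<Sum>x\<in>UNIV. \<chi> w x) = (\<Sum>x\<in>UNIV. \<chi> w (\<alpha> * x))" by (rule sum_scale[symmetric, OF gen_nz])
  also have "\<dots> = w * (\<Sum>x\<in>UNIV. \<chi> w x)"
    using chi_gen[OF w, of 1] by (simp add: chi_mult[OF w] sum_distrib_left)
  finally show ?thesis using prim_root3_neq_1[OF assms] by simp
qed

section \<open>Gauss and Jacobi sums\<close>

definition gauss :: "complex \<Rightarrow> complex" where "gauss w = (\<Sum>x\<in>UNIV. \<chi> w x * \<psi> x)"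

definition jacobi :: "complex \<Rightarrow> complex" where "jacobi w = (\<Sum>x\<in>UNIV. \<chi> w x * \<chi> w (1 - x))"

lemma gauss_twist:
  assumes w: "w ^ 3 = 1" and u: "u \<noteq> 0"
  shows "\<chi> w u * (\<Sum>x\<in>UNIV. \<chi> w x * \<psi> (u * x)) = gauss w"
proof -
  have "gauss w = (\<Sum>x\<in>UNIV. \<chi> w (u * x) * \<psi> (u * x))"
    unfolding gauss_def by (rule sum_scale[symmetric, OF u])
  then show ?thesis by (simp add: chi_mult[OF w] sum_distrib_left mult.assoc)
qed

text \<open>For each \<open>y\<close> the first factor is rewritten by \<open>gauss_twist\<close>
  with \<open>u = y\<close>, which cancels the characters of \<open>y\<close>. The remaining sum of
  \<open>\<psi> (y * (x + 1))\<close> over \<open>y \<noteq> 0\<close> isolates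
  \<open>x = - 1\<close>, and -1 is a cube.\<close>

lemma gauss_mult_gauss:
  assumes "prim_root3 w"
  shows "gauss w * gauss (w\<^sup>2) = of_nat r"
proof -
  note w = prim_root3_cube[OF assms]
  have "gauss w * gauss (w\<^sup>2) = (\<Sum>y\<in>UNIV. gauss w * (\<chi> (w\<^sup>2) y * \<psi> y))"
    unfolding gauss_def[of "w\<^sup>2"] by (rule sum_distrib_left)
  also have "\<dots> = (\<Sum>y\<in>UNIV - {0}. gauss w * (\<chi> (w\<^sup>2) y * \<psi> y))"
    by (rule sum.mono_neutral_right) auto
  also have "\<dots> = (\<Sum>y\<in>UNIV - {0}. \<Sum>x\<in>UNIV. \<chi> w x * \<psi> (y * (x + 1)))"
  proof (rule sum.cong[OF refl])
    fix y :: 'a assume "y \<in> UNIV - {0}"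
    then have y: "y \<noteq> 0" by simp
    have "gauss w * (\<chi> (w\<^sup>2) y * \<psi> y)
        = (\<chi> w y * \<chi> (w\<^sup>2) y) * (\<Sum>x\<in>UNIV. \<chi> w x * \<psi> (y * x)) * \<psi> y"
      unfolding gauss_twist[OF w y, symmetric] by (simp only: mult_ac)
    also have "\<dots> = (\<Sum>x\<in>UNIV. \<chi> w x * \<psi> (y * (x + 1)))"
      by (simp add: chi_inverse[OF w y] sum_distrib_right distrib_left psi_add mult.assoc)
    finally show "gauss w * (\<chi> (w\<^sup>2) y * \<psi> y) = (\<Sum>x\<in>UNIV. \<chi> w x * \<psi> (y * (x + 1)))" .
  qed
  also have "\<dots> = (\<Sum>x\<in>UNIV. \<chi> w x * (\<Sum>y\<in>UNIV - {0}. \<psi> (y * (x + 1))))"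
    by (subst sum.swap) (simp add: sum_distrib_left)
  also have "\<dots> = (\<Sum>x\<in>UNIV. \<chi> w x * ((if x = - 1 then of_nat r else 0) - 1))"
  proof (rule sum.cong[OF refl])
    fix x :: 'a
    have "(\<Sum>y\<in>UNIV - {0}. \<psi> (y * (x + 1))) = (if x + 1 = 0 then of_nat r else 0) - 1"
      unfolding sum_psi[of "x + 1", symmetric] sum_remove_0[of "\<lambda>y. \<psi> (y * (x + 1))"]
      by (simp only: mult_zero_left psi_0 add_diff_cancel_left')
    then show "\<chi> w x * (\<Sum>y\<in>UNIV - {0}. \<psi> (y * (x + 1)))
        = \<chi> w x * ((if x = - 1 then of_nat r else 0) - 1)"
      by (simp only: eq_neg_iff_add_eq_0)
  qed
  also have "\<dots> = (\<Sum>x\<in>UNIV. if x = - 1 then \<chi> w x * of_nat r else 0) - (\<Sum>x\<in>UNIV. \<chi> w x)"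
    unfolding sum_subtractf[symmetric] by (intro sum.cong) (auto simp: algebra_simps)
  also have "\<dots> = of_nat r"
    using chi_cube[OF w, of "- 1"] sum_chi[OF assms] by simp
  finally show ?thesis .
qed

text \<open>The coefficient \<open>h z\<close> of \<open>\<psi> z\<close> in the square is a
  convolution. Scaling its variable by \<open>z\<close> gives a Jacobi sum; at \<open>z = 0\<close>
  it is the sum of the nontrivial character for \<open>w\<^sup>2\<close>, which vanishes, so no
  correction term appears.\<close>

lemma gauss_square:
  assumes "prim_root3 w"
  shows "gauss w * gauss w = jacobi w * gauss (w\<^sup>2)"
proof -
  note w = prim_root3_cube[OF assms]
  define h where "h z = (\<Sum>x\<in>UNIV. \<chi> w x * \<chi> w (z - x))" for z
  have h0: "h 0 = 0"
    using sum_chi[OF prim_root3_square[OF assms]]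
    by (simp add: h_def chi_minus[OF w] chi_square[OF w])
  have hz: "h z = \<chi> (w\<^sup>2) z * jacobi w" if "z \<noteq> 0" for z
  proof -
    have "h z = (\<Sum>x\<in>UNIV. \<chi> w (z * x) * \<chi> w (z - z * x))"
      unfolding h_def by (rule sum_scale[symmetric, OF that])
    also have "\<dots> = (\<Sum>x\<in>UNIV. \<chi> w (z * x) * \<chi> w (z * (1 - x)))" by (simp add: right_diff_distrib)
    also have "\<dots> = (\<Sum>x\<in>UNIV. (\<chi> w z * \<chi> w z) * (\<chi> w x * \<chi> w (1 - x)))"
      by (simp only: chi_mult[OF w] mult_ac)
    also have "\<dots> = \<chi> (w\<^sup>2) z * jacobi w"
      by (simp only: chi_square[OF w] jacobi_def sum_distrib_left)
    finally show ?thesis .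
  qed
  have "gauss w * gauss w = (\<Sum>x\<in>UNIV. \<Sum>y\<in>UNIV. \<chi> w x * \<psi> x * (\<chi> w y * \<psi> y))"
    unfolding gauss_def by (rule sum_product)
  also have "\<dots> = (\<Sum>x\<in>UNIV. \<Sum>z\<in>UNIV. \<chi> w x * \<chi> w (z - x) * \<psi> z)"
  proof (rule sum.cong[OF refl])
    fix x :: 'a
    show "(\<Sum>y\<in>UNIV. \<chi> w x * \<psi> x * (\<chi> w y * \<psi> y)) = (\<Sum>z\<in>UNIV. \<chi> w x * \<chi> w (z - x) * \<psi> z)"
      by (rule sum.reindex_bij_witness[of _ "\<lambda>z. z - x" "\<lambda>y. x + y"]) (simp_all add: psi_add)
  qed
  also have "\<dots> = (\<Sum>z\<in>UNIV. h z * \<psi> z)"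
    by (subst sum.swap) (simp add: h_def sum_distrib_right)
  also have "\<dots> = (\<Sum>z\<in>UNIV. \<chi> (w\<^sup>2) z * jacobi w * \<psi> z)"
  proof (rule sum.cong[OF refl])
    fix z :: 'a
    show "h z * \<psi> z = \<chi> (w\<^sup>2) z * jacobi w * \<psi> z" using h0 hz by (cases "z = 0") auto
  qed
  also have "\<dots> = jacobi w * gauss (w\<^sup>2)"
    by (simp add: gauss_def sum_distrib_left mult_ac)
  finally show ?thesis .
qed

lemma gauss_cube:
  assumes "prim_root3 w"
  shows "gauss w ^ 3 = of_nat r * jacobi w"
proof -
  have "gauss w ^ 3 = jacobi w * (gauss w * gauss (w\<^sup>2))"
    using gauss_square[OF assms] by (simp add: power3_eq_cube mult_ac)
  then show ?thesis by (simp add: gauss_mult_gauss[OF assms])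
qed

text \<open>Cube \<open>gauss w * gauss (w\<^sup>2) = r\<close>, replace both cubes by
  \<open>r\<close> times a Jacobi sum and cancel \<open>r\<close> twice.\<close>

lemma jacobi_norm:
  assumes "prim_root3 w"
  shows "jacobi w * jacobi (w\<^sup>2) = of_nat r"
proof -
  have w4: "(w\<^sup>2)\<^sup>2 = w"
    using prim_root3_cube[OF assms] by (simp add: power2_eq_square power3_eq_cube mult.assoc)
  have "of_nat r * jacobi w * (of_nat r * jacobi (w\<^sup>2)) = (gauss w * gauss (w\<^sup>2)) ^ 3"
    using gauss_cube[OF assms] gauss_cube[OF prim_root3_square[OF assms]]
    by (simp add: power_mult_distrib)
  also have "\<dots> = of_nat r ^ 3" by (simp only: gauss_mult_gauss[OF assms])
  finally have "(of_nat r * of_nat r) * (jacobi w * jacobi (w\<^sup>2)) = of_nat r * of_nat r * (of_nat r :: complex)"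
    by (simp add: power3_eq_cube mult_ac)
  moreover have "(of_nat r * of_nat r :: complex) \<noteq> 0" by simp
  ultimately show ?thesis using mult_left_cancel by blast
qed

lemma cnj_chi: "cnj (\<chi> w x) = \<chi> (cnj w) x" by (simp add: \<chi>_def)

lemma cnj_gauss: "w ^ 3 = 1 \<Longrightarrow> cnj (gauss w) = gauss (cnj w)"
proof -
  assume "w ^ 3 = 1"
  then have w: "cnj w ^ 3 = 1" by (metis complex_cnj_one complex_cnj_power)
  have "cnj (gauss w) = (\<Sum>x\<in>UNIV. \<chi> (cnj w) (- x) * \<psi> (- x))"
    by (simp add: gauss_def cnj_chi psi_minus chi_minus[OF w])
  also have "\<dots> = gauss (cnj w)"
    unfolding gauss_def using sum_scale[of "- 1" "\<lambda>x. \<chi> (cnj w) x * \<psi> x"] by simp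
  finally show ?thesis .
qed

lemma cnj_jacobi: "cnj (jacobi w) = jacobi (cnj w)"
  by (simp add: jacobi_def cnj_chi)

section \<open>Cubic periods in terms of Gauss sums\<close>

definition per :: "'a \<Rightarrow> complex" where "per = cubic_period p d"

lemma gen_power_cube_iff: "\<alpha> ^ j \<in> nonzero_cubes \<longleftrightarrow> 3 dvd j"
proof
  assume "\<alpha> ^ j \<in> nonzero_cubes"
  then obtain y where "y \<noteq> 0" "\<alpha> ^ j = y ^ 3" by (auto simp: nonzero_cubes_def)
  then obtain i where "y = \<alpha> ^ i" using ex_gen_power by blast
  then have "\<alpha> ^ j = \<alpha> ^ (i * 3)" using \<open>\<alpha> ^ j = y ^ 3\<close> by (simp only: power_mult)
  from gen_power_eq_mod_3[OF this] show "3 dvd j" by presburger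
next
  assume "3 dvd j"
  then obtain i where "j = i * 3" by (metis dvdE mult.commute)
  then show "\<alpha> ^ j \<in> nonzero_cubes"
    unfolding nonzero_cubes_def using gen_nz by (auto simp: power_mult intro!: exI[of _ "\<alpha> ^ i"])
qed

lemma zero_not_cube: "(0::'a) \<notin> nonzero_cubes" by (auto simp: nonzero_cubes_def)

lemma cubes_mult: "z \<in> nonzero_cubes \<Longrightarrow> u \<in> nonzero_cubes \<Longrightarrow> z * u \<in> (nonzero_cubes :: 'a set)"
  unfolding nonzero_cubes_def by (auto simp flip: power_mult_distrib)

lemma cubes_divide: "z \<in> nonzero_cubes \<Longrightarrow> u \<in> nonzero_cubes \<Longrightarrow> z / u \<in> (nonzero_cubes :: 'a set)"
  unfolding nonzero_cubes_def by clarify (metis divide_eq_0_iff power_divide)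

lemma cubes_eq: "nonzero_cubes = (\<lambda>i. \<alpha> ^ (3 * i)) ` {..<L}"
proof (intro equalityI subsetI)
  fix z :: 'a assume z: "z \<in> nonzero_cubes"
  then have "z \<in> UNIV - {0}" using zero_not_cube by auto
  then obtain j where j: "j < M" "z = \<alpha> ^ j" unfolding gen_image[symmetric] by auto
  then have "3 dvd j" using z gen_power_cube_iff by simp
  then obtain i where "j = 3 * i" by (auto elim: dvdE)
  then show "z \<in> (\<lambda>i. \<alpha> ^ (3 * i)) ` {..<L}" using j M_eq by auto
qed (auto simp: gen_power_cube_iff)

lemma inj_on_cubes: "inj_on (\<lambda>i. \<alpha> ^ (3 * i)) {..<L}"
proof (rule inj_onI)
  fix i j assume "i \<in> {..<L}" "j \<in> {..<L}" "\<alpha> ^ (3 * i) = \<alpha> ^ (3 * j)"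
  then show "i = j" unfolding gen_power_eq_iff M_eq by simp
qed

lemma card_cubes: "card (nonzero_cubes :: 'a set) = L"
  unfolding cubes_eq by (simp add: card_image inj_on_cubes)

lemma per_mult_cube:
  assumes "z \<in> nonzero_cubes"
  shows "per (z * u) = per u"
  unfolding per_def cubic_period_def
  by (rule sum.reindex_bij_witness[of _ "\<lambda>y. y / z" "\<lambda>y. y * z"])
    (use assms zero_not_cube in \<open>auto intro: cubes_mult cubes_divide simp: mult.assoc\<close>)

lemma per_0: "per 0 = of_nat L"
  by (simp add: per_def cubic_period_def card_cubes psi_0[unfolded \<psi>_def])

lemma per_minus: "per (- u) = per u"
proof -
  have "(- 1 :: 'a) \<in> nonzero_cubes" unfolding nonzero_cubes_def by (auto intro!: exI[of _ "- 1"])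
  then show ?thesis using per_mult_cube[of "- 1" u] by simp
qed

lemma per_gen_cong:
  assumes "i mod 3 = j mod 3"
  shows "per (\<alpha> ^ i) = per (\<alpha> ^ j)"
  using assms
proof (induction i j rule: linorder_wlog)
  case (le i j)
  then have "3 dvd j - i" by (metis mod_eq_dvd_iff_nat)
  then have "\<alpha> ^ (j - i) \<in> nonzero_cubes" by (simp add: gen_power_cube_iff)
  then show ?case using per_mult_cube[of "\<alpha> ^ (j - i)" "\<alpha> ^ i"] le by (simp flip: power_add)
next
  case (sym i j)
  then show ?case by simp
qed

text \<open>Fourier expansion of the indicator of the cubes. The trivial character contributes -1,
  the other two contribute twisted Gauss sums, where dividing by \<open>v ^ i\<close> is written as
  multiplying by \<open>v ^ (2 * i)\<close>.\<close>

lemma per_gen: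
  assumes "prim_root3 w"
  shows "3 * per (\<alpha> ^ i) = (w\<^sup>2) ^ i * gauss w + w ^ i * gauss (w\<^sup>2) - 1"
proof -
  note w = prim_root3_cube[OF assms] and w2 = prim_root3_cube[OF prim_root3_square[OF assms]]
  define T where "T w = (\<Sum>x\<in>UNIV. \<chi> w x * \<psi> (\<alpha> ^ i * x))" for w
  have T: "T v = v ^ (2 * i) * gauss v" if v: "v ^ 3 = 1" for v
  proof -
    have "v ^ i * T v = gauss v"
      using gauss_twist[OF v, of "\<alpha> ^ i"] gen_nz by (simp add: T_def chi_gen[OF v])
    moreover have "v ^ (2 * i) * v ^ i = (v ^ 3) ^ i"
      by (simp flip: power_add power_mult)
    ultimately show ?thesis using v by (metis mult.assoc mult_1 power_one)
  qed
  have ind: "3 * (if x \<in> nonzero_cubes then 1 else 0) = (if x = 0 then 0 else 1) + \<chi> w x + \<chi> (w\<^sup>2) x" for x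
  proof (cases "x = 0")
    case False
    then obtain j where "x = \<alpha> ^ j" using ex_gen_power by blast
    then show ?thesis
      using gen_nz prim_root3_sum[OF assms, of j] by (auto simp: chi_gen[OF w] chi_gen[OF w2] gen_power_cube_iff)
  qed (simp add: zero_not_cube)
  have "3 * per (\<alpha> ^ i) = (\<Sum>x\<in>UNIV. 3 * (if x \<in> nonzero_cubes then 1 else 0) * \<psi> (\<alpha> ^ i * x))"
    unfolding per_def cubic_period_def \<psi>_def[symmetric]
    by (simp add: sum_distrib_left sum.If_cases if_distrib[of "\<lambda>t. _ * t"] if_distrib[of "\<lambda>t. t * _"] mult.commute[of _ "\<alpha> ^ i"] cong: if_cong)
  also have "\<dots> = (\<Sum>x\<in>UNIV. (if x = 0 then 0 else 1) * \<psi> (\<alpha> ^ i * x)) + T w + T (w\<^sup>2)"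
    unfolding ind T_def by (simp only: distrib_right sum.distrib)
  also have "(\<Sum>x\<in>UNIV. (if x = 0 then 0 else 1) * \<psi> (\<alpha> ^ i * x)) = (\<Sum>x\<in>UNIV - {0}. \<psi> (x * \<alpha> ^ i))"
    by (rule sum.mono_neutral_cong_right) (auto simp: mult.commute)
  also have "\<dots> = - 1"
    using sum_psi[of "\<alpha> ^ i"] sum_remove_0[of "\<lambda>x. \<psi> (x * \<alpha> ^ i)"] gen_nz by (simp add: eq_neg_iff_add_eq_0 add.commute)
  also have "T w = (w\<^sup>2) ^ i * gauss w" by (simp add: T[OF w] power_mult)
  also have "T (w\<^sup>2) = w ^ i * gauss (w\<^sup>2)"
  proof -
    have "(w\<^sup>2) ^ (2 * i) = (w ^ 3 * w) ^ i" by (simp add: power_mult power2_eq_square power3_eq_cube mult.assoc)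
    then show ?thesis by (simp add: T[OF w2] w)
  qed
  finally show ?thesis by simp
qed

end

section \<open>Binomial coefficients and Eisenstein integers\<close>

text \<open>The multiples of \<open>p\<close> up to \<open>p * n + e\<close> contribute
  \<open>p ^ n * fact n\<close>; the other factors are prime to \<open>p\<close>. The inner
  induction walks through one block of \<open>p\<close> consecutive factors.\<close>

lemma fact_mult_add_prime:
  assumes "prime (p::nat)" "e < p"
  shows "\<exists>u. \<not> p dvd u \<and> fact (p * n + e) = p ^ n * fact n * u"
  using assms(2)
proof (induction n arbitrary: e)
  case 0
  then show ?case using assms(1) by (intro exI[of _ "fact e"]) (simp add: prime_dvd_fact_iff)
next
  case (Suc n)
  have p: "p > 0" using Suc.prems by simp
  from Suc.prems show ?case
  proof (induction e)
    case 0
    obtain u where u: "\<not> p dvd u" "fact (p * n + (p - 1)) = p ^ n * fact n * u"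
      using Suc.IH[of "p - 1"] p by auto
    have "p * Suc n + 0 = Suc (p * n + (p - 1))" using p by simp
    then have "fact (p * Suc n + 0) = p * Suc n * fact (p * n + (p - 1))"
      by (simp only: fact_Suc of_nat_id) simp
    then have "fact (p * Suc n + 0) = p ^ Suc n * fact (Suc n) * u"
      unfolding u(2) by (simp only: fact_Suc of_nat_id power_Suc mult_ac)
    then show ?case using u(1) by blast
  next
    case (Suc e)
    obtain u where u: "\<not> p dvd u" "fact (p * Suc n + e) = p ^ Suc n * fact (Suc n) * u"
      using Suc.IH Suc.prems by auto
    have nd: "\<not> p dvd (p * Suc n + Suc e)"
      using Suc.prems by (simp only: dvd_add_right_iff dvd_triv_left) (auto dest: dvd_imp_le)
    have "fact (p * Suc n + Suc e) = (p * Suc n + Suc e) * fact (p * Suc n + e)"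
      by (simp only: add_Suc_right fact_Suc of_nat_id)
    also have "\<dots> = p ^ Suc n * fact (Suc n) * (u * (p * Suc n + Suc e))"
      using u(2) by (simp only: mult_ac)
    finally show ?case
      using u(1) nd assms(1) by (intro exI[of _ "u * (p * Suc n + Suc e)"]) (simp only: prime_dvd_mult_iff simp_thms)
  qed
qed

text \<open>Appending the base \<open>p\<close> digit \<open>c\<close> to \<open>n\<close> produces
  no carry in the doubling, because \<open>2 * c < p\<close>. In the quotient of factorials the
  powers of \<open>p\<close> and the smaller factorials cancel and leave numbers prime to
  \<open>p\<close>.\<close>

lemma central_binomial_step:
  assumes "prime (p::nat)" "2 * c < p" "\<not> p dvd (2 * n choose n)"
  shows "\<not> p dvd (2 * (p * n + c) choose (p * n + c))"
proof -
  define N where "N = p * n + c"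
  obtain u where u: "\<not> p dvd u" "fact N = p ^ n * fact n * u"
    using fact_mult_add_prime[OF assms(1), of c n] assms(2) unfolding N_def by auto
  obtain v where v: "\<not> p dvd v" "fact (2 * N) = p ^ (2 * n) * fact (2 * n) * v"
    using fact_mult_add_prime[OF assms(1,2), of "2 * n"] unfolding N_def by (auto simp: algebra_simps)
  have "fact N * fact (2 * N - N) * (2 * N choose N) = fact (2 * N)"
    by (rule binomial_fact_lemma) simp
  then have "p ^ n * fact n * u * (p ^ n * fact n * u) * (2 * N choose N) = p ^ (2 * n) * fact (2 * n) * v"
    by (simp add: u(2) v(2))
  moreover have "fact (2 * n) = fact n * fact n * (2 * n choose n)"
    using binomial_fact_lemma[of n "2 * n"] by simp
  ultimately have "(p ^ (2 * n) * (fact n * fact n)) * (u * u * (2 * N choose N))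
      = (p ^ (2 * n) * (fact n * fact n)) * ((2 * n choose n) * v)"
    by (simp add: mult_ac power_mult power2_eq_square power_mult_distrib mult.commute[of 2])
  moreover have "p ^ (2 * n) * (fact n * fact n) \<noteq> 0"
    using prime_gt_0_nat[OF assms(1)] by simp
  ultimately have "u * u * (2 * N choose N) = (2 * n choose n) * v" using mult_left_cancel by blast
  moreover have "\<not> p dvd (2 * n choose n) * v" using assms(1,3) v(1) by (simp add: prime_dvd_mult_iff)
  ultimately show ?thesis unfolding N_def[symmetric] by (metis dvd_mult)
qed

section \<open>Arithmetic and congruences of Eisenstein integers\<close>

lemma prim_root3_omega: "prim_root3 omega"
  unfolding prim_root3_def omega_def
  by (simp add: complex_eq_iff power2_eq_square field_simps)

lemma omega_square: "omega\<^sup>2 = - 1 - omega"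
  using prim_root3_omega unfolding prim_root3_def by algebra

lemma cnj_omega: "cnj omega = - 1 - omega"
  by (simp add: omega_def complex_eq_iff)

lemma Im_omega: "Im omega \<noteq> 0" by (simp add: omega_def)

lemma prim_root3_iff: "prim_root3 w \<longleftrightarrow> w = omega \<or> w = omega\<^sup>2"
proof -
  have "w\<^sup>2 + w + 1 = (w - omega) * (w - omega\<^sup>2)"
    using prim_root3_omega unfolding prim_root3_def by algebra
  then show ?thesis by (auto simp: prim_root3_def)
qed

lemma cnj_prim_root3: "prim_root3 w \<Longrightarrow> cnj w = w\<^sup>2"
proof -
  assume "prim_root3 w"
  then consider "w = omega" | "w = omega\<^sup>2" unfolding prim_root3_iff by blast
  then show ?thesis
  proof cases
    case 1
    then show ?thesis by (simp add: cnj_omega omega_square)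
  next
    case 2
    have "(- 1 - omega)\<^sup>2 = omega" using prim_root3_omega unfolding prim_root3_def by algebra
    then show ?thesis by (simp add: 2 omega_square cnj_omega)
  qed
qed

lemma eisenstein_coords_unique:
  assumes "of_int a + of_int b * omega = of_int a' + of_int b' * omega"
  shows "a = a' \<and> b = b'"
proof -
  have "Im (of_int a + of_int b * omega) = Im (of_int a' + of_int b' * omega)" using assms by simp
  then have "b = b'" using Im_omega by simp
  then show ?thesis using assms by simp
qed

lemma eisensteinE:
  assumes "x \<in> eisenstein_ints"
  obtains a b where "x = of_int a + of_int b * omega"
  using assms unfolding eisenstein_ints_def by blast

lemma eisensteinI: "x = of_int a + of_int b * omega \<Longrightarrow> x \<in> eisenstein_ints"
  unfolding eisenstein_ints_def by blast

lemma eis_add: "x \<in> eisenstein_ints \<Longrightarrow> y \<in> eisenstein_ints \<Longrightarrow> x + y \<in> eisenstein_ints"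
proof (elim eisensteinE)
  fix a b c e assume "x = of_int a + of_int b * omega" "y = of_int c + of_int e * omega"
  then show "x + y \<in> eisenstein_ints"
    by (intro eisensteinI[of _ "a + c" "b + e"]) (simp add: algebra_simps)
qed

lemma mult_coords:
  "(of_int a + of_int b * omega) * (of_int c + of_int e * omega)
    = of_int (a * c - b * e) + of_int (a * e + b * c - b * e) * omega"
proof -
  have "(of_int a + of_int b * omega) * (of_int c + of_int e * omega)
    = of_int (a * c) + of_int (a * e + b * c) * omega + of_int (b * e) * omega\<^sup>2"
    by (simp add: algebra_simps power2_eq_square)
  then show ?thesis unfolding omega_square by (simp add: algebra_simps)
qed

lemma eis_mult: "x \<in> eisenstein_ints \<Longrightarrow> y \<in> eisenstein_ints \<Longrightarrow> x * y \<in> eisenstein_ints"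
proof (elim eisensteinE)
  fix a b c e assume "x = of_int a + of_int b * omega" "y = of_int c + of_int e * omega"
  then show "x * y \<in> eisenstein_ints"
    using mult_coords[of a b c e] by (intro eisensteinI) (simp only:)
qed

lemma eis_of_int [simp]: "of_int a \<in> eisenstein_ints"
  by (rule eisensteinI[of _ a 0]) simp

lemma eis_of_nat [simp]: "of_nat a \<in> eisenstein_ints"
  using eis_of_int[of "int a"] by simp

lemma eis_0 [simp]: "0 \<in> eisenstein_ints" using eis_of_int[of 0] by simp
lemma eis_1 [simp]: "1 \<in> eisenstein_ints" using eis_of_int[of 1] by simp
lemma eis_omega [simp]: "omega \<in> eisenstein_ints" by (rule eisensteinI[of _ 0 1]) simp

lemma eis_numeral [simp]: "numeral n \<in> eisenstein_ints"
  using eis_of_nat[of "numeral n"] by simp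

lemma eis_minus: "x \<in> eisenstein_ints \<Longrightarrow> - x \<in> eisenstein_ints"
  using eis_mult[OF eis_of_int[of "- 1"], of x] by simp

lemma eis_diff: "x \<in> eisenstein_ints \<Longrightarrow> y \<in> eisenstein_ints \<Longrightarrow> x - y \<in> eisenstein_ints"
  using eis_add[of x "- y"] eis_minus[of y] by simp

lemma eis_power: "x \<in> eisenstein_ints \<Longrightarrow> x ^ n \<in> eisenstein_ints"
  by (induction n) (simp_all add: eis_mult)

lemma eis_sum: "(\<And>x. x \<in> A \<Longrightarrow> f x \<in> eisenstein_ints) \<Longrightarrow> sum f A \<in> eisenstein_ints"
  by (induction A rule: infinite_finite_induct) (simp_all add: eis_add)

lemma eis_cnj: "x \<in> eisenstein_ints \<Longrightarrow> cnj x \<in> eisenstein_ints"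
proof (elim eisensteinE)
  fix a b assume "x = of_int a + of_int b * omega"
  then show "cnj x \<in> eisenstein_ints"
    by (intro eisensteinI[of _ "a - b" "- b"]) (simp add: cnj_omega algebra_simps)
qed

lemma eis_prim_root3: "prim_root3 w \<Longrightarrow> w \<in> eisenstein_ints"
  unfolding prim_root3_iff by (auto intro: eis_power)

lemma eis_cong_mult:
  assumes "eisenstein_cong x y \<mu>" "eisenstein_cong x' y' \<mu>" "x' \<in> eisenstein_ints" "y \<in> eisenstein_ints"
  shows "eisenstein_cong (x * x') (y * y') \<mu>"
proof -
  obtain z z' where z: "z \<in> eisenstein_ints" "z' \<in> eisenstein_ints" "x - y = \<mu> * z" "x' - y' = \<mu> * z'"
    using assms(1,2) unfolding eisenstein_cong_def by blast
  then have "x * x' - y * y' = \<mu> * (x' * z + y * z')" by algebra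
  moreover have "x' * z + y * z' \<in> eisenstein_ints" using z assms by (intro eis_add eis_mult)
  ultimately show ?thesis unfolding eisenstein_cong_def by blast
qed

lemma eis_cong_refl: "eisenstein_cong x x \<mu>"
  unfolding eisenstein_cong_def by (intro bexI[of _ 0]) auto

lemma eis_cong_power:
  assumes "eisenstein_cong x y \<mu>" "x \<in> eisenstein_ints" "y \<in> eisenstein_ints"
  shows "eisenstein_cong (x ^ n) (y ^ n) \<mu>"
proof (induction n)
  case (Suc n)
  then show ?case using assms by (simp add: eis_cong_mult eis_power)
qed (simp add: eis_cong_refl)

lemma eis_cong_trans:
  assumes "eisenstein_cong x y \<mu>" "eisenstein_cong y z \<mu>"
  shows "eisenstein_cong x z \<mu>"
proof -
  obtain a b where "a \<in> eisenstein_ints" "b \<in> eisenstein_ints" "x - y = \<mu> * a" "y - z = \<mu> * b"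
    using assms unfolding eisenstein_cong_def by blast
  then show ?thesis unfolding eisenstein_cong_def by (intro bexI[of _ "a + b"]) (algebra, rule eis_add)
qed

lemma eis_cong_sym:
  assumes "eisenstein_cong x y \<mu>" shows "eisenstein_cong y x \<mu>"
proof -
  obtain a where "a \<in> eisenstein_ints" "x - y = \<mu> * a"
    using assms unfolding eisenstein_cong_def by blast
  then show ?thesis unfolding eisenstein_cong_def by (intro bexI[of _ "- a"]) (algebra, rule eis_minus)
qed

text \<open>The norm form of a unit is 1. Four times it is
  \<open>(2 * a - b)\<^sup>2 + 3 * b\<^sup>2\<close>, which leaves no room for a nonzero
  \<open>b\<close> divisible by 3; then \<open>a\<close> is 1 or -1, and the residue modulo 3
  decides.\<close>

lemma eis_unit_cong_1:
  assumes "u \<in> eisenstein_ints" "u * cnj u = 1" "eisenstein_cong u 1 3"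
  shows "u = 1"
proof -
  obtain a b where u: "u = of_int a + of_int b * omega" using assms(1) by (rule eisensteinE)
  obtain z where z: "z \<in> eisenstein_ints" "u - 1 = 3 * z"
    using assms(3) unfolding eisenstein_cong_def by blast
  obtain c e where ce: "z = of_int c + of_int e * omega" using z(1) by (rule eisensteinE)
  have "of_int a + of_int b * omega = of_int (1 + 3 * c) + of_int (3 * e) * omega"
    using z(2) unfolding u ce by (simp add: algebra_simps)
  then have ab: "a = 1 + 3 * c" "b = 3 * e" using eisenstein_coords_unique by blast+
  have "u * cnj u = (of_int a + of_int b * omega) * (of_int (a - b) + of_int (- b) * omega)"
    by (simp add: u cnj_omega algebra_simps)
  also have "\<dots> = of_int (a\<^sup>2 - a * b + b\<^sup>2) + of_int 0 * omega"
    unfolding mult_coords by (simp add: algebra_simps power2_eq_square)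
  finally have "of_int (a\<^sup>2 - a * b + b\<^sup>2) + of_int 0 * omega = of_int 1 + of_int 0 * omega"
    using assms(2) by simp
  then have eq: "a\<^sup>2 - a * b + b\<^sup>2 = 1" using eisenstein_coords_unique by blast
  then have "(2 * a - b)\<^sup>2 + 3 * b\<^sup>2 = 4" by algebra
  then have "3 * b\<^sup>2 \<le> 4" using zero_le_power2[of "2 * a - b"] by linarith
  then have "9 * e\<^sup>2 \<le> 1" unfolding ab by (simp add: power_mult_distrib)
  then have "e\<^sup>2 = 0" using zero_le_power2[of e] by linarith
  then have b: "b = 0" using ab by simp
  then have "a\<^sup>2 = 1" using eq by simp
  then have "a = 1 \<or> a = - 1" by (simp add: power2_eq_1_iff)
  then have "a = 1" using ab by presburger
  then show ?thesis using b u by simp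
qed

text \<open>Points that are not fixed lie in orbits of length 3 on which \<open>f\<close> is
  constant, so an orbit contributes \<open>3 * f x\<close>. The induction removes one orbit at a
  time.\<close>

lemma eis_cong_sum_fixpoints:
  assumes "finite A" "\<And>x. x \<in> A \<Longrightarrow> \<tau> x \<in> A" "\<And>x. x \<in> A \<Longrightarrow> \<tau> (\<tau> (\<tau> x)) = x"
    "\<And>x. x \<in> A \<Longrightarrow> f (\<tau> x) = f x" "\<And>x. x \<in> A \<Longrightarrow> f x \<in> eisenstein_ints"
  shows "eisenstein_cong (sum f A) (sum f {x \<in> A. \<tau> x = x}) 3"
  using assms
proof (induction A rule: finite_psubset_induct)
  case (psubset A)
  show ?case
  proof (cases "\<exists>x\<in>A. \<tau> x \<noteq> x")
    case False
    then have "{x \<in> A. \<tau> x = x} = A" by blast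
    then show ?thesis by (simp add: eis_cong_refl)
  next
    case True
    then obtain x where x: "x \<in> A" "\<tau> x \<noteq> x" by blast
    define O3 where "O3 = {x, \<tau> x, \<tau> (\<tau> x)}"
    have t: "\<tau> (\<tau> (\<tau> x)) = x" using psubset.prems(2) x(1) by blast
    have d: "\<tau> (\<tau> x) \<noteq> x" "\<tau> (\<tau> x) \<noteq> \<tau> x" using t x(2) by metis+
    have sub: "O3 \<subseteq> A" unfolding O3_def using x psubset.prems(1) by blast
    have s3: "sum f O3 = 3 * f x"
      unfolding O3_def using d x psubset.prems(1,3) by (simp add: eq_commute)
    \<comment> \<open>If \<tau> sent \<open>y\<close> into the orbit, two more applications would
      bring \<open>y\<close> itself into it.\<close>
    have inv: "\<tau> y \<in> A - O3" if "y \<in> A - O3" for y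
    proof -
      have y: "y \<in> A" "\<tau> (\<tau> (\<tau> y)) = y" using that psubset.prems(2) by blast+
      have "\<tau> y \<notin> O3"
      proof
        assume "\<tau> y \<in> O3"
        then have "\<tau> (\<tau> (\<tau> y)) \<in> O3" unfolding O3_def using t by auto
        then show False using y that by simp
      qed
      then show ?thesis using y psubset.prems(1) by blast
    qed
    have "A - O3 \<subset> A" using sub unfolding O3_def by blast
    then have IH: "eisenstein_cong (sum f (A - O3)) (sum f {x \<in> A - O3. \<tau> x = x}) 3"
      using inv psubset.prems by (intro psubset.IH) auto
    have "{x \<in> A - O3. \<tau> x = x} = {x \<in> A. \<tau> x = x}"
      unfolding O3_def using d x t by auto
    moreover have "sum f A = sum f (A - O3) + 3 * f x"
      using sum.subset_diff[OF sub psubset.hyps(1), of f] s3 by simp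
    moreover have "f x \<in> eisenstein_ints" using psubset.prems(4) x by blast
    ultimately have "eisenstein_cong (sum f A) (sum f (A - O3)) 3"
      unfolding eisenstein_cong_def by (intro bexI[of _ "f x"]) simp_all
    from eis_cong_trans[OF this IH] show ?thesis
      by (simp only: \<open>{x \<in> A - O3. \<tau> x = x} = {x \<in> A. \<tau> x = x}\<close>)
  qed
qed

section \<open>Homomorphisms from the Eisenstein integers\<close>

definition eis_coords :: "complex \<Rightarrow> int \<times> int" where
  "eis_coords z = (SOME (a, b). z = of_int a + of_int b * omega)"

lemma eis_coords_eq: "eis_coords (of_int a + of_int b * omega) = (a, b)"
proof -
  have "(case eis_coords (of_int a + of_int b * omega) of (c, e) \<Rightarrow>
      of_int a + of_int b * omega = of_int c + of_int e * omega)"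
    unfolding eis_coords_def by (rule someI[of _ "(a, b)"]) simp
  then show ?thesis using eisenstein_coords_unique[of a b] by (auto split: prod.splits)
qed

text \<open>The map sending \<open>omega\<close> to \<open>W\<close>. It is a ring homomorphism on
  the Eisenstein integers when \<open>W\<close> is a root of the same quadratic polynomial, and it
  takes the place of a quotient ring.\<close>

definition eis_hom :: "'b::comm_ring_1 \<Rightarrow> complex \<Rightarrow> 'b" where
  "eis_hom W z = of_int (fst (eis_coords z)) + of_int (snd (eis_coords z)) * W"

lemma eis_hom_eq: "eis_hom W (of_int a + of_int b * omega) = of_int a + of_int b * W"
  by (simp add: eis_hom_def eis_coords_eq)

lemma eis_hom_of_int: "eis_hom W (of_int a) = of_int a"
  using eis_hom_eq[of W a 0] by simp

lemma eis_hom_of_nat: "eis_hom W (of_nat a) = of_nat a"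
  using eis_hom_of_int[of W "int a"] by simp

lemma eis_hom_add:
  assumes "x \<in> eisenstein_ints" "y \<in> eisenstein_ints"
  shows "eis_hom W (x + y) = eis_hom W x + eis_hom W y"
proof -
  obtain a b where x: "x = of_int a + of_int b * omega" using assms(1) by (rule eisensteinE)
  obtain c e where y: "y = of_int c + of_int e * omega" using assms(2) by (rule eisensteinE)
  have "x + y = of_int (a + c) + of_int (b + e) * omega" by (simp add: x y algebra_simps)
  then have "eis_hom W (x + y) = of_int (a + c) + of_int (b + e) * W" by (simp only: eis_hom_eq)
  then show ?thesis by (simp add: x y eis_hom_eq distrib_right)
qed

lemma eis_hom_mult:
  assumes "x \<in> eisenstein_ints" "y \<in> eisenstein_ints" "W\<^sup>2 + W + 1 = 0"
  shows "eis_hom W (x * y) = eis_hom W x * eis_hom W y"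
proof -
  obtain a b where x: "x = of_int a + of_int b * omega" using assms(1) by (rule eisensteinE)
  obtain c e where y: "y = of_int c + of_int e * omega" using assms(2) by (rule eisensteinE)
  have "eis_hom W (x * y) = of_int (a * c - b * e) + of_int (a * e + b * c - b * e) * W"
    unfolding x y mult_coords eis_hom_eq ..
  also have "\<dots> = (of_int a + of_int b * W) * (of_int c + of_int e * W)
      - of_int b * of_int e * (W\<^sup>2 + W + 1)"
    by (simp add: algebra_simps power2_eq_square)
  finally show ?thesis by (simp add: x y eis_hom_eq assms(3))
qed

lemma eis_hom_power:
  assumes "x \<in> eisenstein_ints" "W\<^sup>2 + W + 1 = 0"
  shows "eis_hom W (x ^ n) = eis_hom W x ^ n"
proof (induction n)
  case 0
  show ?case using eis_hom_of_int[of W 1] by simp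
next
  case (Suc n)
  then show ?case using assms by (simp add: eis_hom_mult eis_power)
qed

lemma eis_hom_sum:
  assumes "\<And>x. x \<in> A \<Longrightarrow> f x \<in> eisenstein_ints"
  shows "eis_hom W (sum f A) = (\<Sum>x\<in>A. eis_hom W (f x))"
  using assms
proof (induction A rule: infinite_finite_induct)
  case (insert x A)
  then show ?case by (simp add: eis_hom_add eis_sum)
qed (use eis_hom_of_int[of W 0] in auto)

section \<open>Gauss and Jacobi sums modulo 3\<close>

context cubic_field
begin

text \<open>Units of this subfield are powers of \<open>\<alpha> ^ (M div (p ^ k - 1))\<close>. As
  \<open>3 * k\<close> divides \<open>d\<close>, that exponent is a multiple of
  \<open>p ^ (2 * k) + p ^ k + 1\<close>, which is divisible by 3; so these units are cubes.\<close>

lemma chi_subfield: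
  assumes "3 * k dvd d" "k > 0" "x \<in> subfield k" "x \<noteq> 0" and w: "w ^ 3 = 1"
  shows "\<chi> w x = 1"
proof -
  have kd: "k dvd d" using assms(1) by (rule dvd_mult_right)
  have "x \<in> subfield k - {0}" using assms by simp
  then obtain j where j: "x = \<alpha> ^ (M div (p ^ k - 1) * j)"
    unfolding subfield_nz_eq(1)[OF kd assms(2)] by auto
  obtain a where a: "p ^ k = 3 * a + 1"
    using p_power_mod_3[of k] by (metis mult_div_mod_eq)
  have "a > 0" using one_less_power[OF p_gt_1 assms(2)] a by (cases a) auto
  have "p ^ (3 * k) = (3 * a + 1) ^ 3" by (simp only: mult.commute[of 3 k] power_mult a)
  also have "\<dots> = (3 * a) * (3 * (3 * a\<^sup>2 + 3 * a + 1)) + 1" by algebra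
  finally have "p ^ (3 * k) - 1 = (p ^ k - 1) * (3 * (3 * a\<^sup>2 + 3 * a + 1))" by (simp add: a)
  moreover have "p ^ (3 * k) - 1 dvd M" using assms(1) by (rule power_minus_1_dvd)
  ultimately obtain b where "M = (p ^ k - 1) * (3 * ((3 * a\<^sup>2 + 3 * a + 1) * b))"
    by (metis dvdE mult.assoc)
  then have "M div (p ^ k - 1) = 3 * ((3 * a\<^sup>2 + 3 * a + 1) * b)"
    using a \<open>a > 0\<close> by simp
  then have "x = \<alpha> ^ (3 * ((3 * a\<^sup>2 + 3 * a + 1) * b * j))" by (simp only: j mult.assoc)
  then have "\<chi> w x = w ^ (3 * ((3 * a\<^sup>2 + 3 * a + 1) * b * j))" by (simp only: chi_gen[OF w])
  also have "\<dots> = (w ^ 3) ^ ((3 * a\<^sup>2 + 3 * a + 1) * b * j)" by (rule power_mult)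
  finally have "\<chi> w x = (w ^ 3) ^ ((3 * a\<^sup>2 + 3 * a + 1) * b * j)" .
  then show ?thesis by (simp only: w power_one)
qed

definition trace_fibre :: "'a \<Rightarrow> 'a set" where
  "trace_fibre t = {x. field_trace p d x = t}"

lemma finite_subset_of_field [simp]: "finite (A :: 'a set)"
  by (rule finite_subset[OF subset_UNIV]) simp

lemma sum_trace_fibres:
  "(\<Sum>x\<in>UNIV. f x) = (\<Sum>t\<in>subfield (Suc 0). \<Sum>x\<in>trace_fibre t. f x :: complex)"
proof -
  have "(UNIV :: 'a set) = (\<Union>t\<in>subfield (Suc 0). trace_fibre t)"
    using trace_prime_field by (auto simp: trace_fibre_def)
  then have "(\<Sum>x\<in>UNIV. f x) = (\<Sum>x\<in>(\<Union>t\<in>subfield (Suc 0). trace_fibre t). f x)" by simp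
  also have "\<dots> = (\<Sum>t\<in>subfield (Suc 0). \<Sum>x\<in>trace_fibre t. f x)"
    by (rule sum.UNION_disjoint) (auto simp: trace_fibre_def)
  finally show ?thesis .
qed

text \<open>The character is trivial on the prime field, so scaling shows that all fibres over
  \<open>t \<noteq> 0\<close> have the same sum \<open>S 1\<close>. The total being 0 gives
  \<open>S 0 = - (p - 1) * S 1\<close>, and the values of \<open>unity_char\<close> at
  \<open>t \<noteq> 0\<close> add up to -1.\<close>

lemma gauss_eq_trace_fibre:
  assumes "prim_root3 w"
  shows "gauss w = - of_nat p * (\<Sum>x\<in>trace_fibre 1. \<chi> w x)"
proof -
  note w = prim_root3_cube[OF assms]
  define S where "S t = (\<Sum>x\<in>trace_fibre t. \<chi> w x)" for t
  define F :: "'a set" where "F = subfield (Suc 0)"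
  have d3: "3 * Suc 0 dvd d" using three_dvd_d by simp
  have S: "S t = S 1" if "t \<in> F - {0}" for t
  proof -
    have t: "t \<in> subfield (Suc 0)" "t \<noteq> 0" using that by (auto simp: F_def)
    have tr: "field_trace p d (c * x) = c * field_trace p d x" if "c \<in> subfield (Suc 0)" for c x
      using trace_scale[of c 1 d x] that by simp
    have "S t = (\<Sum>x\<in>trace_fibre 1. \<chi> w (t * x))"
      unfolding S_def
    proof (rule sum.reindex_bij_witness[of _ "\<lambda>x. t * x" "\<lambda>x. (1 / t) * x"])
      fix x assume "x \<in> trace_fibre t"
      then show "(1 / t) * x \<in> trace_fibre 1"
        using tr[OF subfield_divide[OF one_subfield t(1)], of x] t(2) by (simp add: trace_fibre_def)
    next
      fix x assume "x \<in> trace_fibre 1"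
      then show "t * x \<in> trace_fibre t"
        using tr[OF t(1), of x] by (simp add: trace_fibre_def)
    qed (use t in simp_all)
    then show ?thesis
      using chi_subfield[OF d3 _ t w] by (simp add: chi_mult[OF w] S_def)
  qed
  have split: "(\<Sum>t\<in>F. h t) = h 0 + (\<Sum>t\<in>F - {0}. h t)" for h :: "'a \<Rightarrow> complex"
    by (rule sum.remove) (auto simp: F_def)
  have cF: "of_nat (card (F - {0})) = (of_nat p - 1 :: complex)"
    using subfield_nz_eq(2)[of 1] p_gt_1 by (simp add: F_def card_Diff_singleton of_nat_diff)
  have "(\<Sum>t\<in>F. S t) = 0"
    using sum_trace_fibres[of "\<chi> w"] sum_chi[OF assms] by (simp add: S_def F_def)
  then have S0: "S 0 + (of_nat p - 1) * S 1 = 0"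
    unfolding split[of S] by (simp add: S cF)
  have e: "1 + (\<Sum>t\<in>F - {0}. unity_char t) = 0"
    using sum_unity_char_subfield[of 1] split[of unity_char]
    by (simp add: F_def unity_char_0 field_trace_def)
  have "gauss w = (\<Sum>t\<in>F. \<Sum>x\<in>trace_fibre t. \<chi> w x * \<psi> x)"
    unfolding gauss_def F_def by (rule sum_trace_fibres)
  also have "\<dots> = (\<Sum>t\<in>F. unity_char t * S t)"
    unfolding S_def sum_distrib_left
    by (intro sum.cong refl) (simp add: trace_fibre_def psi_eq mult.commute)
  also have "\<dots> = S 0 + (\<Sum>t\<in>F - {0}. unity_char t) * S 1"
    unfolding split[of "\<lambda>t. unity_char t * S t"] by (simp add: unity_char_0 S sum_distrib_right)
  also have "\<dots> = - of_nat p * S 1" using S0 e by algebra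
  finally show ?thesis by (simp add: S_def)
qed

lemma p_neq_3: "p \<noteq> 3" using p_mod_3 by auto

lemma three_neq_0: "(3 :: 'a) \<noteq> 0"
proof
  assume "(3 :: 'a) = 0"
  then have "of_nat 3 = (of_nat 0 :: 'a)" by simp
  then have "3 mod p = 0" unfolding of_nat_eq_iff by simp
  moreover have "p \<noteq> 2" using p_mod_3 by auto
  then have "p > 3" using p_neq_3 p_gt_1 by linarith
  ultimately show False by simp
qed

lemma eis_chi: "prim_root3 w \<Longrightarrow> \<chi> w x \<in> eisenstein_ints"
  by (simp add: \<chi>_def eis_power eis_prim_root3)

text \<open>The fixed points of \<tau> form the subfield of degree \<open>d div 3\<close>. On it the
  trace is three times the trace of that subfield and the character is 1, so the fixed points of the
  fibre are just counted, and their number is a power of \<open>p\<close>.\<close>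

lemma trace_fibre_sum_cong:
  assumes "prim_root3 w"
  shows "eisenstein_cong (\<Sum>x\<in>trace_fibre 1. \<chi> w x) 1 3"
proof -
  note w = prim_root3_cube[OF assms]
  define k where "k = d div 3"
  have d: "d = k * 3" using three_dvd_d by (simp add: k_def)
  then have k: "k > 0" "k dvd d" "3 * k dvd d" using d_pos by auto
  define \<tau> where "\<tau> x = x ^ (p ^ k)" for x :: 'a
  have tr: "field_trace p d (\<tau> x) = field_trace p d x" for x
  proof -
    have "field_trace p d (\<tau> x) = (field_trace p d x) ^ (p ^ k)"
      unfolding field_trace_def frob_sum \<tau>_def by (simp add: mult.commute flip: power_mult)
    also have "\<dots> = field_trace p d x"
      using subfield_power_mult[OF trace_prime_field, of x k] by simp
    finally show ?thesis .
  qed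
  have "eisenstein_cong (\<Sum>x\<in>trace_fibre 1. \<chi> w x) (\<Sum>x | x \<in> trace_fibre 1 \<and> \<tau> x = x. \<chi> w x) 3"
  proof (rule eis_cong_sum_fixpoints)
    fix x :: 'a
    have "\<tau> (\<tau> (\<tau> x)) = x ^ (p ^ (k * 3))"
      by (simp only: \<tau>_def power_mult power3_eq_cube)
    then show "\<tau> (\<tau> (\<tau> x)) = x" using power_card[of x] by (simp only: d[symmetric])
    show "\<chi> w (\<tau> x) = \<chi> w x" unfolding \<tau>_def by (rule chi_frob[OF w])
    show "x \<in> trace_fibre 1 \<Longrightarrow> \<tau> x \<in> trace_fibre 1" by (simp add: trace_fibre_def tr)
    show "\<chi> w x \<in> eisenstein_ints" by (rule eis_chi[OF assms])
  qed simp
  also have "(\<Sum>x | x \<in> trace_fibre 1 \<and> \<tau> x = x. \<chi> w x)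
      = (\<Sum>x | x \<in> subfield k \<and> field_trace p k x = 1 / 3. \<chi> w x)"
  proof (rule sum.cong)
    have "field_trace p d x = 3 * field_trace p k x" if "x \<in> subfield k" for x
    proof -
      have "field_trace (p ^ k) 3 x = 3 * x"
        using that by (simp add: field_trace_def subfield_def eval_nat_numeral power_mult)
      then have "field_trace p d x = field_trace p k (3 * x)"
        using trace_trace[of k 3 x] by (simp only: d)
      also have "\<dots> = 3 * field_trace p k x"
        using trace_scale[OF subfield_of_nat[of 3 1], of k x] by simp
      finally show ?thesis .
    qed
    then show "{x \<in> trace_fibre 1. \<tau> x = x} = {x. x \<in> subfield k \<and> field_trace p k x = 1 / 3}"
      using three_neq_0 unfolding trace_fibre_def \<tau>_def subfield_def by (auto simp: field_simps)
  qed simp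
  also have "\<dots> = (\<Sum>x | x \<in> subfield k \<and> field_trace p k x = 1 / 3. 1)"
  proof (rule sum.cong[OF refl])
    fix x assume "x \<in> {x. x \<in> subfield k \<and> field_trace p k x = 1 / 3}"
    then have x: "x \<in> subfield k" "field_trace p k x = 1 / 3" by auto
    have "x \<noteq> 0" using x(2) trace_0[of 1 k] three_neq_0 by auto
    then show "\<chi> w x = 1" using chi_subfield[OF k(3,1) x(1) _ w] by blast
  qed
  also have "\<dots> = of_nat (card {x \<in> subfield k. field_trace p k x = 1 / 3})" by simp
  also have "card {x \<in> subfield k. field_trace p k x = 1 / 3} = p ^ (k - 1)"
    using subfield_divide[OF one_subfield subfield_of_nat[of 3 "Suc 0"]]
    by (intro card_trace_fibre[OF k(2,1)]) simp
  finally have 1: "eisenstein_cong (\<Sum>x\<in>trace_fibre 1. \<chi> w x) (of_nat (p ^ (k - 1))) 3" .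
  obtain a where "p ^ (k - 1) = 3 * a + 1"
    using p_power_mod_3[of "k - 1"] by (metis mult_div_mod_eq)
  then have "eisenstein_cong (of_nat (p ^ (k - 1))) 1 3"
    unfolding eisenstein_cong_def by (intro bexI[of _ "of_nat a"]) simp_all
  then show ?thesis using 1 eis_cong_trans by blast
qed

lemma gauss_cong:
  assumes "prim_root3 w"
  shows "eisenstein_cong (gauss w) (- 1) 3"
proof -
  define S where "S = (\<Sum>x\<in>trace_fibre 1. \<chi> w x)"
  obtain a where a: "p = 3 * a + 1" using p_mod_3 by (metis mult_div_mod_eq)
  obtain z where z: "z \<in> eisenstein_ints" "S - 1 = 3 * z"
    using trace_fibre_sum_cong[OF assms] unfolding eisenstein_cong_def S_def by blast
  have S: "S \<in> eisenstein_ints" unfolding S_def by (intro eis_sum eis_chi assms)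
  have g: "gauss w = - of_nat p * S" using gauss_eq_trace_fibre[OF assms] by (simp add: S_def)
  have "gauss w - - 1 = 3 * (- z - of_nat a * S)"
  proof -
    have "of_nat p = 3 * of_nat a + (1 :: complex)" by (simp add: a)
    then show ?thesis using z(2) g by algebra
  qed
  moreover have "- z - of_nat a * S \<in> eisenstein_ints"
    using z S by (intro eis_diff eis_minus eis_mult) auto
  ultimately show ?thesis unfolding eisenstein_cong_def by blast
qed

lemma eis_jacobi: "prim_root3 w \<Longrightarrow> jacobi w \<in> eisenstein_ints"
  unfolding jacobi_def by (intro eis_sum eis_mult eis_chi)

text \<open>With \<open>gauss w = 3 * z - 1\<close> the cube is congruent to -1 modulo 9, and so is
  \<open>J\<close>, because \<open>r\<close> is congruent to 1 modulo 9.\<close>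

lemma jacobi_cong:
  assumes "prim_root3 w"
  shows "eisenstein_cong (jacobi w) (- 1) 3"
proof -
  obtain z where z: "z \<in> eisenstein_ints" "gauss w - - 1 = 3 * z"
    using gauss_cong[OF assms] unfolding eisenstein_cong_def by blast
  obtain a where a: "M = 9 * a" using nine_dvd_M by (auto elim: dvdE)
  define J where "J = jacobi w"
  have J: "J \<in> eisenstein_ints" unfolding J_def by (rule eis_jacobi[OF assms])
  have "(of_nat r :: complex) = 9 * of_nat a + 1" by (simp only: r_eq a) simp
  moreover have "gauss w ^ 3 = of_nat r * J" by (simp only: gauss_cube[OF assms] J_def)
  ultimately have "J - - 1 = 3 * (3 * (z - 3 * z\<^sup>2 + 3 * z ^ 3 - of_nat a * J))"
    using z(2) by algebra
  moreover have "3 * (z - 3 * z\<^sup>2 + 3 * z ^ 3 - of_nat a * J) \<in> eisenstein_ints"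
    using z(1) J by (intro eis_mult eis_diff eis_add eis_power) simp_all
  ultimately show ?thesis unfolding eisenstein_cong_def J_def by blast
qed

text \<open>Either every unit contributes 1, and \<open>M\<close> is -1 in the field, or scaling by
  \<alpha> multiplies the sum by \<open>\<alpha> ^ k \<noteq> 1\<close>. For \<open>k = 0\<close>
  the extra term \<open>0 ^ 0 = 1\<close> would make the sum 0.\<close>

lemma sum_power:
  assumes "k > 0"
  shows "(\<Sum>x\<in>UNIV. x ^ k) = (if M dvd k then - 1 else (0 :: 'a))"
proof (cases "M dvd k")
  case True
  then obtain j where j: "k = M * j" by (auto elim: dvdE)
  have "(\<Sum>x\<in>UNIV. x ^ k :: 'a) = (\<Sum>x\<in>UNIV - {0::'a}. 1 :: 'a)"
    by (rule sum.mono_neutral_cong_right)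
      (use assms in \<open>auto simp: j power_mult power_r_minus_1 power_0_left\<close>)
  also have "\<dots> = of_nat M" by (simp add: card_UNIV card_Diff_subset M_def)
  also have "of_nat M + 1 = (of_nat r :: 'a)" by (simp only: r_eq) simp
  then have "of_nat M = (- 1 :: 'a)" using of_nat_p d_pos by (simp add: eq_neg_iff_add_eq_0)
  finally show ?thesis using True by simp
next
  case False
  have "(\<Sum>x\<in>UNIV. x ^ k :: 'a) = (\<Sum>x\<in>UNIV. (\<alpha> * x) ^ k)" by (rule sum_scale[symmetric, OF gen_nz])
  also have "\<dots> = \<alpha> ^ k * (\<Sum>x\<in>UNIV. x ^ k)" by (simp add: power_mult_distrib sum_distrib_left)
  finally have "(1 - \<alpha> ^ k) * (\<Sum>x\<in>UNIV. x ^ k) = 0" by (simp add: algebra_simps)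
  moreover have "\<alpha> ^ k \<noteq> 1" using False gen_power_eq_1_iff by simp
  ultimately show ?thesis using False by simp
qed

text \<open>All base \<open>p\<close> digits of \<open>L\<close> equal \<open>(p - 1) div 3\<close>,
  and twice this digit is below \<open>p\<close>. The induction is on the number of digits.\<close>

lemma central_binomial: "\<not> p dvd (2 * L choose L)"
proof -
  have "\<not> p dvd (2 * ((p ^ k - 1) div 3) choose ((p ^ k - 1) div 3))" for k
  proof (induction k)
    case 0
    show ?case using p_gt_1 by simp
  next
    case (Suc k)
    obtain c where c: "p = 3 * c + 1" using p_mod_3 by (metis mult_div_mod_eq)
    obtain a where a: "p ^ k = 3 * a + 1" using p_power_mod_3[of k] by (metis mult_div_mod_eq)
    have "p ^ Suc k = 3 * (p * a + c) + 1" by (simp add: a) (simp add: c algebra_simps)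
    then have "(p ^ Suc k - 1) div 3 = p * a + c" by simp
    moreover have "(p ^ k - 1) div 3 = a" by (simp add: a)
    moreover have "2 * c < p" using c by simp
    ultimately show ?case using central_binomial_step[OF prime_p _ Suc[unfolded \<open>(p ^ k - 1) div 3 = a\<close>]] by simp
  qed
  from this[of d] show ?thesis unfolding L_def M_def .
qed

text \<open>After binomial expansion each power sum is 0 unless \<open>M = 3 * L\<close> divides
  \<open>2 * L + j\<close>. This leaves \<open>j = L\<close>, that is, the central binomial
  coefficient up to sign.\<close>

lemma power_sum_jacobi_neq_0:
  "(\<Sum>x\<in>UNIV. x ^ (2 * L) * (1 - x) ^ (2 * L)) \<noteq> (0 :: 'a)"
proof -
  have "(\<Sum>x\<in>UNIV. x ^ (2 * L) * (1 - x) ^ (2 * L))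
      = (\<Sum>x\<in>UNIV. \<Sum>j\<le>2*L. of_nat (2 * L choose j) * (- 1) ^ j * x ^ (2 * L + j) :: 'a)"
  proof (rule sum.cong[OF refl])
    fix x :: 'a
    have "(1 - x) ^ (2 * L) = (- x + 1) ^ (2 * L)" by simp
    also have "\<dots> = (\<Sum>j\<le>2*L. of_nat (2 * L choose j) * (- x) ^ j * 1 ^ (2 * L - j))"
      by (rule binomial_ring)
    also have "\<dots> = (\<Sum>j\<le>2*L. of_nat (2 * L choose j) * (- 1) ^ j * x ^ j)"
    proof (rule sum.cong[OF refl])
      fix j
      have "(- x) ^ j = (- 1) ^ j * x ^ j" by (rule power_minus)
      then show "of_nat (2 * L choose j) * (- x) ^ j * 1 ^ (2 * L - j) = of_nat (2 * L choose j) * (- 1) ^ j * x ^ j"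
        by (simp only: power_one mult_1_right mult.assoc)
    qed
    finally show "x ^ (2 * L) * (1 - x) ^ (2 * L)
      = (\<Sum>j\<le>2*L. of_nat (2 * L choose j) * (- 1) ^ j * x ^ (2 * L + j))"
      by (simp only: sum_distrib_left power_add mult_ac)
  qed
  also have "\<dots> = (\<Sum>j\<le>2*L. of_nat (2 * L choose j) * (- 1) ^ j * (\<Sum>x\<in>UNIV. x ^ (2 * L + j)))"
    by (subst sum.swap) (simp only: sum_distrib_left)
  also have "\<dots> = (\<Sum>j\<le>2*L. if j = L then - (of_nat (2 * L choose j) * (- 1) ^ j) else 0)"
  proof (rule sum.cong[OF refl])
    fix j assume j: "j \<in> {..2 * L}"
    have "M dvd 2 * L + j \<longleftrightarrow> j = L"
    proof
      assume "M dvd 2 * L + j"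
      then obtain c where c: "2 * L + j = 3 * L * c" unfolding M_eq by (auto elim: dvdE)
      \<comment> \<open>The number \<open>2 * L + j\<close> lies between \<open>2 * L\<close> and
        \<open>4 * L\<close>.\<close>
      have "c = 1"
      proof (rule ccontr)
        assume "c \<noteq> 1"
        then consider "c = 0" | "c \<ge> 2" by linarith
        then show False
        proof cases
          case 1
          then show False using c L_pos by simp
        next
          case 2
          then have "3 * L * 2 \<le> 3 * L * c" by (intro mult_left_mono) auto
          moreover have "j \<le> 2 * L" using j by simp
          ultimately show False using c L_pos by linarith
        qed
      qed
      then show "j = L" using c by simp
    next
      assume "j = L"
      then have "2 * L + j = M" by (simp add: M_eq)
      then show "M dvd 2 * L + j" by simp
    qed
    then have "(\<Sum>x\<in>UNIV. x ^ (2 * L + j)) = (if j = L then - 1 else (0 :: 'a))"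
      using sum_power[of "2 * L + j"] L_pos by simp
    then show "of_nat (2 * L choose j) * (- 1) ^ j * (\<Sum>x\<in>UNIV. x ^ (2 * L + j))
        = (if j = L then - (of_nat (2 * L choose j) * (- 1) ^ j) else (0::'a))"
      by simp
  qed
  also have "\<dots> = - (of_nat (2 * L choose L) * (- 1) ^ L)"
    by (simp add: sum.delta)
  finally have eq: "(\<Sum>x\<in>UNIV. x ^ (2 * L) * (1 - x) ^ (2 * L)) = - (of_nat (2 * L choose L) * (- 1) ^ L :: 'a)" .
  have "of_nat (2 * L choose L) \<noteq> (0 :: 'a)"
    using central_binomial by (simp add: of_nat_eq_0_iff_char_dvd CHAR_eq)
  then show ?thesis unfolding eq by simp
qed

end

section \<open>Evaluation of the cubic Gauss sum\<close>

locale eisenstein_field = cubic_field +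
  fixes \<pi> :: complex
  assumes eis_pi: "\<pi> \<in> eisenstein_ints" and pi_norm: "\<pi> * cnj \<pi> = of_nat p"
    and pi_cong: "eisenstein_cong \<pi> (- 1) 3"
begin

section \<open>Reduction modulo \<pi>\<close>

definition "pa = fst (eis_coords \<pi>)"
definition "pb = snd (eis_coords \<pi>)"

lemma pi_eq: "\<pi> = of_int pa + of_int pb * omega"
proof -
  obtain a b where "\<pi> = of_int a + of_int b * omega" using eis_pi by (rule eisensteinE)
  then have "eis_coords \<pi> = (a, b)" by (simp only: eis_coords_eq)
  then have "pa = a" "pb = b" by (simp_all add: pa_def pb_def)
  then show ?thesis using \<open>\<pi> = of_int a + of_int b * omega\<close> by (simp only:)
qed

lemma pab_norm: "pa\<^sup>2 - pa * pb + pb\<^sup>2 = int p"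
proof -
  have "of_nat p = (of_int pa + of_int pb * omega) * (of_int (pa - pb) + of_int (- pb) * omega)"
    unfolding pi_norm[symmetric] by (subst (1 2) pi_eq) (simp add: cnj_omega algebra_simps)
  also have "\<dots> = of_int (pa\<^sup>2 - pa * pb + pb\<^sup>2) + of_int 0 * omega"
    unfolding mult_coords by (simp add: algebra_simps power2_eq_square)
  finally have "of_int (pa\<^sup>2 - pa * pb + pb\<^sup>2) + of_int 0 * omega = of_int (int p) + of_int 0 * omega"
    by simp
  then show ?thesis using eisenstein_coords_unique by blast
qed

lemma prime_int_p: "prime (int p)" using prime_p by simp

text \<open>Otherwise \<open>p\<close> would divide both coordinates of \<pi>, and the norm
  \<open>p\<close> would be divisible by \<open>p ^ 2\<close>. This makes division by
  \<open>pb\<close> possible in the field.\<close>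

lemma p_not_dvd_pb: "\<not> int p dvd pb"
proof
  assume "int p dvd pb"
  then obtain c where c: "pb = int p * c" by (auto elim: dvdE)
  have "pa * pa = int p * (1 + pa * c - int p * c * c)"
    using pab_norm unfolding c by (simp add: algebra_simps power2_eq_square)
  then have "int p dvd pa * pa" by simp
  then have "int p dvd pa" using prime_int_p by (simp add: prime_dvd_mult_iff)
  then obtain e where e: "pa = int p * e" by (auto elim: dvdE)
  have "int p * (int p * (e * e - e * c + c * c)) = int p * 1"
    using pab_norm unfolding c e by (simp add: algebra_simps power2_eq_square)
  then have "int p * (e * e - e * c + c * c) = 1" using p_gt_1 by simp
  then have "int p dvd 1" by (metis dvd_triv_left)
  then show False using p_gt_1 by simp
qed

text \<open>The residue of \<open>omega\<close>: the solution of \<open>pa + pb * W = 0\<close>,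
  forced by sending \<pi> to 0.\<close>

definition W :: 'a where "W = - of_int pa / of_int pb"

lemma pb_neq_0: "of_int pb \<noteq> (0 :: 'a)" using p_not_dvd_pb by (simp add: of_int_eq_0_iff)

lemma W_root: "W\<^sup>2 + W + 1 = 0"
proof -
  have "W * of_int pb = - of_int pa" using pb_neq_0 by (simp add: W_def)
  moreover have "of_int (pa\<^sup>2 - pa * pb + pb\<^sup>2) = (0 :: 'a)" unfolding pab_norm by (simp add: of_nat_p)
  then have "(of_int pa)\<^sup>2 - of_int pa * of_int pb + (of_int pb)\<^sup>2 = (0 :: 'a)" by simp
  ultimately have "(of_int pb)\<^sup>2 * (W\<^sup>2 + W + 1) = 0" by algebra
  then show ?thesis using pb_neq_0 by simp
qed

definition red :: "complex \<Rightarrow> 'a" where "red = eis_hom W"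

lemmas red_add = eis_hom_add[where W = W, folded red_def]
lemmas red_mult = eis_hom_mult[OF _ _ W_root, folded red_def]
lemmas red_power = eis_hom_power[OF _ W_root, folded red_def]
lemmas red_sum = eis_hom_sum[where W = W, folded red_def]
lemmas red_of_nat = eis_hom_of_nat[where W = W, folded red_def]

lemma red_1: "red 1 = 1" using red_of_nat[of 1] by simp

lemma red_0: "red 0 = 0" using red_of_nat[of 0] by simp

lemma red_omega: "red omega = W"
  using eis_hom_eq[of W 0 1] by (simp add: red_def)

lemma red_pi: "red \<pi> = 0"
  unfolding red_def by (subst pi_eq) (use pb_neq_0 in \<open>simp only: eis_hom_eq, simp add: W_def\<close>)

lemma red_diff:
  assumes "x \<in> eisenstein_ints" "y \<in> eisenstein_ints"
  shows "red (x - y) = red x - red y"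
  using red_add[OF eis_diff[OF assms] assms(2)] by simp

text \<open>The kernel is the ideal generated by \<pi>: both coordinates of
  \<open>x * cnj \<pi>\<close> turn out to be divisible by \<open>p = \<pi> * cnj \<pi>\<close>, and
  \<open>cnj \<pi>\<close> cancels. For the second divisibility the norm form is used to rewrite
  \<open>pb * A\<close>.\<close>

lemma red_eq_0_imp:
  assumes "x \<in> eisenstein_ints" "red x = 0"
  obtains z where "z \<in> eisenstein_ints" "x = \<pi> * z"
proof -
  obtain u v where x: "x = of_int u + of_int v * omega" using assms(1) by (rule eisensteinE)
  have "of_int u + of_int v * W = (0 :: 'a)" using assms(2) by (simp only: red_def x eis_hom_eq)
  moreover have "W * of_int pb = - of_int pa" using pb_neq_0 by (simp add: W_def)
  ultimately have "of_int u * of_int pb - of_int v * of_int pa = (0 :: 'a)" by algebra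
  then have "of_int (v * pa - u * pb) = (0 :: 'a)" by (simp add: mult.commute)
  then have d1: "int p dvd v * pa - u * pb" unfolding of_int_eq_0_iff .
  define A where "A = u * pa - u * pb + v * pb"
  have "pb * A = (u * (pa * pb) - (u * pb) * pb + v * pb\<^sup>2)" by (simp add: A_def algebra_simps power2_eq_square)
  also have "\<dots> = (pb - pa) * (v * pa - u * pb) + v * (pa\<^sup>2 - pa * pb + pb\<^sup>2)"
    by (simp add: algebra_simps power2_eq_square)
  finally have "int p dvd pb * A" using d1 by (simp only: pab_norm) simp
  then have d2: "int p dvd A" using p_not_dvd_pb prime_int_p by (simp add: prime_dvd_mult_iff)
  obtain c e where ce: "v * pa - u * pb = int p * c" "A = int p * e" using d1 d2 by (auto elim!: dvdE)
  have "x * cnj \<pi> = (of_int u + of_int v * omega) * (of_int (pa - pb) + of_int (- pb) * omega)"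
    unfolding x by (subst pi_eq) (simp add: cnj_omega algebra_simps)
  also have "\<dots> = of_int A + of_int (v * pa - u * pb) * omega"
    unfolding mult_coords A_def by (simp add: algebra_simps)
  also have "\<dots> = of_nat p * (of_int e + of_int c * omega)" unfolding ce by (simp add: algebra_simps)
  also have "\<dots> = \<pi> * (of_int e + of_int c * omega) * cnj \<pi>" unfolding pi_norm[symmetric] by (simp only: mult_ac)
  finally have "x * cnj \<pi> = \<pi> * (of_int e + of_int c * omega) * cnj \<pi>" .
  moreover have "cnj \<pi> \<noteq> 0" using pi_norm p_gt_1 by auto
  ultimately have "x = \<pi> * (of_int e + of_int c * omega)" using mult_right_cancel by blast
  then show thesis using that eisensteinI by blast
qed

lemma cong_pi_iff:
  assumes "x \<in> eisenstein_ints" "y \<in> eisenstein_ints"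
  shows "eisenstein_cong x y \<pi> \<longleftrightarrow> red x = red y"
proof
  assume "eisenstein_cong x y \<pi>"
  then obtain z where "z \<in> eisenstein_ints" "x - y = \<pi> * z" unfolding eisenstein_cong_def by blast
  then have "red (x - y) = 0" by (simp add: red_mult[OF eis_pi] red_pi)
  then show "red x = red y" by (simp add: red_diff[OF assms])
next
  assume "red x = red y"
  then have "red (x - y) = 0" by (simp add: red_diff[OF assms])
  then show "eisenstein_cong x y \<pi>"
    using red_eq_0_imp[OF eis_diff[OF assms]] unfolding eisenstein_cong_def by blast
qed

text \<open>A replacement for unique factorisation. The residues of \<open>x\<close> and
  \<open>cnj x\<close> multiply to 0 and the second is nonzero, so \<pi> divides \<open>x\<close>;
  the nonzero residue is inherited by the quotient.\<close>

lemma norm_descent: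
  assumes "x \<in> eisenstein_ints" "x * cnj x = of_nat (p ^ n)" "red (cnj x) \<noteq> 0"
  shows "\<exists>u\<in>eisenstein_ints. u * cnj u = 1 \<and> x = u * \<pi> ^ n"
  using assms
proof (induction n arbitrary: x)
  case 0
  then show ?case by (intro bexI[of _ x]) simp_all
next
  case (Suc n)
  have "red x * red (cnj x) = red (of_nat (p ^ Suc n))"
    using red_mult[OF Suc.prems(1) eis_cnj[OF Suc.prems(1)]] Suc.prems(2) by simp
  also have "\<dots> = 0" unfolding red_of_nat by (simp add: of_nat_p)
  finally have "red x = 0" using Suc.prems(3) by simp
  then obtain y where y: "y \<in> eisenstein_ints" "x = \<pi> * y" using red_eq_0_imp[OF Suc.prems(1)] by blast
  have "of_nat p * (y * cnj y) = x * cnj x" unfolding pi_norm[symmetric] y(2) by simp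
  also have "\<dots> = of_nat p * of_nat (p ^ n)" unfolding Suc.prems(2) by simp
  finally have "y * cnj y = of_nat (p ^ n)" by (simp only: mult_cancel_left) simp
  moreover have "red (cnj y) \<noteq> 0"
    using Suc.prems(3) red_mult[OF eis_cnj[OF eis_pi] eis_cnj[OF y(1)]] unfolding y(2) by auto
  ultimately obtain u where "u \<in> eisenstein_ints" "u * cnj u = 1" "y = u * \<pi> ^ n"
    using Suc.IH[OF y(1)] by blast
  then show ?case using y(2) by (intro bexI[of _ u]) simp_all
qed

definition \<rho> :: complex where "\<rho> = cubic_char p d \<pi> \<alpha>"

lemma gen_L: "(\<alpha> ^ L)\<^sup>2 + \<alpha> ^ L + 1 = 0"
proof -
  have "(\<alpha> ^ L) ^ 3 = 1"
    by (simp only: power_mult[symmetric] mult.commute[of L] M_eq[symmetric] power_r_minus_1[OF gen_nz])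
  moreover have "(t - 1) * (t\<^sup>2 + t + 1) = t ^ 3 - 1" for t :: 'a by algebra
  ultimately have "(\<alpha> ^ L - 1) * ((\<alpha> ^ L)\<^sup>2 + \<alpha> ^ L + 1) = 0" by simp
  moreover have "\<alpha> ^ L \<noteq> 1"
    unfolding gen_power_eq_1_iff using L_pos M_eq by (auto dest: dvd_imp_le)
  ultimately show ?thesis by simp
qed

text \<open>The norm of \<alpha> is \<open>\<alpha> ^ T\<close> with
  \<open>T = 1 + p + \<dots> + p ^ (d - 1)\<close>, and \<open>(p - 1) * T = M\<close>.\<close>

lemma field_norm_power: "field_norm p d \<alpha> ^ ((p - 1) div 3) = \<alpha> ^ L"
  and field_norm_prime_field: "field_norm p d \<alpha> \<in> subfield (Suc 0)"
proof -
  define T where "T = (\<Sum>i<d. p ^ i)"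
  have n: "field_norm p d \<alpha> = \<alpha> ^ T" unfolding field_norm_def T_def by (simp only: power_sum)
  obtain c where c: "p = 3 * c + 1" using p_mod_3 by (metis mult_div_mod_eq)
  have "int p ^ d - 1 = (int p - 1) * int T"
    unfolding T_def by (simp add: power_diff_1_eq)
  then have "int M = int (3 * c) * int T" by (simp only: c[symmetric] M_def) (simp add: c of_nat_diff)
  then have M: "M = 3 * c * T" by (simp only: of_nat_mult[symmetric] of_nat_eq_iff)
  then have "T * c = L" unfolding M_eq by simp
  moreover have "(p - 1) div 3 = c" using c by simp
  ultimately show "field_norm p d \<alpha> ^ ((p - 1) div 3) = \<alpha> ^ L" by (simp only: n power_mult[symmetric])
  have "T * p = T + M" unfolding M by (subst c) (simp add: algebra_simps)
  then have "(\<alpha> ^ T) ^ p = \<alpha> ^ T"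
    by (simp only: power_mult[symmetric] power_add power_r_minus_1[OF gen_nz] mult_1_right)
  then show "field_norm p d \<alpha> \<in> subfield (Suc 0)" by (simp add: n subfield_def)
qed

text \<open>Modulo \<pi> the defining congruence says that the residue is
  \<open>\<alpha> ^ L\<close>. This is one of the two roots \<open>W\<close> and
  \<open>W\<^sup>2\<close> of the cyclotomic polynomial, and 1, \<open>W\<close>,
  \<open>W\<^sup>2\<close> are distinct because the characteristic is not 3.\<close>

lemma rho: "prim_root3 \<rho>" and red_rho: "red \<rho> = \<alpha> ^ L"
proof -
  define c where "c = prime_field_rep (field_norm p d \<alpha>)"
  define k where "k = (p - 1) div 3"
  have rc: "red (of_nat c ^ k) = \<alpha> ^ L"
    unfolding red_power[OF eis_of_nat] red_of_nat c_def of_nat_prime_field_rep[OF field_norm_prime_field]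
      k_def field_norm_power ..
  have r2: "red (omega ^ 2) = W\<^sup>2" by (simp add: red_power red_omega)
  have P: "(\<zeta> \<in> {1, omega, omega ^ 2} \<and> eisenstein_cong \<zeta> (of_nat c ^ k) \<pi>)
      \<longleftrightarrow> (\<zeta> \<in> {1, omega, omega ^ 2} \<and> red \<zeta> = \<alpha> ^ L)" for \<zeta>
    using cong_pi_iff[of \<zeta> "of_nat c ^ k"] by (auto simp: rc eis_power)
  have n1: "\<alpha> ^ L \<noteq> 1"
    using gen_L three_neq_0 by auto
  have "(t - W) * (t - W\<^sup>2) = 0" if "t\<^sup>2 + t + 1 = 0" for t using that W_root by algebra
  from this[OF gen_L] have "(\<alpha> ^ L - W) * (\<alpha> ^ L - W\<^sup>2) = 0" .
  then have "\<alpha> ^ L = W \<or> \<alpha> ^ L = W\<^sup>2" by simp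
  then have "red omega = \<alpha> ^ L \<or> red (omega ^ 2) = \<alpha> ^ L" unfolding red_omega r2 by metis
  then have ex: "\<exists>\<zeta>. \<zeta> \<in> {1, omega, omega ^ 2} \<and> red \<zeta> = \<alpha> ^ L" by blast
  have ne: "W \<noteq> W\<^sup>2"
  proof
    assume "W = W\<^sup>2"
    then have "W = 0 \<or> W = 1" by (simp add: power2_eq_square)
    then show False using W_root three_neq_0 by auto
  qed
  have uniq: "\<zeta> = \<zeta>'" if "\<zeta> \<in> {1, omega, omega ^ 2} \<and> red \<zeta> = \<alpha> ^ L"
    "\<zeta>' \<in> {1, omega, omega ^ 2} \<and> red \<zeta>' = \<alpha> ^ L" for \<zeta> \<zeta>'
    using that n1 ne by (auto simp: red_1 red_omega r2)
  have "\<rho> \<in> {1, omega, omega ^ 2} \<and> red \<rho> = \<alpha> ^ L"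
    unfolding \<rho>_def cubic_char_def c_def[symmetric] k_def[symmetric] P
    using theI'[of "\<lambda>\<zeta>. \<zeta> \<in> {1, omega, omega ^ 2} \<and> red \<zeta> = \<alpha> ^ L"] ex uniq by blast
  then show "red \<rho> = \<alpha> ^ L" "prim_root3 \<rho>"
    using n1 by (auto simp: red_1 prim_root3_iff)
qed

text \<open>This turns character sums into power sums over the field.\<close>

lemma red_chi: "red (\<chi> \<rho> x) = x ^ L"
proof (cases "x = 0")
  case True
  then show ?thesis using L_pos by (simp add: red_0)
next
  case False
  then obtain j where j: "x = \<alpha> ^ j" using ex_gen_power by blast
  have "red (\<chi> \<rho> x) = (\<alpha> ^ L) ^ j"
    unfolding j chi_gen[OF prim_root3_cube[OF rho]] red_power[OF eis_prim_root3[OF rho]] red_rho ..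
  then show ?thesis by (simp add: j mult.commute flip: power_mult)
qed

text \<open>Conjugation replaces \<rho> by its square, so the exponent becomes \<open>2 * L\<close>,
  which is large enough for a surviving term of degree \<open>M\<close>.\<close>

lemma red_cnj_jacobi: "red (cnj (jacobi \<rho>)) \<noteq> 0"
proof -
  note w = prim_root3_cube[OF rho] and r2 = prim_root3_square[OF rho]
  have chi2: "red (\<chi> (\<rho>\<^sup>2) x) = x ^ (2 * L)" for x
    unfolding chi_square[OF w] red_mult[OF eis_chi[OF rho] eis_chi[OF rho]] red_chi
    by (simp only: power_add[symmetric] mult_2)
  have "cnj (jacobi \<rho>) = jacobi (\<rho>\<^sup>2)" by (simp add: cnj_jacobi cnj_prim_root3[OF rho])
  also have "red \<dots> = (\<Sum>x\<in>UNIV. x ^ (2 * L) * (1 - x) ^ (2 * L))"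
    unfolding jacobi_def
    by (subst red_sum) (simp_all add: eis_mult eis_chi[OF r2] red_mult chi2)
  finally show ?thesis using power_sum_jacobi_neq_0 by simp
qed

lemma pi_power_cong: "eisenstein_cong (\<pi> ^ n) ((- 1) ^ n) 3"
  by (intro eis_cong_power pi_cong eis_pi eis_minus) simp

text \<open>Descent leaves an unknown unit. It is found modulo 3, where the Jacobi sum is -1 and
  \<pi> is -1.\<close>

lemma jacobi_eq: "jacobi \<rho> = (- 1) ^ (d + 1) * \<pi> ^ d"
proof -
  have J: "jacobi \<rho> \<in> eisenstein_ints" by (rule eis_jacobi[OF rho])
  have "jacobi \<rho> * cnj (jacobi \<rho>) = of_nat (p ^ d)"
    unfolding cnj_jacobi cnj_prim_root3[OF rho] by (rule jacobi_norm[OF rho])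
  from norm_descent[OF J this red_cnj_jacobi] obtain u
    where u: "u \<in> eisenstein_ints" "u * cnj u = 1" "jacobi \<rho> = u * \<pi> ^ d" by blast
  have s: "(- 1) ^ n * (- 1) ^ n = (1 :: complex)" for n by (simp flip: power_mult_distrib)
  have e1: "(- 1) ^ n \<in> eisenstein_ints" for n by (intro eis_power eis_minus eis_1)
  have "eisenstein_cong (u * \<pi> ^ d) (u * (- 1) ^ d) 3"
    by (intro eis_cong_mult eis_cong_refl pi_power_cong eis_power eis_pi u)
  then have "eisenstein_cong (u * (- 1) ^ d) (- 1) 3"
    using jacobi_cong[OF rho] unfolding u(3) using eis_cong_sym eis_cong_trans by blast
  then have "eisenstein_cong (u * (- 1) ^ d * (- 1)) (- 1 * - 1) 3"
    by (intro eis_cong_mult eis_cong_refl eis_minus eis_1)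
  then have "eisenstein_cong (u * (- 1) ^ (d + 1)) 1 3" by simp
  moreover have "u * (- 1) ^ (d + 1) * cnj (u * (- 1) ^ (d + 1)) = (u * cnj u) * ((- 1) ^ (d + 1) * (- 1) ^ (d + 1))"
    by (simp only: complex_cnj_mult complex_cnj_power complex_cnj_minus complex_cnj_one mult_ac)
  then have "u * (- 1) ^ (d + 1) * cnj (u * (- 1) ^ (d + 1)) = 1" by (simp only: u(2) s mult_1)
  ultimately have "u * (- 1) ^ (d + 1) = 1"
    using eis_unit_cong_1[of "u * (- 1) ^ (d + 1)"] eis_mult[OF u(1) e1] by blast
  then have "u = (- 1) ^ (d + 1)" using s[of "d + 1"] by (metis mult.assoc mult.left_neutral mult.right_neutral)
  then show ?thesis using u(3) by simp
qed

text \<open>\<open>T\<close> is the claimed value. Its cube is that of the Gauss sum, so the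
  quotient \<open>y\<close> is a cube root of unity; both sides are -1 modulo 3, hence
  \<open>y\<close> is congruent to 1 and equals 1.\<close>

lemma gauss_eq: "gauss \<rho> = (- 1) ^ (d + 1) * of_nat p ^ (d div 3) * \<pi> ^ (d div 3)"
proof -
  define k where "k = d div 3"
  have d: "d = 3 * k" using three_dvd_d by (simp add: k_def)
  define T where "T = (- 1) ^ (d + 1) * (of_nat p * \<pi>) ^ k"
  have pi0: "\<pi> \<noteq> 0" using pi_norm p_gt_1 by auto
  have "T ^ 3 = ((- 1) ^ 3) ^ (d + 1) * (of_nat p * \<pi>) ^ d"
    unfolding T_def d by (simp only: power_mult_distrib power_mult[symmetric] mult.commute)
  also have "\<dots> = of_nat r * ((- 1) ^ (d + 1) * \<pi> ^ d)" by (simp add: power_mult_distrib)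
  also have "\<dots> = gauss \<rho> ^ 3" by (simp only: gauss_cube[OF rho] jacobi_eq)
  finally have T3: "gauss \<rho> ^ 3 = T ^ 3" ..
  have T0: "T \<noteq> 0" using pi0 by (simp add: T_def)
  define y where "y = gauss \<rho> / T"
  have gy: "gauss \<rho> = y * T" using T0 by (simp add: y_def)
  have y3: "y ^ 3 = 1" using T3 T0 by (simp add: y_def power_divide)
  then have y: "y = 1 \<or> prim_root3 y" by (simp only: cube_eq_1_iff)
  then have yE: "y \<in> eisenstein_ints" by (auto intro: eis_prim_root3)
  have yn: "y * cnj y = 1"
    using y y3 by (auto simp: cnj_prim_root3 power2_eq_square power3_eq_cube mult.assoc)
  have pc: "eisenstein_cong (of_nat p) 1 3"
  proof -
    obtain c where "p = 3 * c + 1" using p_mod_3 by (metis mult_div_mod_eq)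
    then show ?thesis unfolding eisenstein_cong_def by (intro bexI[of _ "of_nat c"]) simp_all
  qed
  have "eisenstein_cong (of_nat p * \<pi>) (1 * - 1) 3"
    by (intro eis_cong_mult pc pi_cong eis_pi eis_1)
  then have "eisenstein_cong ((of_nat p * \<pi>) ^ k) ((1 * - 1) ^ k) 3"
    by (intro eis_cong_power eis_mult eis_pi eis_of_nat eis_minus eis_1)
  then have "eisenstein_cong T ((- 1) ^ (d + 1) * (1 * - 1) ^ k) 3"
    unfolding T_def
    by (intro eis_cong_mult eis_cong_refl eis_power eis_mult eis_pi eis_of_nat eis_minus eis_1)
  \<comment> \<open>The total exponent is \<open>3 * k + 1 + k\<close>, which is odd.\<close>
  moreover have "(- 1) ^ (d + 1) * (1 * - 1) ^ k = (- 1 :: complex)"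
  proof -
    have "(- 1) ^ (d + 1) * (1 * - 1) ^ k = (- 1 :: complex) ^ (2 * (2 * k) + 1)"
      by (simp add: d flip: power_add)
    then show ?thesis by (simp add: power_mult)
  qed
  ultimately have Tc: "eisenstein_cong T (- 1) 3" by simp
  have TE: "T \<in> eisenstein_ints"
    unfolding T_def by (intro eis_power eis_mult eis_pi eis_of_nat eis_minus eis_1)
  have "eisenstein_cong (y * T) (y * - 1) 3"
    by (intro eis_cong_mult eis_cong_refl Tc TE yE)
  then have "eisenstein_cong (y * - 1) (- 1) 3"
    using gauss_cong[OF rho] unfolding gy using eis_cong_sym eis_cong_trans by blast
  then have "eisenstein_cong (y * - 1 * - 1) (- 1 * - 1) 3"
    by (intro eis_cong_mult eis_cong_refl eis_minus eis_1)
  then have "eisenstein_cong y 1 3" by simp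
  then have "y = 1" using eis_unit_cong_1[OF yE yn] by blast
  then show ?thesis using gy by (simp add: T_def k_def power_mult_distrib mult.assoc)
qed

lemma gauss_square_eq: "gauss (\<rho>\<^sup>2) = (- 1) ^ (d + 1) * of_nat p ^ (d div 3) * cnj \<pi> ^ (d div 3)"
proof -
  have "gauss (\<rho>\<^sup>2) = cnj (gauss \<rho>)"
    by (simp add: cnj_gauss[OF prim_root3_cube[OF rho]] cnj_prim_root3[OF rho])
  then show ?thesis by (simp add: gauss_eq)
qed

end

lemma sum_lessThan_3_mult:
  fixes f :: "nat \<Rightarrow> 'b::comm_monoid_add"
  shows "(\<Sum>i<3 * n. f i) = (\<Sum>j<n. f (3 * j) + f (3 * j + 1) + f (3 * j + 2))"
  by (induction n) (simp_all add: eval_nat_numeral add.assoc)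

section \<open>Weights of the codewords\<close>

locale cyclic_code = cubic_field +
  fixes s m h :: nat
  assumes d_eq: "d = s * m" and h_pos: "h > 0" and h_dvd: "h dvd p ^ s - 1"
    and gcd_eq_3: "gcd ((p ^ d - 1) div (p ^ s - 1)) (3 * (p ^ s - 1) div h) = 3"
begin

abbreviation "q \<equiv> p ^ s"

text \<open>\<open>\<alpha> ^ K\<close> generates the units of GF(q), \<open>E\<close> is the
  exponent of \<open>g\<close>, and \<open>N\<close> is one third of the code length, not the gcd
  from the theorem.\<close>

definition "K = M div (q - 1)"
definition "E = (q - 1) div h"
definition "N = h * K div 3"
definition g :: 'a where "g = \<alpha> ^ E"
definition \<beta> :: 'a where "\<beta> = \<alpha> ^ L"

lemma s_pos: "s > 0" and s_dvd: "s dvd d" using d_eq d_pos by auto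

lemma q_gt_1: "q > 1" using p_gt_1 s_pos one_less_power by blast

lemma h_E: "h * E = q - 1" using h_dvd by (simp add: E_def)

lemma K_q: "K * (q - 1) = M" using power_minus_1_dvd[OF s_dvd] by (simp add: K_def)

lemma gcd_K_E: "gcd K (3 * E) = 3"
proof -
  have "3 * (q - 1) div h = 3 * E" using h_E h_pos by (metis mult.left_commute nonzero_mult_div_cancel_left not_gr_zero)
  then show ?thesis using gcd_eq_3 by (simp add: K_def M_def)
qed

lemma three_dvd_K: "3 dvd K" using gcd_dvd1[of K "3 * E"] by (simp only: gcd_K_E)

lemma K_pos: "K > 0" using K_q M_pos by (cases K) auto

lemma N_eq: "3 * N = h * K" using three_dvd_K by (simp add: N_def)

text \<open>The left side is the number of terms of \<open>S\<close> below, the right side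
  \<open>h\<close> times the number of cubes; this is where the factor \<open>h\<close> in
  \<open>S_eq\<close> comes from.\<close>

lemma q_N: "(q - 1) * N = h * L"
proof -
  have "3 * ((q - 1) * N) = (q - 1) * (h * K)" using N_eq by (metis mult.left_commute)
  also have "\<dots> = 3 * (h * L)" using K_q M_eq by (metis mult.left_commute mult.commute)
  finally show ?thesis by simp
qed

lemma g_power_N: "g ^ (3 * N) = 1"
proof -
  have "E * (3 * N) = M" using h_E K_q N_eq by (metis mult.assoc mult.commute)
  then show ?thesis by (simp only: g_def power_mult[symmetric] power_r_minus_1[OF gen_nz])
qed

lemma beta_cube: "\<beta> ^ 3 = 1"
  by (simp only: \<beta>_def power_mult[symmetric] mult.commute[of L] M_eq[symmetric] power_r_minus_1[OF gen_nz])

lemma beta_neq_1: "\<beta> \<noteq> 1"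
  unfolding \<beta>_def gen_power_eq_1_iff using L_pos M_eq by (auto dest: dvd_imp_le)

lemma beta_sum: "1 + \<beta> + \<beta>\<^sup>2 = 0"
proof -
  have "(\<beta> - 1) * (1 + \<beta> + \<beta>\<^sup>2) = \<beta> ^ 3 - 1" by algebra
  then show ?thesis using beta_cube beta_neq_1 by simp
qed

lemma beta_cube_mem: "\<beta> \<in> nonzero_cubes"
proof -
  have "3 dvd L" using nine_dvd_M M_eq by auto
  then show ?thesis by (simp add: \<beta>_def gen_power_cube_iff)
qed

lemma subfield_cubes: "subfield s - {0} \<subseteq> nonzero_cubes"
  unfolding subfield_nz_eq(1)[OF s_dvd s_pos] K_def[symmetric]
  using three_dvd_K by (auto simp: gen_power_cube_iff)

lemma card_subfield_nz: "card (subfield s - {0}) = q - 1"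
  using subfield_nz_eq(2)[OF s_dvd s_pos] by (simp add: card_Diff_singleton)

text \<open>The part of the orthogonality sum with nonzero scalars \<open>y\<close> that belongs to
  the positions in one residue class modulo 3.\<close>

definition S :: "'a \<Rightarrow> complex" where
  "S u = (\<Sum>y\<in>subfield s - {0}. \<Sum>j<N. \<psi> (y * (g ^ (3 * j) * u)))"

lemma S_scale_subfield: "y \<in> subfield s - {0} \<Longrightarrow> S (y * u) = S u"
  unfolding S_def
proof (rule sum.reindex_bij_witness[of _ "\<lambda>x. x / y" "\<lambda>x. x * y"])
  fix x assume y: "y \<in> subfield s - {0}" and x: "x \<in> subfield s - {0}"
  show "x * y \<in> subfield s - {0}" "x / y \<in> subfield s - {0}"
    using x y by (auto intro: subfield_mult subfield_divide)
  show "x * y / y = x" "x / y * y = x" using y by auto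
  show "(\<Sum>j<N. \<psi> (x * y * (g ^ (3 * j) * u))) = (\<Sum>j<N. \<psi> (x * (g ^ (3 * j) * (y * u))))"
    by (simp only: mult_ac)
qed

lemma S_scale_g: "S (g ^ 3 * u) = S u"
proof -
  have "(\<Sum>j<N. \<psi> (y * (g ^ (3 * j) * (g ^ 3 * u)))) = (\<Sum>j<N. \<psi> (y * (g ^ (3 * j) * u)))" for y
  proof -
    define f where "f j = \<psi> (y * (g ^ (3 * j) * u))" for j
    have "(\<Sum>j<N. f j) + f N = f 0 + (\<Sum>j<N. f (Suc j))"
      by (simp only: sum.lessThan_Suc[symmetric] sum.lessThan_Suc_shift)
    moreover have "f N = f 0" by (simp add: f_def g_power_N)
    moreover have "f (Suc j) = \<psi> (y * (g ^ (3 * j) * (g ^ 3 * u)))" for j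
      unfolding f_def mult_Suc_right power_add by (simp only: mult_ac)
    ultimately show ?thesis by (simp add: f_def)
  qed
  then show ?thesis by (simp only: S_def)
qed

lemma S_scale_g_power: "S (g ^ (3 * j) * u) = S u"
proof (induction j)
  case (Suc j)
  have "g ^ (3 * Suc j) * u = g ^ 3 * (g ^ (3 * j) * u)"
    by (simp only: mult_Suc_right power_add mult.assoc)
  then show ?case by (simp only: S_scale_g Suc.IH)
qed simp

text \<open>\<open>S\<close> is invariant under powers of \<open>\<alpha> ^ K\<close> and of
  \<open>g ^ 3 = \<alpha> ^ (3 * E)\<close>. Bezout for \<open>gcd K (3 * E) = 3\<close> combines
  the two into invariance under \<open>\<alpha> ^ 3\<close>.\<close>

lemma S_scale_gen: "S (\<alpha> ^ 3 * u) = S u"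
proof -
  obtain x y where xy: "K * x = 3 * E * y + gcd K (3 * E)"
    using bezout_nat[of K "3 * E"] K_pos by auto
  have "\<alpha> ^ (K * x) \<in> subfield s - {0}"
  proof -
    have "(\<alpha> ^ (K * x)) ^ q = \<alpha> ^ (K * x) * (\<alpha> ^ (K * (q - 1))) ^ x"
    proof -
      have "K * x * q = K * x + K * (q - 1) * x"
        using q_gt_1 by (cases q) (auto simp: algebra_simps)
      then show ?thesis by (simp only: power_mult[symmetric] power_add)
    qed
    then have "(\<alpha> ^ (K * x)) ^ q = \<alpha> ^ (K * x)" by (simp only: K_q power_r_minus_1[OF gen_nz] power_one mult_1_right)
    then show ?thesis using gen_nz by (simp add: subfield_def)
  qed
  then have "S (\<alpha> ^ (K * x) * u) = S u" by (rule S_scale_subfield)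
  moreover have "\<alpha> ^ (K * x) * u = g ^ (3 * y) * (\<alpha> ^ 3 * u)"
  proof -
    have "K * x = E * (3 * y) + 3" using xy gcd_K_E by simp
    then show ?thesis by (simp only: g_def power_mult[symmetric] power_add mult.assoc)
  qed
  ultimately show ?thesis by (simp only: S_scale_g_power)
qed

lemma S_scale_gen_power: "S (\<alpha> ^ (3 * i) * u) = S u"
proof (induction i)
  case (Suc i)
  have "\<alpha> ^ (3 * Suc i) * u = \<alpha> ^ 3 * (\<alpha> ^ (3 * i) * u)"
    by (simp only: mult_Suc_right power_add mult.assoc)
  then show ?case by (simp only: S_scale_gen Suc.IH)
qed simp

text \<open>\<open>S\<close> is constant on the cosets of the cubes, so averaging over the cubes evaluates it without
  counting how often \<open>y g\<^sup>3\<^sup>j\<close> represents a given cube.\<close>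

lemma S_eq: "S u = of_nat h * per u"
proof -
  have A: "(\<Sum>z\<in>nonzero_cubes. S (z * u)) = of_nat L * S u"
  proof -
    have "(\<Sum>z\<in>nonzero_cubes. S (z * u)) = (\<Sum>z\<in>(nonzero_cubes :: 'a set). S u)"
      by (rule sum.cong[OF refl]) (auto simp: cubes_eq S_scale_gen_power)
    then show ?thesis by (simp add: card_cubes)
  qed
  have B: "(\<Sum>z\<in>nonzero_cubes. S (z * u)) = of_nat ((q - 1) * N) * per u"
  proof -
    have "(\<Sum>z\<in>nonzero_cubes. S (z * u))
        = (\<Sum>y\<in>subfield s - {0}. \<Sum>j<N. \<Sum>z\<in>nonzero_cubes. \<psi> (z * (y * g ^ (3 * j) * u)))"
      unfolding S_def
      by (subst sum.swap, rule sum.cong[OF refl], subst sum.swap) (simp only: mult_ac)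
    also have "\<dots> = (\<Sum>y\<in>subfield s - {0}. \<Sum>j<N. per u)"
    proof (intro sum.cong refl)
      fix y j assume "y \<in> subfield s - {0}"
      then have "y \<in> nonzero_cubes" using subfield_cubes by blast
      moreover have "g ^ (3 * j) \<in> nonzero_cubes"
        unfolding g_def power_mult[symmetric] gen_power_cube_iff by simp
      ultimately have "per (y * g ^ (3 * j) * u) = per u" by (intro per_mult_cube cubes_mult)
      then show "(\<Sum>z\<in>nonzero_cubes. \<psi> (z * (y * g ^ (3 * j) * u))) = per u"
        by (simp only: per_def cubic_period_def \<psi>_def)
    qed
    finally show ?thesis by (simp add: card_subfield_nz)
  qed
  have "of_nat L * S u = of_nat (h * L) * per u" using A B by (simp only: q_N)
  also have "\<dots> = of_nat L * (of_nat h * per u)" by (simp only: of_nat_mult mult_ac)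
  finally have "of_nat L * S u = of_nat L * (of_nat h * per u)" .
  moreover have "(of_nat L :: complex) \<noteq> 0" using L_pos by simp
  ultimately show ?thesis using mult_left_cancel by blast
qed

text \<open>Orthogonality is applied at each position; the scalar 0 gives the term
  \<open>3 * N\<close>. The power of \<beta> depends on the position modulo 3 alone, so each residue
  class \<open>k\<close> yields one \<open>S\<close> at
  \<open>g ^ k * (a + b * \<beta> ^ k)\<close>.\<close>

lemma codeword_zeros:
  "of_nat q * of_nat (card {i. i < 3 * N \<and> field_trace q m (a * g ^ i + b * (\<beta> * g) ^ i) = 0})
    = of_nat (3 * N) + of_nat h * (per (a + b) + per (g * (a + b * \<beta>)) + per (g\<^sup>2 * (a + b * \<beta>\<^sup>2)))"
proof -
  define x where "x i = a * g ^ i + b * (\<beta> * g) ^ i" for i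
  have x: "x (3 * j + k) = g ^ (3 * j) * (g ^ k * (a + b * \<beta> ^ k))" for j k
  proof -
    have "\<beta> ^ (3 * j + k) = \<beta> ^ k" by (simp add: power_add power_mult beta_cube)
    then have "x (3 * j + k) = a * g ^ (3 * j + k) + b * (\<beta> ^ k * g ^ (3 * j + k))"
      unfolding x_def power_mult_distrib by (simp only:)
    then show ?thesis unfolding power_add by (simp add: algebra_simps)
  qed
  define Z where "Z = {i. i < 3 * N \<and> field_trace q m (x i) = 0}"
  have "of_nat q * of_nat (card Z) = (\<Sum>i<3*N. if field_trace q m (x i) = 0 then of_nat q else (0::complex))"
  proof -
    have "(\<Sum>i<3*N. if field_trace q m (x i) = 0 then of_nat q else (0::complex))
        = (\<Sum>i\<in>Z. of_nat q)"
      by (rule sum.mono_neutral_cong_right) (auto simp: Z_def)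
    then show ?thesis by simp
  qed
  also have "\<dots> = (\<Sum>i<3*N. \<Sum>y\<in>subfield s. \<psi> (y * x i))"
    by (simp only: sum_psi_subfield[OF d_eq])
  also have "\<dots> = (\<Sum>i<3*N. 1 + (\<Sum>y\<in>subfield s - {0}. \<psi> (y * x i)))"
    by (intro sum.cong refl, subst sum.remove[of _ 0]) auto
  also have "\<dots> = of_nat (3 * N) + (\<Sum>i<3*N. \<Sum>y\<in>subfield s - {0}. \<psi> (y * x i))"
    by (simp only: sum.distrib sum_constant card_lessThan mult_1_right)
  also have "(\<Sum>i<3*N. \<Sum>y\<in>subfield s - {0}. \<psi> (y * x i)) = S (a + b) + S (g * (a + b * \<beta>)) + S (g\<^sup>2 * (a + b * \<beta>\<^sup>2))"
  proof -
    have S': "S (g ^ k * (a + b * \<beta> ^ k)) = (\<Sum>j<N. \<Sum>y\<in>subfield s - {0}. \<psi> (y * x (3 * j + k)))" for k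
      unfolding S_def x by (rule sum.swap)
    show ?thesis
      using S'[of 0] S'[of 1] S'[of 2] by (simp add: sum_lessThan_3_mult sum.distrib)
  qed
  finally show ?thesis unfolding Z_def x_def S_eq by (simp add: distrib_left)
qed

text \<open>The normalisation of \<lambda> removes the constant:
  \<open>h * M = (q - 1) * (3 * N)\<close>, so \<open>q\<close> times \<lambda> is \<open>q\<close>
  times the number of zeros minus \<open>3 * N\<close>.\<close>

lemma hamming_weight_codeword:
  "of_nat q * (of_nat h * of_nat M / of_nat q - of_nat (hamming_weight (codeword q m (3 * N) g \<beta> a b)))
    = of_nat h * (per (a + b) + per (g * (a + b * \<beta>)) + per (g\<^sup>2 * (a + b * \<beta>\<^sup>2)))"
proof -
  define P where "P i \<longleftrightarrow> field_trace q m (a * g ^ i + b * (\<beta> * g) ^ i) = 0" for i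
  have "hamming_weight (codeword q m (3 * N) g \<beta> a b) = card {i. i < 3 * N \<and> \<not> P i}"
    unfolding hamming_weight_def codeword_def P_def by (intro arg_cong[of _ _ card]) auto
  moreover have "card {i. i < 3 * N \<and> P i} + card {i. i < 3 * N \<and> \<not> P i} = card {..<3 * N}"
  proof -
    have "{..<3 * N} = {i. i < 3 * N \<and> P i} \<union> {i. i < 3 * N \<and> \<not> P i}" by auto
    then show ?thesis by (simp only:, subst card_Un_disjoint) auto
  qed
  ultimately have "of_nat (card {i. i < 3 * N \<and> P i}) + of_nat (hamming_weight (codeword q m (3 * N) g \<beta> a b))
      = (of_nat (3 * N) :: complex)"
    by (simp only: of_nat_add[symmetric] card_lessThan)
  moreover have "of_nat h * of_nat M = (of_nat q - 1) * (of_nat (3 * N) :: complex)"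
  proof -
    have "h * M = (q - 1) * (3 * N)" using K_q N_eq by (metis mult.left_commute mult.commute)
    then have "of_nat h * of_nat M = of_nat (q - 1) * (of_nat (3 * N) :: complex)"
      by (simp only: of_nat_mult[symmetric])
    moreover have "q \<ge> 1" using q_gt_1 by simp
    then have "of_nat (q - 1) = (of_nat q - 1 :: complex)" by (simp only: of_nat_diff of_nat_1)
    ultimately show ?thesis by (simp only:)
  qed
  moreover have "(of_nat q :: complex) * (of_nat h * of_nat M / of_nat q) = of_nat h * of_nat M" by simp
  moreover note codeword_zeros[of a b, folded P_def]
  moreover have "(b - 1) * n - b * c = t" if "z + c = n" "b * z = n + t" for b c n t z :: complex
    using that(2) unfolding that(1)[symmetric] by (simp add: algebra_simps)
  ultimately show ?thesis by (simp only: right_diff_distrib)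
qed

end

section \<open>Value distribution\<close>

lemma lessThan_3: "{..<3::nat} = {0, 1, 2}" by auto

context cubic_field
begin

definition cls :: "'a \<Rightarrow> nat" where "cls x = dlog x mod 3"

text \<open>Indexed by all exponents, with period 3, so that shifts by \<open>E\<close> need no
  reduction.\<close>

definition e :: "nat \<Rightarrow> complex" where "e i = per (\<alpha> ^ i)"

lemma cls_gen: "cls (\<alpha> ^ j) = j mod 3"
proof -
  have "\<alpha> ^ dlog (\<alpha> ^ j) = \<alpha> ^ j" by (rule gen_dlog) (simp add: gen_nz)
  then show ?thesis unfolding cls_def by (rule gen_power_eq_mod_3)
qed

lemma cls_less: "cls x < 3" by (simp add: cls_def)

lemma e_cong: "i mod 3 = j mod 3 \<Longrightarrow> e i = e j"
  unfolding e_def by (rule per_gen_cong)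

lemma per_scale_cls: "x \<noteq> 0 \<Longrightarrow> per (x * \<alpha> ^ i) = e (cls x + i)"
proof -
  assume "x \<noteq> 0"
  then obtain j where j: "x = \<alpha> ^ j" using ex_gen_power by blast
  have "per (x * \<alpha> ^ i) = e (j + i)" by (simp add: e_def j power_add)
  also have "\<dots> = e (cls x + i)" unfolding j cls_gen by (intro e_cong) presburger
  finally show ?thesis .
qed

lemma sum_cls: "(\<Sum>x\<in>UNIV - {0}. f (cls x)) = of_nat L * (f 0 + f 1 + f 2 :: complex)"
proof -
  have "(\<Sum>x\<in>UNIV - {0}. f (cls x)) = (\<Sum>j<3 * L. f (j mod 3))"
    by (simp only: sum_units cls_gen M_eq)
  also have "\<dots> = (\<Sum>j<L. f 0 + f 1 + f 2)"
  proof -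
    have "3 * j mod 3 = 0" "(3 * j + 1) mod 3 = 1" "(3 * j + 2) mod 3 = 2" for j :: nat by presburger+
    then show ?thesis by (simp only: sum_lessThan_3_mult)
  qed
  finally show ?thesis by simp
qed

definition coset :: "nat \<Rightarrow> 'a set" where "coset i = {x. x \<noteq> 0 \<and> cls x = i}"

lemma coset_eq: "i < 3 \<Longrightarrow> coset i = (\<lambda>z. z * \<alpha> ^ i) ` nonzero_cubes"
proof (intro equalityI subsetI)
  fix x assume i: "i < 3" and "x \<in> coset i"
  then have x: "x \<noteq> 0" "cls x = i" by (auto simp: coset_def)
  obtain j where j: "x = \<alpha> ^ j" using ex_gen_power[OF x(1)] by blast
  have "j = 3 * (j div 3) + i" using x(2) unfolding j cls_gen by (metis mult_div_mod_eq)
  then have "x = \<alpha> ^ (3 * (j div 3)) * \<alpha> ^ i" unfolding j by (metis power_add)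
  moreover have "\<alpha> ^ (3 * (j div 3)) \<in> nonzero_cubes" by (simp only: gen_power_cube_iff) simp
  ultimately show "x \<in> (\<lambda>z. z * \<alpha> ^ i) ` nonzero_cubes" by blast
next
  fix x assume i: "i < 3" and "x \<in> (\<lambda>z. z * \<alpha> ^ i) ` nonzero_cubes"
  then obtain j where "x = \<alpha> ^ (3 * j + i)" unfolding cubes_eq by (auto simp: power_add)
  then show "x \<in> coset i" using i gen_nz by (simp add: coset_def cls_gen)
qed

lemma sum_psi_coset: "i < 3 \<Longrightarrow> (\<Sum>x\<in>coset i. \<psi> (t * x)) = per (t * \<alpha> ^ i)"
  unfolding coset_eq per_def cubic_period_def \<psi>_def[symmetric]
  by (subst sum.reindex) (auto simp: inj_on_def gen_nz mult_ac)

text \<open>Dividing by \<open>x\<close> shows that this is \<open>L\<close> times a cyclotomic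
  number of order 3.\<close>

definition coset_count :: "nat \<Rightarrow> nat \<Rightarrow> nat \<Rightarrow> complex" where
  "coset_count i j k = of_nat (card {(x, y). x \<in> coset i \<and> y \<in> coset j \<and> x + y \<in> coset k})"

text \<open>The equation \<open>x + y = z\<close> is detected by orthogonality, and for each
  \<open>t\<close> the sum factors into three periods. The term \<open>t = 0\<close> gives
  \<open>L ^ 3\<close>; the others depend on the class of \<open>t\<close> only. The sign at
  \<open>z\<close> disappears because -1 is a cube.\<close>

lemma coset_count_eq:
  assumes "i < 3" "j < 3" "k < 3"
  shows "of_nat r * coset_count i j k = of_nat L ^ 3
    + of_nat L * (e i * e j * e k + e (1 + i) * e (1 + j) * e (1 + k) + e (2 + i) * e (2 + j) * e (2 + k))"
proof -
  have "of_nat r * coset_count i j k = (\<Sum>(x, y)\<in>coset i \<times> coset j. if x + y \<in> coset k then of_nat r else (0::complex))"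
  proof -
    have "(\<Sum>(x, y)\<in>coset i \<times> coset j. if x + y \<in> coset k then of_nat r else (0::complex))
        = (\<Sum>u\<in>{(x, y). x \<in> coset i \<and> y \<in> coset j \<and> x + y \<in> coset k}. of_nat r)"
      by (rule sum.mono_neutral_cong_right) (auto split: if_splits)
    then show ?thesis by (simp add: coset_count_def)
  qed
  also have "\<dots> = (\<Sum>x\<in>coset i. \<Sum>y\<in>coset j. if x + y \<in> coset k then of_nat r else 0)"
    by (simp add: sum.cartesian_product)
  also have "\<dots> = (\<Sum>x\<in>coset i. \<Sum>y\<in>coset j. \<Sum>z\<in>coset k. \<Sum>t\<in>UNIV. \<psi> (t * (x + y - z)))"
  proof (intro sum.cong refl)
    fix x y :: 'a
    have "(\<Sum>z\<in>coset k. \<Sum>t\<in>UNIV. \<psi> (t * (x + y - z))) = (\<Sum>z\<in>coset k. if x + y = z then of_nat r else 0)"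
      by (simp only: sum_psi right_minus_eq)
    also have "\<dots> = (if x + y \<in> coset k then of_nat r else 0)" by (simp only: sum.delta' finite_subset_of_field)
    finally show "(if x + y \<in> coset k then of_nat r else 0) = (\<Sum>z\<in>coset k. \<Sum>t\<in>UNIV. \<psi> (t * (x + y - z)))" ..
  qed
  also have "\<dots> = (\<Sum>t\<in>UNIV. \<Sum>x\<in>coset i. \<Sum>y\<in>coset j. \<Sum>z\<in>coset k. \<psi> (t * x) * \<psi> (t * y) * \<psi> (- t * z))"
  proof -
    have *: "\<psi> (t * (x + y - z)) = \<psi> (t * x) * \<psi> (t * y) * \<psi> (- t * z)" for t x y z
      by (simp add: algebra_simps flip: psi_add)
    show ?thesis unfolding *
      by (simp only: sum.swap[of _ "UNIV :: 'a set" "coset k"] sum.swap[of _ "UNIV :: 'a set" "coset j"]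
        sum.swap[of _ "UNIV :: 'a set" "coset i"])
  qed
  also have "\<dots> = (\<Sum>t\<in>UNIV. per (t * \<alpha> ^ i) * per (t * \<alpha> ^ j) * per (- t * \<alpha> ^ k))"
    by (simp only: sum_distrib_left[symmetric] sum_distrib_right[symmetric] sum_psi_coset[OF assms(1)]
        sum_psi_coset[OF assms(2)] sum_psi_coset[OF assms(3)])
  also have "\<dots> = (\<Sum>t\<in>UNIV. per (t * \<alpha> ^ i) * per (t * \<alpha> ^ j) * per (t * \<alpha> ^ k))"
    by (simp add: per_minus)
  also have "\<dots> = of_nat L ^ 3
    + (\<Sum>t\<in>UNIV - {0}. e (cls t + i) * e (cls t + j) * e (cls t + k))"
    by (subst sum_remove_0) (simp add: per_0 per_scale_cls power3_eq_cube)
  also have "(\<Sum>t\<in>UNIV - {0}. e (cls t + i) * e (cls t + j) * e (cls t + k))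
      = of_nat L * (e i * e j * e k + e (1 + i) * e (1 + j) * e (1 + k) + e (2 + i) * e (2 + j) * e (2 + k))"
    by (subst sum_cls[of "\<lambda>c. e (c + i) * e (c + j) * e (c + k)"]) simp
  finally show ?thesis .
qed

lemma sum_nonzero_pairs:
  "(\<Sum>(x, y) | x \<noteq> 0 \<and> y \<noteq> 0 \<and> x + y \<noteq> 0. f (cls x) (cls y) (cls (x + y)))
    = (\<Sum>i<3. \<Sum>j<3. \<Sum>k<3. coset_count i j k * f i j k :: complex)"
proof -
  define T :: "('a \<times> 'a) set" where "T = {(x, y). x \<noteq> 0 \<and> y \<noteq> 0 \<and> x + y \<noteq> 0}"
  define c where "c = (\<lambda>(x :: 'a, y). (cls x, cls y, cls (x + y)))"
  have "(\<Sum>u\<in>T. (case c u of (i, j, k) \<Rightarrow> f i j k))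
      = (\<Sum>t\<in>{..<3} \<times> {..<3} \<times> {..<3}. \<Sum>u | u \<in> T \<and> c u = t. (case c u of (i, j, k) \<Rightarrow> f i j k))"
    by (rule sum.group[symmetric]) (auto simp: c_def cls_less)
  also have "\<dots> = (\<Sum>t\<in>{..<3} \<times> {..<3} \<times> {..<3}. case t of (i, j, k) \<Rightarrow> coset_count i j k * f i j k)"
  proof (rule sum.cong[OF refl], clarify)
    fix i j k :: nat
    have "{u \<in> T. c u = (i, j, k)} = {(x, y). x \<in> coset i \<and> y \<in> coset j \<and> x + y \<in> coset k}"
      by (auto simp: T_def c_def coset_def)
    moreover have "(\<Sum>u | u \<in> T \<and> c u = (i, j, k). (case c u of (i, j, k) \<Rightarrow> f i j k))
        = (\<Sum>u | u \<in> T \<and> c u = (i, j, k). f i j k)"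
      by (rule sum.cong) auto
    ultimately show "(\<Sum>u | u \<in> T \<and> c u = (i, j, k). (case c u of (i, j, k) \<Rightarrow> f i j k)) = coset_count i j k * f i j k"
      by (simp add: coset_count_def)
  qed
  finally show ?thesis
    by (simp add: T_def c_def sum.cartesian_product case_prod_unfold)
qed

text \<open>On the lines \<open>x = 0\<close>, \<open>y = 0\<close> and \<open>x + y = 0\<close>,
  which meet only in the origin, one of the three periods has argument 0. They are therefore split
  off from the generic pairs.\<close>

lemma sum_pairs:
  fixes F :: "'a \<Rightarrow> 'a \<Rightarrow> complex"
  shows "(\<Sum>(x, y)\<in>UNIV. F x y) = F 0 0 + (\<Sum>x\<in>UNIV - {0}. F 0 x) + (\<Sum>x\<in>UNIV - {0}. F x 0)
    + (\<Sum>x\<in>UNIV - {0}. F x (- x)) + (\<Sum>(x, y) | x \<noteq> 0 \<and> y \<noteq> 0 \<and> x + y \<noteq> 0. F x y)"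
proof -
  have fin: "finite (A :: ('a \<times> 'a) set)" for A by (rule finite_subset[OF subset_UNIV]) simp
  have inner: "(\<Sum>y\<in>UNIV. F x y) = F x 0 + F x (- x) + (\<Sum>y\<in>UNIV - {0} - {- x}. F x y)"
    if "x \<noteq> 0" for x
  proof -
    have "(\<Sum>y\<in>UNIV - {0}. F x y) = F x (- x) + (\<Sum>y\<in>UNIV - {0} - {- x}. F x y)"
      using that by (intro sum.remove) simp_all
    then show ?thesis using sum_remove_0[of "F x"] by simp
  qed
  have "(\<Sum>(x, y)\<in>UNIV. F x y) = (\<Sum>x\<in>UNIV. \<Sum>y\<in>UNIV. F x y)"
    unfolding UNIV_Times_UNIV[symmetric] by (rule sum.cartesian_product[symmetric])
  also have "\<dots> = (\<Sum>y\<in>UNIV. F 0 y) + (\<Sum>x\<in>UNIV - {0}. \<Sum>y\<in>UNIV. F x y)"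
    by (rule sum_remove_0)
  also have "(\<Sum>y\<in>UNIV. F 0 y) = F 0 0 + (\<Sum>x\<in>UNIV - {0}. F 0 x)"
    by (rule sum_remove_0)
  also have "(\<Sum>x\<in>UNIV - {0}. \<Sum>y\<in>UNIV. F x y) = (\<Sum>x\<in>UNIV - {0}. F x 0) + (\<Sum>x\<in>UNIV - {0}. F x (- x))
      + (\<Sum>x\<in>UNIV - {0}. \<Sum>y\<in>UNIV - {0} - {- x}. F x y)"
    unfolding sum.distrib[symmetric] by (rule sum.cong[OF refl]) (simp add: inner)
  also have "(\<Sum>x\<in>UNIV - {0}. \<Sum>y\<in>UNIV - {0} - {- x}. F x y)
      = (\<Sum>(x, y)\<in>Sigma (UNIV - {0}) (\<lambda>x. UNIV - {0} - {- x}). F x y)"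
    by (rule sum.Sigma) simp_all
  also have "Sigma (UNIV - {0 :: 'a}) (\<lambda>x. UNIV - {0} - {- x}) = {(x, y). x \<noteq> 0 \<and> y \<noteq> 0 \<and> x + y \<noteq> 0}"
    by (auto simp: add_eq_0_iff)
  finally show ?thesis by (simp only: add.assoc)
qed

end

locale eisenstein_code = eisenstein_field + cyclic_code
begin

definition "X = (- 1) ^ d * (\<pi> ^ d + cnj \<pi> ^ d)"
definition "Y = (- 1) ^ d * (\<rho>\<^sup>2 * \<pi> ^ d + \<rho> * cnj \<pi> ^ d)"
definition "Z = (- 1) ^ d * (\<rho> * \<pi> ^ d + \<rho>\<^sup>2 * cnj \<pi> ^ d)"

abbreviation "R \<equiv> (of_nat r :: complex)"

lemma rho_root: "\<rho>\<^sup>2 + \<rho> + 1 = 0" using rho by (simp add: prim_root3_def)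

lemma rho_4: "\<rho> ^ 4 = \<rho>" using rho_root by algebra

lemma e_eqs:
  "3 * e 0 = gauss \<rho> + gauss (\<rho>\<^sup>2) - 1"
  "3 * e 1 = \<rho>\<^sup>2 * gauss \<rho> + \<rho> * gauss (\<rho>\<^sup>2) - 1"
  "3 * e 2 = \<rho> * gauss \<rho> + \<rho>\<^sup>2 * gauss (\<rho>\<^sup>2) - 1"
  using per_gen[OF rho, of 0] per_gen[OF rho, of 1] per_gen[OF rho, of 2]
  by (simp_all add: e_def rho_4)

lemma e_sum: "e 0 + e 1 + e 2 = - 1"
proof -
  have "3 * (e 0 + e 1 + e 2) = 3 * (- 1)"
    using e_eqs rho_root by algebra
  then show ?thesis by (simp only: mult_cancel_left) simp
qed

lemma L_R: "3 * of_nat L = R - 1"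
proof -
  have "R = of_nat (3 * L) + 1" by (simp only: r_eq M_eq) simp
  then show ?thesis by simp
qed

text \<open>The four cases are the triples of classes up to order and simultaneous shift. If exactly
  two classes agree, the sum is 1 modulo 3 precisely when the third is the cyclic successor of the
  repeated one.\<close>

definition class_count :: "nat \<Rightarrow> nat \<Rightarrow> nat \<Rightarrow> complex" where
  "class_count i j k = (R - 1) / 27 * (
    if i = j \<and> j = k then R - 8 - X
    else if i \<noteq> j \<and> j \<noteq> k \<and> i \<noteq> k then R + 1 - X
    else if (i + j + k) mod 3 = 1 then R - 2 - Y
    else R - 2 - Z)"

text \<open>Clearing the constant -1 gives \<open>a\<close>, \<open>b\<close>, \<open>c\<close> with
  sum 0. In their quadratic expressions only \<open>G * G'\<close> survives, in the cubic ones only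
  the cubes of \<open>G\<close> and \<open>G'\<close>; the other mixed terms cancel by
  \<open>w\<^sup>2 + w + 1 = 0\<close>.\<close>

lemma period_identities:
  fixes G G' J J' w l x y z R :: complex
  assumes x: "3 * x = G + G' - 1" and y: "3 * y = w\<^sup>2 * G + w * G' - 1" and z: "3 * z = w * G + w\<^sup>2 * G' - 1"
    and w: "w\<^sup>2 + w + 1 = 0" and GG: "G * G' = R" and G: "G ^ 3 = R * J" "G' ^ 3 = R * J'"
    and l: "3 * l = R - 1"
  shows "27 * (l ^ 3 + l * (x ^ 3 + y ^ 3 + z ^ 3)) = R * ((R - 1) * (R - 8 + (J + J')))"
    and "27 * (l ^ 3 + l * (x\<^sup>2 * y + y\<^sup>2 * z + z\<^sup>2 * x)) = R * ((R - 1) * (R - 2 + (w\<^sup>2 * J + w * J')))"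
    and "27 * (l ^ 3 + l * (x\<^sup>2 * z + y\<^sup>2 * x + z\<^sup>2 * y)) = R * ((R - 1) * (R - 2 + (w * J + w\<^sup>2 * J')))"
    and "27 * (l ^ 3 + l * (3 * (x * y * z))) = R * ((R - 1) * (R + 1 + (J + J')))"
proof -
  define a b c where "a = G + G'" and "b = w\<^sup>2 * G + w * G'" and "c = w * G + w\<^sup>2 * G'"
  have e: "3 * x = a - 1" "3 * y = b - 1" "3 * z = c - 1" using x y z by (simp_all add: a_def b_def c_def)
  have s1: "a + b + c = 0" unfolding a_def b_def c_def using w by algebra
  have s2: "a\<^sup>2 + b\<^sup>2 + c\<^sup>2 = 6 * R" unfolding a_def b_def c_def using w GG by algebra
  have s2': "a * b + b * c + c * a = - 3 * R" unfolding a_def b_def c_def using w GG by algebra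
  have s3: "a ^ 3 + b ^ 3 + c ^ 3 = 3 * R * (J + J')" unfolding a_def b_def c_def using w G by algebra
  have s3y: "a\<^sup>2 * b + b\<^sup>2 * c + c\<^sup>2 * a = 3 * R * (w\<^sup>2 * J + w * J')" unfolding a_def b_def c_def using w G by algebra
  have s3z: "a\<^sup>2 * c + b\<^sup>2 * a + c\<^sup>2 * b = 3 * R * (w * J + w\<^sup>2 * J')" unfolding a_def b_def c_def using w G by algebra
  have s3p: "a * b * c = R * (J + J')" unfolding a_def b_def c_def using w G by algebra
  have "27 * (x ^ 3 + y ^ 3 + z ^ 3) = (a ^ 3 + b ^ 3 + c ^ 3) - 3 * (a\<^sup>2 + b\<^sup>2 + c\<^sup>2) + 3 * (a + b + c) - 3"
    using e by algebra
  then have 1: "27 * (x ^ 3 + y ^ 3 + z ^ 3) = 3 * R * (J + J') - 18 * R - 3" using s1 s2 s3 by algebra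
  have "27 * (x\<^sup>2 * y + y\<^sup>2 * z + z\<^sup>2 * x) = (a\<^sup>2 * b + b\<^sup>2 * c + c\<^sup>2 * a) - (a\<^sup>2 + b\<^sup>2 + c\<^sup>2)
      - 2 * (a * b + b * c + c * a) + 3 * (a + b + c) - 3"
    using e by algebra
  then have 2: "27 * (x\<^sup>2 * y + y\<^sup>2 * z + z\<^sup>2 * x) = 3 * R * (w\<^sup>2 * J + w * J') - 3" using s1 s2 s2' s3y by algebra
  have "27 * (x\<^sup>2 * z + y\<^sup>2 * x + z\<^sup>2 * y) = (a\<^sup>2 * c + b\<^sup>2 * a + c\<^sup>2 * b) - (a\<^sup>2 + b\<^sup>2 + c\<^sup>2)
      - 2 * (a * b + b * c + c * a) + 3 * (a + b + c) - 3"
    using e by algebra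
  then have 3: "27 * (x\<^sup>2 * z + y\<^sup>2 * x + z\<^sup>2 * y) = 3 * R * (w * J + w\<^sup>2 * J') - 3" using s1 s2 s2' s3z by algebra
  have "27 * (x * y * z) = a * b * c - (a * b + b * c + c * a) + (a + b + c) - 1"
    using e by algebra
  then have 4: "27 * (x * y * z) = R * (J + J') + 3 * R - 1" using s1 s2' s3p by algebra
  have l3: "27 * l ^ 3 = (R - 1) ^ 3" unfolding l[symmetric] by (simp add: power_mult_distrib)
  show "27 * (l ^ 3 + l * (x ^ 3 + y ^ 3 + z ^ 3)) = R * ((R - 1) * (R - 8 + (J + J')))"
    using 1 l l3 by algebra
  show "27 * (l ^ 3 + l * (x\<^sup>2 * y + y\<^sup>2 * z + z\<^sup>2 * x)) = R * ((R - 1) * (R - 2 + (w\<^sup>2 * J + w * J')))"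
    using 2 l l3 by algebra
  show "27 * (l ^ 3 + l * (x\<^sup>2 * z + y\<^sup>2 * x + z\<^sup>2 * y)) = R * ((R - 1) * (R - 2 + (w * J + w\<^sup>2 * J')))"
    using 3 l l3 by algebra
  show "27 * (l ^ 3 + l * (3 * (x * y * z))) = R * ((R - 1) * (R + 1 + (J + J')))"
    using 4 l l3 by algebra
qed

text \<open>Indices reach at most 4, so the period is needed at 3 and 4 only.\<close>

lemma shift_sum_cases:
  fixes e :: "nat \<Rightarrow> complex"
  assumes "i < 3" "j < 3" "k < 3" and e: "e 3 = e 0" "e 4 = e 1"
  shows "e i * e j * e k + e (1 + i) * e (1 + j) * e (1 + k) + e (2 + i) * e (2 + j) * e (2 + k) =
    (if i = j \<and> j = k then e 0 ^ 3 + e 1 ^ 3 + e 2 ^ 3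
     else if i \<noteq> j \<and> j \<noteq> k \<and> i \<noteq> k then 3 * (e 0 * e 1 * e 2)
     else if (i + j + k) mod 3 = 1 then (e 0)\<^sup>2 * e 1 + (e 1)\<^sup>2 * e 2 + (e 2)\<^sup>2 * e 0
     else (e 0)\<^sup>2 * e 2 + (e 1)\<^sup>2 * e 0 + (e 2)\<^sup>2 * e 1)"
proof -
  have "i = 0 \<or> i = 1 \<or> i = 2" "j = 0 \<or> j = 1 \<or> j = 2" "k = 0 \<or> k = 1 \<or> k = 2" using assms by auto
  moreover have "e (Suc 2) = e 0" "e (Suc (Suc (Suc 0))) = e 0" "e (Suc (Suc 0)) = e 2" using e(1) by (simp_all add: eval_nat_numeral)
  ultimately show ?thesis
    using e by (elim disjE; hypsubst; simp add: power2_eq_square power3_eq_cube)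
qed

lemma coset_count_eq_class_count:
  assumes "i < 3" "j < 3" "k < 3"
  shows "coset_count i j k = class_count i j k"
proof -
  define J where "J = jacobi \<rho>"
  define J' where "J' = jacobi (\<rho>\<^sup>2)"
  have J: "J = - ((- 1) ^ d * \<pi> ^ d)" by (simp add: J_def jacobi_eq)
  have "J' = cnj J" unfolding J'_def J_def by (simp add: cnj_jacobi cnj_prim_root3[OF rho])
  then have J': "J' = - ((- 1) ^ d * cnj \<pi> ^ d)" by (simp add: J)
  \<comment> \<open>The minus signs come from the factor \<open>(- 1) ^ (d + 1)\<close> of the
    Jacobi sum.\<close>
  have XYZ: "X = - (J + J')" "Y = - (\<rho>\<^sup>2 * J + \<rho> * J')" "Z = - (\<rho> * J + \<rho>\<^sup>2 * J')"
    by (simp_all add: X_def Y_def Z_def J J' algebra_simps)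
  note ids = period_identities[OF e_eqs rho_root gauss_mult_gauss[OF rho]
      gauss_cube[OF rho, folded J_def] gauss_cube[OF prim_root3_square[OF rho], folded J'_def] L_R]
  have R0: "R \<noteq> 0" by simp
  have ee: "e 3 = e 0" "e 4 = e 1" by (auto intro: e_cong)
  have "27 * (R * coset_count i j k) = 27 * (R * class_count i j k)"
  proof -
    have "27 * (R * class_count i j k) = R * ((R - 1) * (
      if i = j \<and> j = k then R - 8 + (J + J')
      else if i \<noteq> j \<and> j \<noteq> k \<and> i \<noteq> k then R + 1 + (J + J')
      else if (i + j + k) mod 3 = 1 then R - 2 + (\<rho>\<^sup>2 * J + \<rho> * J')
      else R - 2 + (\<rho> * J + \<rho>\<^sup>2 * J')))"
      unfolding class_count_def XYZ by simp
    also have "\<dots> = 27 * (of_nat L ^ 3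
    + of_nat L * (e i * e j * e k + e (1 + i) * e (1 + j) * e (1 + k) + e (2 + i) * e (2 + j) * e (2 + k)))"
      unfolding shift_sum_cases[OF assms ee] if_distrib[of "\<lambda>t. 27 * (of_nat L ^ 3 + of_nat L * t)"]
        if_distrib[of "\<lambda>t. R * ((R - 1) * t)"] ids ..
    finally show ?thesis unfolding coset_count_eq[OF assms] ..
  qed
  then show ?thesis using R0 by simp
qed

end

text \<open>Shifting the three indices by 0, \<open>E\<close>, \<open>2 * E\<close> keeps their sum
  modulo 3, so the weights \<open>B\<close> and \<open>C\<close> of triples with exactly two equal
  classes stay in place. If 3 does not divide \<open>E\<close>, triples with sum 0 are rearranged:
  constant ones receive \<open>D\<close>, and of the six orders of three distinct classes three
  receive \<open>A\<close> and three \<open>D\<close>. In \<open>U\<close> the two indices beside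
  \<open>l\<close> differ by a multiple of \<open>E\<close>, and each pair arises from all three
  positions of \<open>l\<close>.\<close>

lemma sum_triples_combine:
  fixes t :: "complex \<Rightarrow> complex \<Rightarrow> complex \<Rightarrow> complex" and e :: "nat \<Rightarrow> complex"
    and A B C D l :: complex and E :: nat
  assumes comm: "\<And>a b c. t a b c = t b a c" "\<And>a b c. t a b c = t a c b"
    and e_all: "\<forall>i j. i mod 3 = j mod 3 \<longrightarrow> e i = e j"
    and n: "\<And>i j k. n i j k = (if i = j \<and> j = k then A else if i \<noteq> j \<and> j \<noteq> k \<and> i \<noteq> k then D
      else if (i + j + k) mod 3 = (1::nat) then B else (C::complex))"
  defines "S \<equiv> \<Sum>i<3. \<Sum>j<3. \<Sum>k<3. n i j k * t (e i) (e (j + E)) (e (k + 2 * E))"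
    and "MX \<equiv> 3 * B * (t (e 0) (e 0) (e 1) + t (e 1) (e 1) (e 2) + t (e 2) (e 2) (e 0))
      + 3 * C * (t (e 0) (e 0) (e 2) + t (e 1) (e 1) (e 0) + t (e 2) (e 2) (e 1))"
    and "U \<equiv> \<Sum>i<3. t l (e (i + E)) (e (i + 2 * E)) + t (e i) l (e (i + 2 * E)) + t (e i) (e (i + E)) l"
  shows "3 dvd E \<Longrightarrow> S = A * (t (e 0) (e 0) (e 0) + t (e 1) (e 1) (e 1) + t (e 2) (e 2) (e 2)) + MX
      + 6 * D * t (e 0) (e 1) (e 2)"
    and "\<not> 3 dvd E \<Longrightarrow> S = D * (t (e 0) (e 0) (e 0) + t (e 1) (e 1) (e 1) + t (e 2) (e 2) (e 2)) + MX
      + 3 * (A + D) * t (e 0) (e 1) (e 2)"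
    and "3 dvd E \<Longrightarrow> U = 3 * (t l (e 0) (e 0) + t l (e 1) (e 1) + t l (e 2) (e 2))"
    and "\<not> 3 dvd E \<Longrightarrow> U = 3 * (t l (e 0) (e 1) + t l (e 0) (e 2) + t l (e 1) (e 2))"
proof -
  note e = e_all[rule_format]
  define x y z where "x = e 0" and "y = e 1" and "z = e 2"
  have ex: "e i = x" if "i mod 3 = 0" for i using e[of i 0] that by (simp add: x_def)
  have ey: "e i = y" if "i mod 3 = 1" for i using e[of i 1] that by (simp add: y_def)
  have ez: "e i = z" if "i mod 3 = 2" for i using e[of i 2] that by (simp add: z_def)
  have eE: "e (i + E) = e (i + E mod 3)" "e (i + 2 * E) = e (i + 2 * (E mod 3))" for i
    by (rule e, metis mod_add_right_eq, rule e, metis mod_add_right_eq mod_mult_right_eq)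
  have S0: "S = (\<Sum>i<3. \<Sum>j<3. \<Sum>k<3. n i j k * t (e i) (e (j + E mod 3)) (e (k + 2 * (E mod 3))))"
    unfolding S_def by (simp only: eE(1) eE(2))
  have U0: "U = (\<Sum>i<3. t l (e (i + E mod 3)) (e (i + 2 * (E mod 3))) + t (e i) l (e (i + 2 * (E mod 3))) + t (e i) (e (i + E mod 3)) l)"
    unfolding U_def by (simp only: eE(1) eE(2))
  note ev = lessThan_3 n ex ey ez comm
  show "S = A * (t (e 0) (e 0) (e 0) + t (e 1) (e 1) (e 1) + t (e 2) (e 2) (e 2)) + MX
      + 6 * D * t (e 0) (e 1) (e 2)" if "3 dvd E"
  proof -
    from that have "E mod 3 = 0" by presburger
    then show ?thesis unfolding S0 MX_def by (simp add: ev algebra_simps)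
  qed
  show "S = D * (t (e 0) (e 0) (e 0) + t (e 1) (e 1) (e 1) + t (e 2) (e 2) (e 2)) + MX
      + 3 * (A + D) * t (e 0) (e 1) (e 2)" if "\<not> 3 dvd E"
  proof -
    from that have "E mod 3 = 1 \<or> E mod 3 = 2" by presburger
    then consider "E mod 3 = 1" | "E mod 3 = 2" by blast
    then show ?thesis unfolding S0 MX_def by cases (simp_all add: ev algebra_simps)
  qed
  show "U = 3 * (t l (e 0) (e 0) + t l (e 1) (e 1) + t l (e 2) (e 2))" if "3 dvd E"
  proof -
    from that have "E mod 3 = 0" by presburger
    then show ?thesis unfolding U0 by (simp add: ev algebra_simps)
  qed
  show "U = 3 * (t l (e 0) (e 1) + t l (e 0) (e 2) + t l (e 1) (e 2))" if "\<not> 3 dvd E"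
  proof -
    from that have "E mod 3 = 1 \<or> E mod 3 = 2" by presburger
    then consider "E mod 3 = 1" | "E mod 3 = 2" by blast
    then show ?thesis unfolding U0 by cases (simp_all add: ev algebra_simps)
  qed
qed

context eisenstein_code
begin

text \<open>Put \<open>x = a + b\<close> and \<open>y = \<beta> * (a + b * \<beta>)\<close>; the
  determinant is \<open>\<beta> * (\<beta> - 1)\<close>, which is not 0. From
  \<open>1 + \<beta> + \<beta>\<^sup>2 = 0\<close> follows that
  \<open>\<beta>\<^sup>2 * (a + b * \<beta>\<^sup>2)\<close> is \<open>- (x + y)\<close>, and
  periods do not see the cubes \<beta> and -1.\<close>

lemma sum_codewords:
  fixes \<delta> :: "complex \<Rightarrow> complex"
  shows "(\<Sum>(a, b)\<in>UNIV. \<delta> (per (a + b) + per (g * (a + b * \<beta>)) + per (g\<^sup>2 * (a + b * \<beta>\<^sup>2))))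
    = (\<Sum>(x, y)\<in>UNIV. \<delta> (per x + per (g * y) + per (g\<^sup>2 * (x + y))))"
proof -
  define f where "f = (\<lambda>(a, b). (a + b, \<beta> * (a + b * \<beta>)))"
  have "inj f"
  proof (rule injI)
    fix u v assume uv: "f u = f v"
    obtain a b where u: "u = (a, b)" by (cases u)
    obtain a' b' where v: "v = (a', b')" by (cases v)
    have eqs: "a + b = a' + b'" "\<beta> * (a + b * \<beta>) = \<beta> * (a' + b' * \<beta>)" using uv by (simp_all add: f_def u v)
    have b0: "\<beta> \<noteq> 0" using beta_cube by auto
    then have "a + b * \<beta> = a' + b' * \<beta>" using eqs(2) by simp
    then have "(b - b') * (\<beta> - 1) = 0" using eqs(1) by algebra
    then have "b = b'" using beta_neq_1 by simp
    then show "u = v" using eqs(1) by (simp add: u v)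
  qed
  then have bij: "bij_betw f UNIV UNIV"
    using finite_UNIV_inj_surj[of f] by (simp add: bij_betw_def)
  have "\<delta> (per (a + b) + per (g * (a + b * \<beta>)) + per (g\<^sup>2 * (a + b * \<beta>\<^sup>2)))
      = (case f (a, b) of (x, y) \<Rightarrow> \<delta> (per x + per (g * y) + per (g\<^sup>2 * (x + y))))" for a b
  proof -
    have 1: "per (g * (a + b * \<beta>)) = per (g * (\<beta> * (a + b * \<beta>)))"
      using per_mult_cube[OF beta_cube_mem, of "g * (a + b * \<beta>)"] by (simp only: mult.left_commute)
    have "per (g\<^sup>2 * (a + b * \<beta>\<^sup>2)) = per (\<beta> * (\<beta> * (g\<^sup>2 * (a + b * \<beta>\<^sup>2))))"
      by (simp only: per_mult_cube[OF beta_cube_mem])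
    also have "\<beta> * (\<beta> * (g\<^sup>2 * (a + b * \<beta>\<^sup>2))) = - (g\<^sup>2 * (a + b + \<beta> * (a + b * \<beta>)))"
      using beta_sum by algebra
    finally have "per (g\<^sup>2 * (a + b * \<beta>\<^sup>2)) = per (g\<^sup>2 * (a + b + \<beta> * (a + b * \<beta>)))"
      by (simp only: per_minus)
    with 1 show ?thesis by (simp only: f_def prod.case)
  qed
  then have "(\<Sum>(a, b)\<in>UNIV. \<delta> (per (a + b) + per (g * (a + b * \<beta>)) + per (g\<^sup>2 * (a + b * \<beta>\<^sup>2))))
      = (\<Sum>u\<in>UNIV. case f u of (x, y) \<Rightarrow> \<delta> (per x + per (g * y) + per (g\<^sup>2 * (x + y))))"
    by (intro sum.cong) auto
  also have "\<dots> = (\<Sum>(x, y)\<in>UNIV. \<delta> (per x + per (g * y) + per (g\<^sup>2 * (x + y))))"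
    by (rule sum.reindex_bij_betw[OF bij])
  finally show ?thesis .
qed

text \<open>The three summands belong to the origin, where all periods are \<open>L\<close>, to the
  three lines, where one is, and to the generic pairs.\<close>

lemma sum_codewords_classes:
  fixes \<delta> :: "complex \<Rightarrow> complex"
  defines "t \<equiv> \<lambda>a b c. \<delta> (a + b + c)" and "l \<equiv> of_nat L"
  shows "(\<Sum>(a, b)\<in>UNIV. \<delta> (per (a + b) + per (g * (a + b * \<beta>)) + per (g\<^sup>2 * (a + b * \<beta>\<^sup>2))))
    = t l l l
    + l * (\<Sum>i<3. t l (e (i + E)) (e (i + 2 * E)) + t (e i) l (e (i + 2 * E)) + t (e i) (e (i + E)) l)
    + (\<Sum>i<3. \<Sum>j<3. \<Sum>k<3. class_count i j k * t (e i) (e (j + E)) (e (k + 2 * E)))"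
proof -
  have p1: "per x = e (cls x)" if "x \<noteq> 0" for x using per_scale_cls[OF that, of 0] by simp
  have pg: "per (g * x) = e (cls x + E)" if "x \<noteq> 0" for x
    using per_scale_cls[OF that, of E] by (simp add: g_def mult.commute)
  have pg2: "per (g\<^sup>2 * x) = e (cls x + 2 * E)" if "x \<noteq> 0" for x
    using per_scale_cls[OF that, of "2 * E"] by (simp add: g_def mult.commute flip: power_mult)
  have pl: "per 0 = l" by (simp add: per_0 l_def)
  have F: "\<delta> (per x + per (g * y) + per (g\<^sup>2 * (x + y))) = t (per x) (per (g * y)) (per (g\<^sup>2 * (x + y)))" for x y
    by (simp add: t_def)
  have s: "(\<Sum>x\<in>UNIV - {0}. f (cls x)) = l * (\<Sum>i<3. f i)" for f :: "nat \<Rightarrow> complex"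
    unfolding sum_cls l_def lessThan_3 by (simp add: add.assoc)
  have "(\<Sum>x\<in>UNIV - {0}. t (per 0) (per (g * x)) (per (g\<^sup>2 * (0 + x)))) = l * (\<Sum>i<3. t l (e (i + E)) (e (i + 2 * E)))"
    unfolding s[symmetric] by (intro sum.cong refl) (simp add: pl pg pg2)
  moreover have "(\<Sum>x\<in>UNIV - {0}. t (per x) (per (g * 0)) (per (g\<^sup>2 * (x + 0)))) = l * (\<Sum>i<3. t (e i) l (e (i + 2 * E)))"
    unfolding s[symmetric] by (intro sum.cong refl) (simp add: pl p1 pg2)
  moreover have "(\<Sum>x\<in>UNIV - {0}. t (per x) (per (g * (- x))) (per (g\<^sup>2 * (x + - x)))) = l * (\<Sum>i<3. t (e i) (e (i + E)) l)"
    unfolding s[symmetric] by (intro sum.cong refl) (simp add: pl p1 pg per_minus)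
  moreover have "(\<Sum>(x, y) | x \<noteq> 0 \<and> y \<noteq> 0 \<and> x + y \<noteq> 0. t (per x) (per (g * y)) (per (g\<^sup>2 * (x + y))))
      = (\<Sum>(x, y) | x \<noteq> 0 \<and> y \<noteq> 0 \<and> x + y \<noteq> 0. t (e (cls x)) (e (cls y + E)) (e (cls (x + y) + 2 * E)))"
    by (intro sum.cong refl) (auto simp: p1 pg pg2)
  moreover have "\<dots> = (\<Sum>i<3. \<Sum>j<3. \<Sum>k<3. class_count i j k * t (e i) (e (j + E)) (e (k + 2 * E)))"
    unfolding sum_nonzero_pairs[of "\<lambda>i j k. t (e i) (e (j + E)) (e (k + 2 * E))"]
    by (intro sum.cong refl) (simp add: coset_count_eq_class_count)
  ultimately show ?thesis
    unfolding sum_codewords F sum_pairs[of "\<lambda>x y. t (per x) (per (g * y)) (per (g\<^sup>2 * (x + y)))"]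
    by (simp add: pl sum.distrib distrib_left)
qed

text \<open>With the indicator of \<open>v\<close> as test function, both sides become linear
  combinations of the same indicator values, and comparing coefficients settles coinciding values as
  well.\<close>

lemma value_distribution:
  fixes \<Lambda> :: "'a \<Rightarrow> 'a \<Rightarrow> complex" and H Q :: complex
  assumes \<Lambda>: "\<And>a b. \<Lambda> a b = H / Q * (per (a + b) + per (g * (a + b * \<beta>)) + per (g\<^sup>2 * (a + b * \<beta>\<^sup>2)))"
  shows "3 dvd E \<Longrightarrow> has_value_distribution (\<lambda>(a, b). \<Lambda> a b)
       [(3 * H / Q * e 0, (R - 1) / 27 * (R - 8 - X)),
        (3 * H / Q * e 1, (R - 1) / 27 * (R - 8 - X)),
        (3 * H / Q * e 2, (R - 1) / 27 * (R - 8 - X)),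
        (H / Q * (2 * e 0 + e 1), (R - 1) / 9 * (R - 2 - Y)),
        (H / Q * (2 * e 0 + e 2), (R - 1) / 9 * (R - 2 - Z)),
        (H / Q * (2 * e 1 + e 0), (R - 1) / 9 * (R - 2 - Z)),
        (H / Q * (2 * e 1 + e 2), (R - 1) / 9 * (R - 2 - Y)),
        (H / Q * (2 * e 2 + e 0), (R - 1) / 9 * (R - 2 - Y)),
        (H / Q * (2 * e 2 + e 1), (R - 1) / 9 * (R - 2 - Z)),
        (- (H / Q), 2 * (R - 1) / 9 * (R + 1 - X)),
        (H / (3 * Q) * (R - 1 + 6 * e 0), R - 1),
        (H / (3 * Q) * (R - 1 + 6 * e 1), R - 1),
        (H / (3 * Q) * (R - 1 + 6 * e 2), R - 1),
        (H * (R - 1) / Q, 1)]" (is "_ \<Longrightarrow> has_value_distribution _ ?D1")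
    and "\<not> 3 dvd E \<Longrightarrow> has_value_distribution (\<lambda>(a, b). \<Lambda> a b)
       [(3 * H / Q * e 0, (R - 1) / 27 * (R + 1 - X)),
        (3 * H / Q * e 1, (R - 1) / 27 * (R + 1 - X)),
        (3 * H / Q * e 2, (R - 1) / 27 * (R + 1 - X)),
        (H / Q * (2 * e 0 + e 1), (R - 1) / 9 * (R - 2 - Y)),
        (H / Q * (2 * e 0 + e 2), (R - 1) / 9 * (R - 2 - Z)),
        (H / Q * (2 * e 1 + e 0), (R - 1) / 9 * (R - 2 - Z)),
        (H / Q * (2 * e 1 + e 2), (R - 1) / 9 * (R - 2 - Y)),
        (H / Q * (2 * e 2 + e 0), (R - 1) / 9 * (R - 2 - Y)),
        (H / Q * (2 * e 2 + e 1), (R - 1) / 9 * (R - 2 - Z)),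
        (- (H / Q), (R - 1) / 9 * (2 * R - 7 - 2 * X)),
        (H / Q * ((R - 1) / 3 + e 0 + e 1), R - 1),
        (H / Q * ((R - 1) / 3 + e 0 + e 2), R - 1),
        (H / Q * ((R - 1) / 3 + e 1 + e 2), R - 1),
        (H * (R - 1) / Q, 1)]" (is "_ \<Longrightarrow> has_value_distribution _ ?D2")
proof -
  define \<delta> where "\<delta> v z = (if H / Q * z = v then 1 else 0 :: complex)" for v z
  define l where "l = (of_nat L :: complex)"
  define w where "w = R - 1"
  define A B C D where "A = w / 27 * (R - 8 - X)" and "B = w / 27 * (R - 2 - Y)"
    and "C = w / 27 * (R - 2 - Z)" and "D = w / 27 * (R + 1 - X)"
  have w: "w = 3 * l" using L_R by (simp only: w_def l_def)
  have count: "of_nat (card {x. (case x of (a, b) \<Rightarrow> \<Lambda> a b) = v})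
      = (\<Sum>(a, b)\<in>UNIV. \<delta> v (per (a + b) + per (g * (a + b * \<beta>)) + per (g\<^sup>2 * (a + b * \<beta>\<^sup>2))))" for v
  proof -
    have "(\<Sum>(a, b)\<in>UNIV. \<delta> v (per (a + b) + per (g * (a + b * \<beta>)) + per (g\<^sup>2 * (a + b * \<beta>\<^sup>2))))
        = (\<Sum>x\<in>{x. (case x of (a, b) \<Rightarrow> \<Lambda> a b) = v}. 1)"
      by (rule sum.mono_neutral_cong_right) (auto simp: \<delta>_def \<Lambda> split: if_splits)
    then show ?thesis by simp
  qed
  have list: "(\<Sum>(u, c)\<leftarrow>xs. if u = v then c else 0) = (\<Sum>(u, c)\<leftarrow>xs. c * (if u = v then 1 else 0 :: complex))" for v xs
    by (intro arg_cong[of _ _ sum_list] map_cong refl) auto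
  have nA: "class_count i j k = (if i = j \<and> j = k then A else if i \<noteq> j \<and> j \<noteq> k \<and> i \<noteq> k then D
      else if (i + j + k) mod 3 = (1::nat) then B else (C::complex))" for i j k
    by (simp add: class_count_def A_def B_def C_def D_def w_def)
  \<comment> \<open>The numerical factors count orderings: 3 for two equal classes, 6 for three
    distinct ones, the latter split evenly between \<open>A\<close> and \<open>D\<close> in the
    second case.\<close>
  have coeffs: "w / 27 * (R - 8 - X) = A" "w / 27 * (R + 1 - X) = D" "w / 9 * (R - 2 - Y) = 3 * B"
    "w / 9 * (R - 2 - Z) = 3 * C" "2 * w / 9 * (R + 1 - X) = 6 * D" "w / 9 * (2 * R - 7 - 2 * X) = 3 * (A + D)"
    by (simp_all add: A_def B_def C_def D_def field_simps)
  have esum: "e 0 + e 1 + e 2 = - 1" by (rule e_sum)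
  have d3: "(if 3 * H / Q * x = v then 1 else 0) = \<delta> v (x + x + x)" for x v
  proof -
    have "3 * H / Q * x = H / Q * (x + x + x)" by (simp add: algebra_simps)
    then show ?thesis by (simp only: \<delta>_def)
  qed
  have d2: "(if H / Q * (2 * x + y) = v then 1 else 0) = \<delta> v (x + x + y)" for x y v
    by (simp only: \<delta>_def mult_2)
  \<comment> \<open>Three distinct classes give the sum of all periods, which is -1; hence the
    listed value \<open>- (H / Q)\<close>.\<close>
  have d1: "(if - (H / Q) = v then 1 else 0) = \<delta> v (e 0 + e 1 + e 2)" for v
    unfolding esum \<delta>_def by simp
  have dl1: "(if H / (3 * Q) * (w + 6 * x) = v then 1 else 0) = \<delta> v (l + x + x)" for x v
  proof -
    have "H / (3 * Q) * (w + 6 * x) = H / (3 * Q) * (3 * (l + x + x))" unfolding w by (simp add: algebra_simps)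
    also have "H / (3 * Q) * (3 * y) = H / Q * y" for y by simp
    finally have "H / (3 * Q) * (w + 6 * x) = H / Q * (l + x + x)" .
    then show ?thesis by (simp only: \<delta>_def)
  qed
  have dl2: "(if H / Q * (w / 3 + x + y) = v then 1 else 0) = \<delta> v (l + x + y)" for x y v
    unfolding w \<delta>_def by simp
  have dl3: "(if H * w / Q = v then 1 else 0) = \<delta> v (l + l + l)" for v
  proof -
    have "H * w / Q = H / Q * (l + l + l)" unfolding w by (simp add: algebra_simps)
    then show ?thesis by (simp only: \<delta>_def)
  qed
  have e_all: "\<forall>i j. i mod 3 = j mod 3 \<longrightarrow> e i = e j" using e_cong by blast
  note sums = sum_triples_combine[where t = "\<lambda>a b c. \<delta> v (a + b + c)" and e = e and n = class_count
      and A = A and B = B and C = C and D = D and E = E for v, OF _ _ e_all nA]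
  have comm: "\<delta> v (a + b + c) = \<delta> v (b + a + c)" "\<delta> v (a + b + c) = \<delta> v (a + c + b)" for v a b c
    by (simp_all only: add_ac)
  show "has_value_distribution (\<lambda>(a, b). \<Lambda> a b) ?D1" if "3 dvd E"
    unfolding has_value_distribution_def
  proof
    fix v
    show "of_nat (card {x. (case x of (a, b) \<Rightarrow> \<Lambda> a b) = v}) = (\<Sum>(u, c)\<leftarrow>?D1. if u = v then c else 0)"
      unfolding count list w_def[symmetric] sum_codewords_classes[of "\<delta> v", folded l_def]
        sums(1)[OF comm that] sums(3)[OF comm that, where l = l]
      by (simp only: list.map sum_list.Cons sum_list.Nil prod.case d3 d2 d1 dl1 dl3 coeffs) (simp add: w algebra_simps)
  qed
  show "has_value_distribution (\<lambda>(a, b). \<Lambda> a b) ?D2" if "\<not> 3 dvd E"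
    unfolding has_value_distribution_def
  proof
    fix v
    show "of_nat (card {x. (case x of (a, b) \<Rightarrow> \<Lambda> a b) = v}) = (\<Sum>(u, c)\<leftarrow>?D2. if u = v then c else 0)"
      unfolding count list w_def[symmetric] sum_codewords_classes[of "\<delta> v", folded l_def]
        sums(2)[OF comm that] sums(4)[OF comm that, where l = l]
      by (simp only: list.map sum_list.Cons sum_list.Nil prod.case d3 d2 d1 dl2 dl3 coeffs) (simp add: w algebra_simps)
  qed
qed

end

theorem theorem2:
  fixes p s m q r h n :: nat
    and \<alpha> g \<beta> :: "'a::finite_field"
    and \<pi> H Q R \<eta>1 \<eta>2 \<eta>3 \<rho> X Y Z :: complex
    and \<Lambda> :: "'a \<Rightarrow> 'a \<Rightarrow> complex"
  assumes "prime p" and "p mod 3 = 1"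
    and "s > 0" and "m > 0"
    and "q = p ^ s" and "r = q ^ m"
    and "card (UNIV :: 'a set) = r"
    and "field_generator \<alpha>"
    and "h > 0" and "h dvd q - 1"
    and "3 dvd gcd (q - 1) (h * m)"
    and "g = \<alpha> ^ ((q - 1) div h)"
    and "n = h * (r - 1) div (q - 1)"
    and "\<beta> = \<alpha> ^ ((r - 1) div 3)"
    and "gcd ((r - 1) div (q - 1)) (3 * (q - 1) div h) = 3"
    and "H = of_nat h" and "Q = of_nat q" and "R = of_nat r"
    and "\<And>a b. \<Lambda> a b = H * (R - 1) / Q - of_nat (hamming_weight (codeword q m n g \<beta> a b))"
    and "\<pi> \<in> eisenstein_ints" and "\<pi> * cnj \<pi> = of_nat p" and "eisenstein_cong \<pi> (-1) 3"
    and "\<rho> = cubic_char p (s * m) \<pi> \<alpha>"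
    and "\<eta>1 = cubic_period p (s * m) (1 :: 'a)"
    and "\<eta>2 = cubic_period p (s * m) \<alpha>"
    and "\<eta>3 = cubic_period p (s * m) (\<alpha> ^ 2)"
    and "X = (-1) ^ (m * s) * (\<pi> ^ (m * s) + cnj \<pi> ^ (m * s))"
    and "Y = (-1) ^ (m * s) * (\<rho> ^ 2 * \<pi> ^ (m * s) + \<rho> * cnj \<pi> ^ (m * s))"
    and "Z = (-1) ^ (m * s) * (\<rho> * \<pi> ^ (m * s) + \<rho> ^ 2 * cnj \<pi> ^ (m * s))"
  shows "\<eta>1 = ((-1) ^ (s * m + 1) * of_nat p ^ (s * m div 3) *
                (\<pi> ^ (s * m div 3) + cnj \<pi> ^ (s * m div 3)) - 1) / 3
    \<and> \<eta>2 = ((-1) ^ (s * m + 1) * of_nat p ^ (s * m div 3) *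
                (\<rho> ^ 2 * \<pi> ^ (s * m div 3) + \<rho> * cnj \<pi> ^ (s * m div 3)) - 1) / 3
    \<and> \<eta>3 = ((-1) ^ (s * m + 1) * of_nat p ^ (s * m div 3) *
                (\<rho> * \<pi> ^ (s * m div 3) + \<rho> ^ 2 * cnj \<pi> ^ (s * m div 3)) - 1) / 3
    \<and> (3 dvd (q - 1) div h \<longrightarrow> has_value_distribution (\<lambda>(a, b). \<Lambda> a b)
       [(3 * H / Q * \<eta>1, (R - 1) / 27 * (R - 8 - X)),
        (3 * H / Q * \<eta>2, (R - 1) / 27 * (R - 8 - X)),
        (3 * H / Q * \<eta>3, (R - 1) / 27 * (R - 8 - X)),
        (H / Q * (2 * \<eta>1 + \<eta>2), (R - 1) / 9 * (R - 2 - Y)),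
        (H / Q * (2 * \<eta>1 + \<eta>3), (R - 1) / 9 * (R - 2 - Z)),
        (H / Q * (2 * \<eta>2 + \<eta>1), (R - 1) / 9 * (R - 2 - Z)),
        (H / Q * (2 * \<eta>2 + \<eta>3), (R - 1) / 9 * (R - 2 - Y)),
        (H / Q * (2 * \<eta>3 + \<eta>1), (R - 1) / 9 * (R - 2 - Y)),
        (H / Q * (2 * \<eta>3 + \<eta>2), (R - 1) / 9 * (R - 2 - Z)),
        (- (H / Q), 2 * (R - 1) / 9 * (R + 1 - X)),
        (H / (3 * Q) * (R - 1 + 6 * \<eta>1), R - 1),
        (H / (3 * Q) * (R - 1 + 6 * \<eta>2), R - 1),
        (H / (3 * Q) * (R - 1 + 6 * \<eta>3), R - 1),
        (H * (R - 1) / Q, 1)])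
    \<and> (\<not> 3 dvd (q - 1) div h \<longrightarrow> has_value_distribution (\<lambda>(a, b). \<Lambda> a b)
       [(3 * H / Q * \<eta>1, (R - 1) / 27 * (R + 1 - X)),
        (3 * H / Q * \<eta>2, (R - 1) / 27 * (R + 1 - X)),
        (3 * H / Q * \<eta>3, (R - 1) / 27 * (R + 1 - X)),
        (H / Q * (2 * \<eta>1 + \<eta>2), (R - 1) / 9 * (R - 2 - Y)),
        (H / Q * (2 * \<eta>1 + \<eta>3), (R - 1) / 9 * (R - 2 - Z)),
        (H / Q * (2 * \<eta>2 + \<eta>1), (R - 1) / 9 * (R - 2 - Z)),
        (H / Q * (2 * \<eta>2 + \<eta>3), (R - 1) / 9 * (R - 2 - Y)),
        (H / Q * (2 * \<eta>3 + \<eta>1), (R - 1) / 9 * (R - 2 - Y)),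
        (H / Q * (2 * \<eta>3 + \<eta>2), (R - 1) / 9 * (R - 2 - Z)),
        (- (H / Q), (R - 1) / 9 * (2 * R - 7 - 2 * X)),
        (H / Q * ((R - 1) / 3 + \<eta>1 + \<eta>2), R - 1),
        (H / Q * ((R - 1) / 3 + \<eta>1 + \<eta>3), R - 1),
        (H / Q * ((R - 1) / 3 + \<eta>2 + \<eta>3), R - 1),
        (H * (R - 1) / Q, 1)])"
proof -
  note qe = \<open>q = p ^ s\<close> and re = \<open>r = q ^ m\<close>
  have r: "r = p ^ (s * m)" by (simp only: qe re power_mult)
  have p1: "p > 1" using \<open>prime p\<close> prime_gt_1_nat by blast
  have q1: "q > 1" unfolding qe using p1 \<open>s > 0\<close> by (rule one_less_power)
  have q3: "q mod 3 = 1"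
    using \<open>p mod 3 = 1\<close> power_mod[of p 3 s] by (simp add: qe)
  define K where "K = (\<Sum>i<m. q ^ i)"
  have "r \<ge> 1" unfolding re using q1 by (intro one_le_power) simp
  have "int r - 1 = (int q - 1) * int K"
    unfolding K_def re by (simp only: of_nat_power power_diff_1_eq of_nat_sum)
  then have "int (r - 1) = int ((q - 1) * K)"
    using q1 \<open>r \<ge> 1\<close> by (simp only: of_nat_diff of_nat_mult less_imp_le of_nat_1)
  then have rK: "r - 1 = (q - 1) * K" by (simp only: of_nat_eq_iff)
  have "3 dvd (r - 1) div (q - 1)" using gcd_dvd1 assms(15) by metis
  then have "3 dvd K" unfolding rK using q1 by simp
  \<comment> \<open>Each of the \<open>m\<close> powers of \<open>q\<close> is 1 modulo 3, so
    divisibility of \<open>K\<close> by 3 passes to \<open>m\<close>.\<close>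
  moreover have "K mod 3 = m mod 3"
  proof -
    have "K mod 3 = (\<Sum>i<m. q ^ i mod 3) mod 3" unfolding K_def by (rule mod_sum_eq[symmetric])
    also have "(\<Sum>i<m. q ^ i mod 3) = m"
      using q3 by (simp only: power_mod[of q 3, symmetric]) simp
    finally show ?thesis .
  qed
  ultimately have m3: "3 dvd m" by presburger
  interpret C: eisenstein_code p "s * m" \<alpha> \<pi> s m h
  proof unfold_locales
    show "card (UNIV :: 'a set) = p ^ (s * m)" using assms(7) r by (simp only:)
    show "3 dvd s * m" using m3 by simp
    show "h dvd p ^ s - 1" using assms(10) by (simp only: qe)
    show "gcd ((p ^ (s * m) - 1) div (p ^ s - 1)) (3 * (p ^ s - 1) div h) = 3"
      using assms(15) by (simp only: qe re power_mult)
  qed (use assms in simp_all)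
  define k where "k = s * m div 3"
  note rr = r[symmetric]
  have qq: "p ^ s = q" by (simp only: qe)
  have M: "C.M = r - 1" by (simp only: C.M_def rr)
  have E: "C.E = (q - 1) div h" by (simp only: C.E_def qq)
  have g: "g = C.g" by (simp only: assms(12) C.g_def E)
  have \<beta>: "\<beta> = C.\<beta>" by (simp only: assms(14) C.\<beta>_def C.L_def M)
  have n: "n = 3 * C.N"
  proof -
    have "h * (r - 1) = (q - 1) * (h * C.K)"
      unfolding C.K_q[unfolded M qq, symmetric] by (simp only: mult_ac)
    then show ?thesis using q1 by (simp only: assms(13) C.N_eq) simp
  qed
  have \<rho>: "\<rho> = C.\<rho>" by (simp only: assms(23) C.\<rho>_def)
  have e: "\<eta>1 = C.e 0" "\<eta>2 = C.e 1" "\<eta>3 = C.e 2"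
    by (simp_all add: assms(24-26) C.e_def C.per_def)
  have X: "X = C.X" and Y: "Y = C.Y" and Z: "Z = C.Z"
    unfolding assms(27-29) C.X_def C.Y_def C.Z_def \<rho> by (simp_all only: mult.commute[of m s])
  have R: "R = of_nat (p ^ (s * m))" by (simp only: assms(18) rr)
  have \<Lambda>: "\<Lambda> a b = H / Q * (C.per (a + b) + C.per (C.g * (a + b * C.\<beta>)) + C.per (C.g\<^sup>2 * (a + b * C.\<beta>\<^sup>2)))" for a b
  proof -
    have Q: "Q \<noteq> 0" using q1 by (simp only: assms(17)) simp
    have "of_nat C.M = R - 1" using C.r_eq by (simp only: R) simp
    then have "Q * \<Lambda> a b = H * (C.per (a + b) + C.per (C.g * (a + b * C.\<beta>)) + C.per (C.g\<^sup>2 * (a + b * C.\<beta>\<^sup>2)))"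
      using C.hamming_weight_codeword[of a b]
      by (simp only: assms(16,17,19) n g \<beta> qq)
    then show ?thesis using Q by (simp add: field_simps)
  qed
  note dist = C.value_distribution[OF \<Lambda>]
  have "\<eta>1 = ((-1) ^ (s * m + 1) * of_nat p ^ (s * m div 3) *
      (\<pi> ^ (s * m div 3) + cnj \<pi> ^ (s * m div 3)) - 1) / 3"
    using C.e_eqs(1) unfolding e C.gauss_eq C.gauss_square_eq k_def[symmetric] by (simp add: algebra_simps)
  moreover have "\<eta>2 = ((-1) ^ (s * m + 1) * of_nat p ^ (s * m div 3) *
      (\<rho> ^ 2 * \<pi> ^ (s * m div 3) + \<rho> * cnj \<pi> ^ (s * m div 3)) - 1) / 3"
    using C.e_eqs(2) unfolding e \<rho> C.gauss_eq C.gauss_square_eq k_def[symmetric] by (simp add: algebra_simps)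
  moreover have "\<eta>3 = ((-1) ^ (s * m + 1) * of_nat p ^ (s * m div 3) *
      (\<rho> * \<pi> ^ (s * m div 3) + \<rho> ^ 2 * cnj \<pi> ^ (s * m div 3)) - 1) / 3"
    using C.e_eqs(3) unfolding e \<rho> C.gauss_eq C.gauss_square_eq k_def[symmetric] by (simp add: algebra_simps)
  ultimately show ?thesis
    unfolding e X Y Z R E[symmetric] using dist by blast
qed

end
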